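(* Let $\Sigma$ be a complete properly immersed self-expander hypersurface in $\mathbb{R}^{n+1}$. Assume that its mean curvature $H$ satisfies $|H|(x)\le a|x|+b$ for all $x\in\Sigma$, for some constants $0\le a<\frac12$ and $b>0$. Then the bottom $\mu_1$ of the spectrum of the $L$-stability operator $L=\Delta+\frac12\langle x,\nabla\cdot\rangle+|A|^2-\frac12$ satisfies $$\mu_1\le\frac{(\alpha+1)n+2}{4}+\frac{\int_\Sigma\left[Scal_\Sigma+(\alpha-1)\left(\frac12H^2-\frac{\alpha+1}{16}|x^T|^2\right)\right]e^{-\frac\alpha4|x|^2}\,d\sigma}{\int_\Sigma e^{-\frac\alpha4|x|^2}\,d\sigma}$$ for all $\alpha>\frac{a^2}{\frac14-a^2}$.
   Context: $x$ denotes the position vector, $x^T$ and $x^\perp$ its tangent and normal components along $\Sigma$. For an immersed hypersurface $\Sigma$ with induced metric, volume form $d\sigma$, gradient $\nabla$ and Laplacian $\Delta$, the second fundamental form is $A(X,Y)=(\overline\nabla_XY)^\perp$ ($\overline\nabla$ the Euclidean connection), the mean curvature vector $\mathbf{H}$ is its trace, and $\Sigma$ is a self-expander if $\mathbf{H}=\frac12x^\perp$. The mean curvature $H$ is defined by $\mathbf{H}=-H\mathbf{n}$, $\mathbf{n}$ the unit normal, and $Scal_\Sigma=H^2-|A|^2$ is the scalar curvature. $\Sigma$ is properly immersed if the preimage under the immersion of every compact subset of $\mathbb{R}^{n+1}$ is compact. The bottom of the (weighted $L^2$) spectrum of $L$ is $$\mu_1=\inf\left\{\frac{\int_\Sigma\left(|\nabla\varphi|^2-(|A|^2-\frac12)\varphi^2\right)e^{\frac{|x|^2}{4}}d\sigma}{\int_\Sigma\varphi^2e^{\frac{|x|^2}{4}}d\sigma}:\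 \varphi\in C_0^\infty(\Sigma),\ \int_\Sigma\varphi^2e^{\frac{|x|^2}{4}}d\sigma\ne0\right\}\in[-\infty,\infty),$$ and inequalities are understood in the extended reals; in particular the bound is trivially true when $\mu_1=-\infty$. *)

theory Defs
  imports "HOL-Analysis.Analysis"
begin

section \<open>Smooth manifolds, given by local parametrizations\<close>

primrec Ck_on :: "nat \<Rightarrow> 'a::real_normed_vector set \<Rightarrow> ('a \<Rightarrow> 'b::real_normed_vector) \<Rightarrow> bool" where
  "Ck_on 0 S f \<longleftrightarrow> continuous_on S f"
| "Ck_on (Suc k) S f \<longleftrightarrow>
     (\<forall>x\<in>S. f differentiable (at x)) \<and> (\<forall>v. Ck_on k S (\<lambda>x. frechet_derivative f (at x) v))"

text \<open>Only used for open \<open>S\<close>.\<close>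

definition smooth_on :: "'a::real_normed_vector set \<Rightarrow> ('a \<Rightarrow> 'b::real_normed_vector) \<Rightarrow> bool" where
  "smooth_on S f \<longleftrightarrow> (\<forall>k. Ck_on k S f)"

text \<open>The manifold is the whole type \<open>'m\<close> (a second countable Hausdorff space where it matters).
  Its smooth structure is an atlas in the form of parametrizations \<open>\<phi> : U \<rightarrow> 'm\<close>, that is, of
  inverses of coordinate charts; \<open>\<phi>\<close> is irrelevant outside \<open>U\<close>.\<close>

type_synonym ('n, 'm) atlas = "((real^'n) set \<times> (real^'n \<Rightarrow> 'm)) set"

definition smooth_atlas :: "('n::finite, 'm::topological_space) atlas \<Rightarrow> bool" where
  "smooth_atlas \<A> \<longleftrightarrow>
     (\<forall>(U, \<phi>)\<in>\<A>. open U \<and> open (\<phi> ` U) \<and> inj_on \<phi> U \<and>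
        homeomorphism U (\<phi> ` U) \<phi> (the_inv_into U \<phi>)) \<and>
     (\<Union>(U, \<phi>)\<in>\<A>. \<phi> ` U) = UNIV \<and>
     (\<forall>(U, \<phi>)\<in>\<A>. \<forall>(V, \<psi>)\<in>\<A>. smooth_on {u\<in>U. \<phi> u \<in> \<psi> ` V} (the_inv_into V \<psi> \<circ> \<phi>))"

definition smooth_map ::
    "('n::finite, 'm::topological_space) atlas \<Rightarrow> ('m \<Rightarrow> 'b::real_normed_vector) \<Rightarrow> bool" where
  "smooth_map \<A> f \<longleftrightarrow> (\<forall>(U, \<phi>)\<in>\<A>. smooth_on U (f \<circ> \<phi>))"

definition immersed_hypersurface ::
    "('n::finite, 'm::topological_space) atlas \<Rightarrow> ('m \<Rightarrow> 'e::euclidean_space) \<Rightarrow> bool" where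
  "immersed_hypersurface \<A> F \<longleftrightarrow>
     DIM('e) = CARD('n) + 1 \<and> smooth_atlas \<A> \<and> smooth_map \<A> F \<and>
     (\<forall>(U, \<phi>)\<in>\<A>. \<forall>u\<in>U. inj (frechet_derivative (F \<circ> \<phi>) (at u)))"

definition properly_immersed :: "('m::topological_space \<Rightarrow> 'e::euclidean_space) \<Rightarrow> bool" where
  "properly_immersed F \<longleftrightarrow> (\<forall>K. compact K \<longrightarrow> compact (F -` K))"


section \<open>Geometry of a parametrized hypersurface \<open>X = F \<circ> \<phi>\<close>\<close>

definition tangential_part :: "'e::euclidean_space set \<Rightarrow> 'e \<Rightarrow> 'e" where
  "tangential_part T x = (THE y. y \<in> T \<and> (\<forall>w\<in>T. orthogonal (x - y) w))"

definition normal_part :: "'e::euclidean_space set \<Rightarrow> 'e \<Rightarrow> 'e" where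
  "normal_part T x = x - tangential_part T x"

definition pd :: "(real^'n \<Rightarrow> 'b::real_normed_vector) \<Rightarrow> 'n::finite \<Rightarrow> real^'n \<Rightarrow> 'b" where
  "pd f i u = frechet_derivative f (at u) (axis i 1)"

definition loc_tangent :: "(real^'n::finite \<Rightarrow> 'e::euclidean_space) \<Rightarrow> real^'n \<Rightarrow> 'e set" where
  "loc_tangent X u = range (frechet_derivative X (at u))"

definition loc_metric :: "(real^'n::finite \<Rightarrow> 'e::euclidean_space) \<Rightarrow> real^'n \<Rightarrow> real^'n^'n" where
  "loc_metric X u = (\<chi> i j. pd X i u \<bullet> pd X j u)"

definition loc_metric_inv :: "(real^'n::finite \<Rightarrow> 'e::euclidean_space) \<Rightarrow> real^'n \<Rightarrow> real^'n^'n" where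
  "loc_metric_inv X u = matrix_inv (loc_metric X u)"

text \<open>The components \<open>A(\<partial>\<^sub>i, \<partial>\<^sub>j)\<close> of the second fundamental form: the Euclidean derivative
  of the coordinate field \<open>\<partial>\<^sub>j X\<close> in the direction \<open>\<partial>\<^sub>i X\<close> is \<open>\<partial>\<^sub>i \<partial>\<^sub>j X\<close>.\<close>

definition loc_sff ::
    "(real^'n::finite \<Rightarrow> 'e::euclidean_space) \<Rightarrow> 'n \<Rightarrow> 'n \<Rightarrow> real^'n \<Rightarrow> 'e" where
  "loc_sff X i j u = normal_part (loc_tangent X u) (pd (pd X j) i u)"

definition loc_sff_norm2 :: "(real^'n::finite \<Rightarrow> 'e::euclidean_space) \<Rightarrow> real^'n \<Rightarrow> real" where
  "loc_sff_norm2 X u =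
     (\<Sum>i\<in>UNIV. \<Sum>j\<in>UNIV. \<Sum>k\<in>UNIV. \<Sum>l\<in>UNIV.
        loc_metric_inv X u $ i $ k * loc_metric_inv X u $ j $ l * (loc_sff X i j u \<bullet> loc_sff X k l u))"

definition loc_mean_curvature_vector ::
    "(real^'n::finite \<Rightarrow> 'e::euclidean_space) \<Rightarrow> real^'n \<Rightarrow> 'e" where
  "loc_mean_curvature_vector X u =
     (\<Sum>i\<in>UNIV. \<Sum>j\<in>UNIV. loc_metric_inv X u $ i $ j *\<^sub>R loc_sff X i j u)"

text \<open>The gradient of a function with coordinate expression \<open>h\<close>, as a tangent vector of the
  ambient space.\<close>

definition loc_gradient ::
    "(real^'n::finite \<Rightarrow> 'e::euclidean_space) \<Rightarrow> (real^'n \<Rightarrow> real) \<Rightarrow> real^'n \<Rightarrow> 'e" where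
  "loc_gradient X h u =
     (\<Sum>i\<in>UNIV. \<Sum>j\<in>UNIV. (loc_metric_inv X u $ i $ j * pd h i u) *\<^sub>R pd X j u)"


section \<open>Geometric quantities as functions on the manifold\<close>

text \<open>A point \<open>p\<close> is represented as \<open>\<phi> u\<close> for some parametrization of the atlas. All quantities
  to which this is applied below are independent of the choice.\<close>

definition local_rep ::
    "('n::finite, 'm) atlas \<Rightarrow> 'm \<Rightarrow> (real^'n \<Rightarrow> 'm) \<times> (real^'n)" where
  "local_rep \<A> p = (SOME (\<phi>, u). \<exists>U. (U, \<phi>) \<in> \<A> \<and> u \<in> U \<and> \<phi> u = p)"

definition at_point ::
    "('n::finite, 'm) atlas \<Rightarrow> ((real^'n \<Rightarrow> 'm) \<Rightarrow> real^'n \<Rightarrow> 'b) \<Rightarrow> 'm \<Rightarrow> 'b" where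
  "at_point \<A> Q p = (case local_rep \<A> p of (\<phi>, u) \<Rightarrow> Q \<phi> u)"

context
  fixes \<A> :: "('n::finite, 'm::topological_space) atlas"
    and F :: "'m \<Rightarrow> 'e::euclidean_space"
begin

definition tangent_space :: "'m \<Rightarrow> 'e set" where
  "tangent_space = at_point \<A> (\<lambda>\<phi>. loc_tangent (F \<circ> \<phi>))"

definition sff_norm2 :: "'m \<Rightarrow> real" where
  "sff_norm2 = at_point \<A> (\<lambda>\<phi>. loc_sff_norm2 (F \<circ> \<phi>))"

definition mean_curvature_vector :: "'m \<Rightarrow> 'e" where
  "mean_curvature_vector = at_point \<A> (\<lambda>\<phi>. loc_mean_curvature_vector (F \<circ> \<phi>))"

definition gradient :: "('m \<Rightarrow> real) \<Rightarrow> 'm \<Rightarrow> 'e" where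
  "gradient f = at_point \<A> (\<lambda>\<phi>. loc_gradient (F \<circ> \<phi>) (f \<circ> \<phi>))"

definition pos_tangential :: "'m \<Rightarrow> 'e" where
  "pos_tangential p = tangential_part (tangent_space p) (F p)"

definition pos_normal :: "'m \<Rightarrow> 'e" where
  "pos_normal p = normal_part (tangent_space p) (F p)"

definition self_expander :: bool where
  "self_expander \<longleftrightarrow> (\<forall>p. mean_curvature_vector p = (1/2) *\<^sub>R pos_normal p)"

text \<open>No continuity is required: the hypersurface need not be two-sided, and only quantities
  that do not depend on the sign of the normal are used.\<close>

definition unit_normal :: "('m \<Rightarrow> 'e) \<Rightarrow> bool" where
  "unit_normal N \<longleftrightarrow> (\<forall>p. norm (N p) = 1 \<and> (\<forall>w\<in>tangent_space p. orthogonal (N p) w))"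

text \<open>The scalar \<open>H\<close> with mean curvature vector \<open>- H N\<close>.\<close>

definition mean_curvature :: "('m \<Rightarrow> 'e) \<Rightarrow> 'm \<Rightarrow> real" where
  "mean_curvature N p = - (mean_curvature_vector p \<bullet> N p)"

definition scalar_curvature :: "('m \<Rightarrow> 'e) \<Rightarrow> 'm \<Rightarrow> real" where
  "scalar_curvature N p = (mean_curvature N p)\<^sup>2 - sff_norm2 p"

text \<open>Characterizes \<open>\<sigma>\<close> uniquely: in coordinates, \<open>d\<sigma> = sqrt (det g) du\<close>.\<close>

definition volume_measure :: "'m measure \<Rightarrow> bool" where
  "volume_measure \<sigma> \<longleftrightarrow> sets \<sigma> = sets borel \<and>
     (\<forall>(U, \<phi>)\<in>\<A>. \<forall>B\<in>sets borel. B \<subseteq> \<phi> ` U \<longrightarrow>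
        emeasure \<sigma> B =
          (\<integral>\<^sup>+ u\<in>{u\<in>U. \<phi> u \<in> B}. ennreal (sqrt (det (loc_metric (F \<circ> \<phi>) u))) \<partial>lborel))"

definition bottom_spectrum :: "'m measure \<Rightarrow> ereal" where
  "bottom_spectrum \<sigma> =
     (INF f \<in> {f. smooth_map \<A> f \<and> compact (closure {p. f p \<noteq> 0}) \<and>
                  (LINT p|\<sigma>. (f p)\<^sup>2 * exp ((norm (F p))\<^sup>2 / 4)) \<noteq> 0}.
        ereal ((LINT p|\<sigma>. ((norm (gradient f p))\<^sup>2 - (sff_norm2 p - 1/2) * (f p)\<^sup>2)
                             * exp ((norm (F p))\<^sup>2 / 4))
               / (LINT p|\<sigma>. (f p)\<^sup>2 * exp ((norm (F p))\<^sup>2 / 4))))"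

end

text \<open>Intrinsic distance. The length of a curve for the induced metric is the Euclidean length of
  its image; as \<open>F\<close> is an immersion, a continuous curve \<open>\<gamma>\<close> in the manifold is piecewise
  \<open>C\<^sup>1\<close> iff \<open>F \<circ> \<gamma>\<close> is. Points in different components have infinite distance.\<close>

definition intrinsic_dist ::
    "('m::topological_space \<Rightarrow> 'e::euclidean_space) \<Rightarrow> 'm \<Rightarrow> 'm \<Rightarrow> ennreal" where
  "intrinsic_dist F p q =
     (INF \<gamma> \<in> {\<gamma>. path \<gamma> \<and> pathstart \<gamma> = p \<and> pathfinish \<gamma> = q \<and> valid_path (F \<circ> \<gamma>)}.
        \<integral>\<^sup>+ t\<in>{0..1}. ennreal (norm (vector_derivative (F \<circ> \<gamma>) (at t))) \<partial>lborel)"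

definition complete_immersed :: "('m::topological_space \<Rightarrow> 'e::euclidean_space) \<Rightarrow> bool" where
  "complete_immersed F \<longleftrightarrow>
     (\<forall>s :: nat \<Rightarrow> 'm.
        (\<forall>\<epsilon>>0. \<exists>n0. \<forall>i\<ge>n0. \<forall>j\<ge>n0. intrinsic_dist F (s i) (s j) < \<epsilon>) \<longrightarrow>
        (\<exists>p. s \<longlonglongrightarrow> p))"

text \<open>Integral with values in the extended reals; meaningful unless positive and negative part
  are both infinite.\<close>

definition ext_integral :: "'m measure \<Rightarrow> ('m \<Rightarrow> real) \<Rightarrow> ereal" where
  "ext_integral \<sigma> f =
     enn2ereal (\<integral>\<^sup>+ p. ennreal (f p) \<partial>\<sigma>) - enn2ereal (\<integral>\<^sup>+ p. ennreal (- f p) \<partial>\<sigma>)"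

end

theory Submission
  imports Defs
begin

text \<open>With \<open>\<phi> = exp (- (\<alpha> + 1) |x|\<^sup>2 / 8)\<close> one has \<open>\<phi>\<^sup>2 exp (|x|\<^sup>2 / 4) = w\<close> for \<open>w = exp (- \<alpha> |x|\<^sup>2 / 4)\<close>, and
  \<open>|\<nabla>\<phi>|\<^sup>2 = (\<alpha> + 1)\<^sup>2 / 16 |x\<^sup>T|\<^sup>2 \<phi>\<^sup>2\<close>. On a self-expander \<open>div x\<^sup>T = n + 2 H\<^sup>2\<close>, so integrating
  \<open>div (w x\<^sup>T)\<close> gives \<open>\<integral> (n + 2 H\<^sup>2) w = \<alpha>/2 \<integral> |x\<^sup>T|\<^sup>2 w\<close>, which turns the Rayleigh quotient of
  \<open>\<phi>\<close> into the claimed bound. To make this rigorous, \<open>\<phi>\<close> is multiplied by the smooth cutoff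
  \<open>h (R - |x|\<^sup>2)\<close> with \<open>h t = exp (- 1/t)\<close> for \<open>t > 0\<close>, which increases to \<open>1\<close> as \<open>R\<close> grows. Since \<open>h\<close> is
  increasing, the cutoff term in the divergence identity has a sign; as \<open>|x\<^sup>T|\<^sup>2 = |x|\<^sup>2 - 4 H\<^sup>2\<close>, the
  growth condition on \<open>H\<close> then bounds \<open>\<integral> (1 + |x|\<^sup>2) w\<close> without any a priori volume growth. If
  \<open>\<integral> |A|\<^sup>2 w\<close> diverges, both sides are \<open>- \<infinity>\<close>.\<close>

section \<open>Functions of class $C^k$\<close>

text \<open>The infimum admits only smooth test functions of compact support. A cutoff in |x|^2 has
  compact support because the immersion is proper, but its gradient is not small: its size is 2 h'
  |x^T|, and uniformly in R only h' \<le> 2 is available. This is why integrability of (1 + |x|^2) w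
  is sought and not just that of w: this one function dominates every error term, and the error
  terms vanish in the limit because h' (R - |x|^2) tends to 0 pointwise.

  The encoding of the geometry sets the other task. Each quantity at a point is computed in a
  parametrization picked by choice, and \<open>N\<close> is any unit normal, possibly discontinuous.
  So every quantity is shown to be invariant under transition maps, and continuity is proved only
  for expressions that do not see the sign of \<open>N\<close>. The divergence theorem is applied to
  C^1 fields, so it can be localized with elementary C^1 bumps; \<open>Ck_on\<close> serves both
  this and the smooth test functions.\<close>

lemma Ck_on_cong:
  assumes "open S" "\<And>x. x \<in> S \<Longrightarrow> f x = g x" "Ck_on k S f"
  shows "Ck_on k S g"
  using assms(2,3)
proof (induction k arbitrary: f g)
  case 0
  then show ?case by (simp cong: continuous_on_cong)
next
  case (Suc k)
  have d: "f differentiable at x" if "x \<in> S" for x using Suc.prems that by simp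
  have e: "frechet_derivative f (at x) = frechet_derivative g (at x)" if "x \<in> S" for x
    by (rule frechet_derivative_transform_within_open[OF d[OF that] assms(1) that]) (use Suc.prems in auto)
  have "g differentiable at x" if "x \<in> S" for x
    using d[OF that] has_derivative_transform_within_open[OF _ assms(1) that] Suc.prems(1)
    unfolding differentiable_def by blast
  moreover have "Ck_on k S (\<lambda>x. frechet_derivative g (at x) v)" for v
    by (rule Suc.IH[of "\<lambda>x. frechet_derivative f (at x) v"]) (use Suc.prems e in auto)
  ultimately show ?case by simp
qed

lemma Ck_on_subset: "Ck_on k S f \<Longrightarrow> T \<subseteq> S \<Longrightarrow> Ck_on k T f"
  by (induction k arbitrary: f) (auto intro: continuous_on_subset)

lemma Ck_on_Suc_imp: "Ck_on (Suc k) S f \<Longrightarrow> Ck_on k S f"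
proof (induction k arbitrary: f)
  case 0
  then show ?case
    by (auto intro!: continuous_at_imp_continuous_on differentiable_imp_continuous_within)
qed auto

lemma Ck_on_imp_continuous_on: "Ck_on k S f \<Longrightarrow> continuous_on S f"
  by (induction k) (simp, blast dest: Ck_on_Suc_imp)

lemma Ck_on_const: "Ck_on k S (\<lambda>x. c)"
  by (induction k arbitrary: c) auto

text \<open>\<open>Ck_on\<close> speaks of the choice-defined \<open>frechet_derivative\<close>; by
  uniqueness of derivatives an explicit formula \<open>f'\<close> may stand in for it on an open
  set.\<close>

lemma Ck_on_SucI:
  assumes "open S" "\<And>x. x \<in> S \<Longrightarrow> (f has_derivative f' x) (at x)"
    "\<And>v. Ck_on k S (\<lambda>x. f' x v)"
  shows "Ck_on (Suc k) S f"
proof -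
  have "Ck_on k S (\<lambda>x. frechet_derivative f (at x) v)" for v
    by (rule Ck_on_cong[OF assms(1) _ assms(3)[of v]]) (use frechet_derivative_at assms(2) in metis)
  then show ?thesis using assms(2) by (auto simp: differentiable_def)
qed

lemma Ck_on_Suc_has_derivative:
  "Ck_on (Suc k) S f \<Longrightarrow> x \<in> S \<Longrightarrow> (f has_derivative frechet_derivative f (at x)) (at x)"
  by (auto simp: frechet_derivative_works)

lemma Ck_on_Suc_frechet_derivative:
  "Ck_on (Suc k) S f \<Longrightarrow> Ck_on k S (\<lambda>x. frechet_derivative f (at x) v)"
  by simp

lemma Ck_on_bounded_linear_compose:
  assumes "bounded_linear L" "open S" "Ck_on k S f"
  shows "Ck_on k S (\<lambda>x. L (f x))"
  using assms(3)
proof (induction k arbitrary: f)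
  case 0
  then show ?case by (auto intro!: bounded_linear.continuous_on[OF assms(1)])
next
  case (Suc k)
  show ?case
    by (rule Ck_on_SucI[OF assms(2), where f' = "\<lambda>x v. L (frechet_derivative f (at x) v)"])
       (use Suc bounded_linear.has_derivative[OF assms(1) Ck_on_Suc_has_derivative[OF Suc.prems]]
         in \<open>auto\<close>)
qed

lemma Ck_on_bounded_linear:
  assumes "bounded_linear L"
  shows "Ck_on k S L"
proof (cases k)
  case 0
  then show ?thesis using assms by (simp add: linear_continuous_on)
next
  case (Suc m)
  have "(L has_derivative L) (at x)" for x using assms bounded_linear_imp_has_derivative by blast
  then have "frechet_derivative L (at x) = L" "L differentiable (at x)" for x
    using frechet_derivative_at by (metis, auto simp: differentiable_def)
  then show ?thesis using Suc by (simp add: Ck_on_const)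
qed

lemma Ck_on_add:
  assumes "open S" "Ck_on k S f" "Ck_on k S g"
  shows "Ck_on k S (\<lambda>x. f x + g x)"
  using assms(2,3)
proof (induction k arbitrary: f g)
  case 0
  then show ?case by (auto intro!: continuous_intros)
next
  case (Suc k)
  show ?case
    by (rule Ck_on_SucI[OF assms(1) has_derivative_add[OF Ck_on_Suc_has_derivative[OF Suc.prems(1)]
            Ck_on_Suc_has_derivative[OF Suc.prems(2)]]])
       (use Suc in auto)
qed

text \<open>One induction for all bilinear products, instantiated for real multiplication and the
  inner product. The product rule contains \<open>f\<close> and \<open>g\<close> themselves, hence
  the weakening by \<open>Ck_on_Suc_imp\<close>.\<close>

lemma (in bounded_bilinear) Ck_on_prod_compose:
  assumes "open S" "Ck_on k S f" "Ck_on k S g"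
  shows "Ck_on k S (\<lambda>x. prod (f x) (g x))"
  using assms(2,3)
proof (induction k arbitrary: f g)
  case 0
  then show ?case by (auto intro!: continuous_on)
next
  case (Suc k)
  have "Ck_on k S f" "Ck_on k S g"
    using Suc.prems Ck_on_Suc_imp by blast+
  then show ?case
    by (intro Ck_on_SucI[OF assms(1) FDERIV[OF Ck_on_Suc_has_derivative[OF Suc.prems(1)]
            Ck_on_Suc_has_derivative[OF Suc.prems(2)]]] Ck_on_add assms(1))
       (use Suc in auto)
qed

lemmas Ck_on_mult = bounded_bilinear.Ck_on_prod_compose[OF bounded_bilinear_mult]
lemmas Ck_on_inner = bounded_bilinear.Ck_on_prod_compose[OF bounded_bilinear_inner]

lemma Ck_on_sum:
  "open S \<Longrightarrow> (\<And>i. i \<in> I \<Longrightarrow> Ck_on k S (f i)) \<Longrightarrow> Ck_on k S (\<lambda>x. \<Sum>i\<in>I. f i x)"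
  by (induction I rule: infinite_finite_induct) (auto intro: Ck_on_const Ck_on_add)

lemma Ck_on_prod:
  fixes f :: "'i \<Rightarrow> 'a::real_normed_vector \<Rightarrow> real"
  shows "open S \<Longrightarrow> (\<And>i. i \<in> I \<Longrightarrow> Ck_on k S (f i)) \<Longrightarrow> Ck_on k S (\<lambda>x. \<Prod>i\<in>I. f i x)"
  by (induction I rule: infinite_finite_induct) (auto intro: Ck_on_const Ck_on_mult)

lemma Ck_on_diff:
  assumes "open S" "Ck_on k S f" "Ck_on k S g"
  shows "Ck_on k S (\<lambda>x. f x - g x)"
  using Ck_on_add[OF assms(1,2) Ck_on_bounded_linear_compose[OF bounded_linear_minus[OF bounded_linear_ident] assms(1,3)]]
  by simp

text \<open>With a real intermediate value the chain rule is an ordinary product, because a linear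
  map on the reals is multiplication by its value at 1. The induction then closes with
  \<open>Ck_on_mult\<close>.\<close>

lemma Ck_on_compose_real:
  fixes f :: "'a::real_normed_vector \<Rightarrow> real" and g :: "real \<Rightarrow> real"
  assumes "open S" "f ` S \<subseteq> T" "Ck_on k S f" "Ck_on k T g"
  shows "Ck_on k S (\<lambda>x. g (f x))"
  using assms(3,4)
proof (induction k arbitrary: g)
  case 0
  then show ?case using assms(2) by (auto intro!: continuous_on_compose2[of T g S f])
next
  case (Suc k)
  have f: "(f has_derivative frechet_derivative f (at x)) (at x)" if "x \<in> S" for x
    using Ck_on_Suc_has_derivative[OF Suc.prems(1) that] .
  have g: "(g has_derivative frechet_derivative g (at (f x))) (at (f x))" if "x \<in> S" for x
    using Ck_on_Suc_has_derivative[OF Suc.prems(2)] that assms(2) by blast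
  have lin: "frechet_derivative g (at (f x)) c = frechet_derivative g (at (f x)) 1 * c"
    if "x \<in> S" for x and c :: real
    using linear_scale[OF has_derivative_linear[OF g[OF that]], of c 1] by (simp add: mult.commute)
  show ?case
  proof (rule Ck_on_SucI[OF assms(1)])
    fix x assume x: "x \<in> S"
    show "((\<lambda>x. g (f x)) has_derivative
        (\<lambda>v. frechet_derivative g (at (f x)) 1 * frechet_derivative f (at x) v)) (at x)"
    proof (rule has_derivative_eq_rhs)
      show "((\<lambda>x. g (f x)) has_derivative
          (\<lambda>v. frechet_derivative g (at (f x)) (frechet_derivative f (at x) v))) (at x)"
        using diff_chain_at[OF f[OF x] g[OF x]] by (simp add: o_def)
    qed (rule ext, rule lin[OF x])
  next
    fix v
    show "Ck_on k S (\<lambda>x. frechet_derivative g (at (f x)) 1 * frechet_derivative f (at x) v)"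
      by (rule Ck_on_mult[OF assms(1) Suc.IH[OF Ck_on_Suc_imp[OF Suc.prems(1)]
              Ck_on_Suc_frechet_derivative[OF Suc.prems(2)]]
            Ck_on_Suc_frechet_derivative[OF Suc.prems(1)]])
  qed
qed

lemma Ck_on_real_SucI:
  fixes g :: "real \<Rightarrow> real"
  assumes "open T" "\<And>t. t \<in> T \<Longrightarrow> (g has_real_derivative g' t) (at t)" "Ck_on k T g'"
  shows "Ck_on (Suc k) T g"
  by (rule Ck_on_SucI[OF assms(1) assms(2)[unfolded has_field_derivative_def]])
     (auto intro!: Ck_on_mult assms Ck_on_const)

text \<open>The factor \<open>C\<close> makes the family closed under differentiation, which
  multiplies it by \<open>c\<close>.\<close>

lemma Ck_on_exp_linear: "Ck_on k UNIV (\<lambda>t::real. C * exp (c * t))"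
proof (induction k arbitrary: C)
  case (Suc k)
  have "((\<lambda>t. C * exp (c * t)) has_real_derivative (C * c) * exp (c * t)) (at t)" for t
    by (auto intro!: derivative_eq_intros)
  then show ?case
    by (intro Ck_on_real_SucI[OF open_UNIV _ Suc.IH])
qed (auto intro!: continuous_intros)

section \<open>Partial derivatives and their symmetry\<close>

lemma Ck_on_Suc_pd: "Ck_on (Suc k) S f \<Longrightarrow> Ck_on k S (pd f i)"
  unfolding pd_def by (rule Ck_on_Suc_frechet_derivative)

lemma smooth_on_pd: "smooth_on S f \<Longrightarrow> smooth_on S (pd f i)"
  unfolding smooth_on_def by (blast intro: Ck_on_Suc_pd)

lemma frechet_derivative_eq_sum_pd:
  fixes f :: "real^'n \<Rightarrow> 'b::real_normed_vector"
  assumes "f differentiable (at u)"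
  shows "frechet_derivative f (at u) v = (\<Sum>i\<in>UNIV. v $ i *\<^sub>R pd f i u)"
proof -
  have "frechet_derivative f (at u) v = frechet_derivative f (at u) (\<Sum>i\<in>UNIV. v $ i *\<^sub>R axis i 1)"
    using basis_expansion[of v] by (simp add: scalar_mult_eq_scaleR)
  also have "\<dots> = (\<Sum>i\<in>UNIV. v $ i *\<^sub>R pd f i u)"
    using linear_frechet_derivative[OF assms] by (simp add: linear_sum linear_scale pd_def)
  finally show ?thesis .
qed

lemma pd_eqI: "(f has_derivative f') (at u) \<Longrightarrow> pd f i u = f' (axis i 1)"
  unfolding pd_def using frechet_derivative_at by metis

text \<open>Schwarz: the second difference quotient of \<open>f\<close> at \<open>x\<close> along \<open>v\<close> and \<open>w\<close> converges to
  both mixed derivatives.\<close>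

lemma second_difference_eq:
  fixes f :: "'a::real_normed_vector \<Rightarrow> real"
  assumes S: "open S" "convex S" "Ck_on 2 S f" and h: "0 < h"
    and inS: "x \<in> S" "x + h *\<^sub>R v \<in> S" "x + h *\<^sub>R w \<in> S" "x + h *\<^sub>R v + h *\<^sub>R w \<in> S"
  shows "\<exists>s t. 0 < s \<and> s < h \<and> 0 < t \<and> t < h \<and>
    f (x + h *\<^sub>R v + h *\<^sub>R w) - f (x + h *\<^sub>R v) - f (x + h *\<^sub>R w) + f x
      = h * h * frechet_derivative (\<lambda>y. frechet_derivative f (at y) v) (at (x + s *\<^sub>R v + t *\<^sub>R w)) w"
proof -
  have C2: "Ck_on (Suc (Suc 0)) S f" using S(3) by (simp add: numeral_2_eq_2)
  note f' = Ck_on_Suc_has_derivative[OF C2]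
  note f'' = Ck_on_Suc_has_derivative[OF Ck_on_Suc_frechet_derivative[OF C2]]
  have seg: "y + (t/h) *\<^sub>R (z - y) \<in> S" if "y \<in> S" "z \<in> S" "0 \<le> t" "t \<le> h" for y z t
  proof -
    have "(1 - t/h) *\<^sub>R y + (t/h) *\<^sub>R z \<in> S"
      using that h S(2) by (intro convexD_alt) auto
    then show ?thesis by (simp add: algebra_simps)
  qed
  have s1: "x + t *\<^sub>R v \<in> S" if "0 \<le> t" "t \<le> h" for t
    using seg[OF inS(1,2) that] h by simp
  have s2: "x + t *\<^sub>R v + h *\<^sub>R w \<in> S" if "0 \<le> t" "t \<le> h" for t
    using seg[OF inS(3,4) that] h by (simp add: algebra_simps)
  have s3: "x + s *\<^sub>R v + t *\<^sub>R w \<in> S" if "0 \<le> s" "s \<le> h" "0 \<le> t" "t \<le> h" for s t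
    using seg[OF s1[OF that(1,2)] s2[OF that(1,2)] that(3,4)] h by (simp add: algebra_simps)
  \<comment> \<open>The mean value theorem is used twice: along \<open>v\<close> for the increment
    in direction \<open>w\<close>, then along \<open>w\<close> for the derivative in direction
    \<open>v\<close>.\<close>
  define g where "g t = f (x + t *\<^sub>R v + h *\<^sub>R w) - f (x + t *\<^sub>R v)" for t
  have g': "(g has_real_derivative frechet_derivative f (at (x + t *\<^sub>R v + h *\<^sub>R w)) v
     - frechet_derivative f (at (x + t *\<^sub>R v)) v) (at t)" if "0 \<le> t" "t \<le> h" for t
  proof -
    have a: "((\<lambda>t. f (x + t *\<^sub>R v + h *\<^sub>R w)) has_derivative
        (\<lambda>r. frechet_derivative f (at (x + t *\<^sub>R v + h *\<^sub>R w)) (r *\<^sub>R v))) (at t)"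
      by (rule has_derivative_compose[where f = "\<lambda>t. x + t *\<^sub>R v + h *\<^sub>R w", OF _ f'[OF s2[OF that]]]) (auto intro!: derivative_eq_intros)
    have b: "((\<lambda>t. f (x + t *\<^sub>R v)) has_derivative
        (\<lambda>r. frechet_derivative f (at (x + t *\<^sub>R v)) (r *\<^sub>R v))) (at t)"
      by (rule has_derivative_compose[where f = "\<lambda>t. x + t *\<^sub>R v", OF _ f'[OF s1[OF that]]]) (auto intro!: derivative_eq_intros)
    show ?thesis
      unfolding g_def has_field_derivative_def
      by (rule has_derivative_eq_rhs[OF has_derivative_diff[OF a b]],
          auto simp: fun_eq_iff linear_scale[OF has_derivative_linear[OF f'[OF s1[OF that]]]]
            linear_scale[OF has_derivative_linear[OF f'[OF s2[OF that]]]])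
         (simp add: algebra_simps)
  qed
  obtain s where s: "0 < s" "s < h" "g h - g 0 = (h - 0) *
      (frechet_derivative f (at (x + s *\<^sub>R v + h *\<^sub>R w)) v - frechet_derivative f (at (x + s *\<^sub>R v)) v)"
    using MVT2[OF h g'] by auto
  define k where "k t = frechet_derivative f (at (x + s *\<^sub>R v + t *\<^sub>R w)) v" for t
  have k': "(k has_real_derivative
      frechet_derivative (\<lambda>y. frechet_derivative f (at y) v) (at (x + s *\<^sub>R v + t *\<^sub>R w)) w) (at t)"
    if "0 \<le> t" "t \<le> h" for t
  proof -
    have m: "x + s *\<^sub>R v + t *\<^sub>R w \<in> S" using s3 s that by simp
    have a: "(k has_derivative (\<lambda>r. frechet_derivative (\<lambda>y. frechet_derivative f (at y) v)
        (at (x + s *\<^sub>R v + t *\<^sub>R w)) (r *\<^sub>R w))) (at t)"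
      unfolding k_def
      by (rule has_derivative_compose[where f = "\<lambda>t. x + s *\<^sub>R v + t *\<^sub>R w", OF _ f''[OF m]])
         (auto intro!: derivative_eq_intros)
    show ?thesis
      unfolding has_field_derivative_def
      by (rule has_derivative_eq_rhs[OF a])
         (auto simp: fun_eq_iff linear_scale[OF has_derivative_linear[OF f''[OF m]]])
  qed
  obtain t where t: "0 < t" "t < h" "k h - k 0 = (h - 0) *
     frechet_derivative (\<lambda>y. frechet_derivative f (at y) v) (at (x + s *\<^sub>R v + t *\<^sub>R w)) w"
    using MVT2[OF h k'] by auto
  show ?thesis
    using s t by (intro exI[of _ s] exI[of _ t]) (simp add: g_def k_def algebra_simps)
qed

lemma mixed_derivatives_commute_real:
  fixes f :: "'a::real_normed_vector \<Rightarrow> real"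
  assumes "open S" "Ck_on 2 S f" "x \<in> S"
  shows "frechet_derivative (\<lambda>y. frechet_derivative f (at y) v) (at x) w
       = frechet_derivative (\<lambda>y. frechet_derivative f (at y) w) (at x) v"
proof -
  obtain e where e: "e > 0" "ball x e \<subseteq> S" using assms(1,3) openE by blast
  have C: "Ck_on 2 (ball x e) f" using Ck_on_subset[OF assms(2) e(2)] .
  define D where "D v w y = frechet_derivative (\<lambda>y. frechet_derivative f (at y) v) (at y) w" for v w y
  define \<Delta> where "\<Delta> v w h = (f (x + h *\<^sub>R v + h *\<^sub>R w) - f (x + h *\<^sub>R v) - f (x + h *\<^sub>R w) + f x) / (h * h)"
    for v w and h :: real
  have lim: "(\<Delta> v w \<longlongrightarrow> D v w x) (at_right 0)" for v w
  proof (rule tendstoI)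
    fix \<epsilon> :: real assume \<epsilon>: "\<epsilon> > 0"
    have "continuous_on (ball x e) (D v w)"
      using C unfolding D_def by (simp add: numeral_2_eq_2)
    then have "isCont (D v w) x"
      using e(1) by (simp add: continuous_on_eq_continuous_at)
    then obtain \<delta> where \<delta>: "\<delta> > 0" "\<And>y. dist y x < \<delta> \<Longrightarrow> dist (D v w y) (D v w x) < \<epsilon>"
      using \<epsilon> unfolding continuous_at_eps_delta by blast
    \<comment> \<open>The summand 1 keeps the denominator positive when \<open>v\<close> and
      \<open>w\<close> both vanish.\<close>
    define r where "r = min e \<delta> / (norm v + norm w + 1)"
    have P: "norm v + norm w + 1 > 0" by (smt (verit) norm_ge_zero)
    then have r: "r > 0" using e \<delta> by (simp add: r_def)
    have small: "dist (x + s *\<^sub>R v + t *\<^sub>R w) x < min e \<delta>" if "0 \<le> s" "0 \<le> t" "s < r" "t < r" for s t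
    proof -
      have "dist (x + s *\<^sub>R v + t *\<^sub>R w) x = norm (s *\<^sub>R v + t *\<^sub>R w)"
        by (simp add: dist_norm algebra_simps)
      also have "\<dots> \<le> s * norm v + t * norm w"
        using norm_triangle_ineq[of "s *\<^sub>R v" "t *\<^sub>R w"] that by simp
      also have "\<dots> \<le> r * norm v + r * norm w"
        using that by (intro add_mono mult_right_mono) auto
      also have "\<dots> < r * (norm v + norm w + 1)" using r by (simp add: algebra_simps)
      also have "\<dots> = min e \<delta>" using P by (simp add: r_def)
      finally show ?thesis .
    qed
    have "dist (\<Delta> v w h) (D v w x) < \<epsilon>" if h: "0 < h" "h < r" for h
    proof -
      have b: "x + s *\<^sub>R v + t *\<^sub>R w \<in> ball x e" if "0 \<le> s" "0 \<le> t" "s \<le> h" "t \<le> h" for s t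
        using small[of s t] that h by (simp add: dist_commute)
      have "\<exists>s t. 0 < s \<and> s < h \<and> 0 < t \<and> t < h \<and>
        f (x + h *\<^sub>R v + h *\<^sub>R w) - f (x + h *\<^sub>R v) - f (x + h *\<^sub>R w) + f x
        = h * h * frechet_derivative (\<lambda>y. frechet_derivative f (at y) v) (at (x + s *\<^sub>R v + t *\<^sub>R w)) w"
        using b[of 0 0] b[of h 0] b[of 0 h] b[of h h] h(1)
        by (intro second_difference_eq[OF open_ball convex_ball C]) auto
      then obtain s t where st: "0 < s" "s < h" "0 < t" "t < h"
        "\<Delta> v w h = D v w (x + s *\<^sub>R v + t *\<^sub>R w)"
        unfolding \<Delta>_def D_def using h(1) by force
      then show ?thesis using \<delta>(2) small[of s t] h by auto
    qed
    then show "\<forall>\<^sub>F h in at_right 0. dist (\<Delta> v w h) (D v w x) < \<epsilon>"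
      unfolding eventually_at_right_field using r by (intro exI[of _ r]) auto
  qed
  \<comment> \<open>The quotient is symmetric in \<open>v\<close> and \<open>w\<close>, whereas its
    limit was computed as a derivative in a fixed order.\<close>
  have "\<Delta> v w = \<Delta> w v" unfolding \<Delta>_def by (auto simp: algebra_simps)
  then have "D v w x = D w v x"
    using tendsto_unique[OF _ lim[of v w]] lim[of w v] by (simp add: trivial_limit_at_right_real)
  then show ?thesis unfolding D_def .
qed

lemma frechet_derivative_inner_left:
  fixes f :: "'a::real_normed_vector \<Rightarrow> 'b::euclidean_space"
  assumes "f differentiable (at x)"
  shows "frechet_derivative (\<lambda>y. f y \<bullet> b) (at x) v = frechet_derivative f (at x) v \<bullet> b"
  using frechet_derivative_at[OF has_derivative_inner_left[OF assms[unfolded frechet_derivative_works]]]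
  by metis

lemma pd_commute:
  fixes f :: "real^'n \<Rightarrow> 'b::euclidean_space"
  assumes S: "open S" "Ck_on 2 S f" "u \<in> S"
  shows "pd (pd f j) i u = pd (pd f i) j u"
proof (rule euclidean_eqI)
  fix b :: 'b assume "b \<in> Basis"
  have C: "Ck_on (Suc (Suc 0)) S f" using S(2) by (simp add: numeral_2_eq_2)
  have D: "f differentiable (at y)" "pd f i differentiable (at y)" if "y \<in> S" for y i
    using that C Ck_on_Suc_pd[OF C, of i] by auto
  let ?f = "\<lambda>y. f y \<bullet> b"
  have Cb: "Ck_on 2 S ?f" using S Ck_on_const by (intro Ck_on_inner)
  have eq: "frechet_derivative (\<lambda>y. frechet_derivative ?f (at y) (axis j 1)) (at u) (axis i 1)
      = pd (pd f j) i u \<bullet> b" for i j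
  proof -
    have "frechet_derivative (\<lambda>y. frechet_derivative ?f (at y) (axis j 1)) (at u)
        = frechet_derivative (\<lambda>y. pd f j y \<bullet> b) (at u)"
      by (rule frechet_derivative_transform_within_open[symmetric, OF _ S(1,3)])
         (use D(1) D(2)[OF S(3), of j, unfolded pd_def[abs_def]] in \<open>auto simp: frechet_derivative_inner_left pd_def
            intro!: differentiable_inner\<close>)
    then show ?thesis using D(2)[OF S(3)] by (simp add: frechet_derivative_inner_left pd_def[of _ i])
  qed
  show "pd (pd f j) i u \<bullet> b = pd (pd f i) j u \<bullet> b"
    using mixed_derivatives_commute_real[OF S(1) Cb S(3), of "axis j 1" "axis i 1"]
    unfolding eq .
qed

section \<open>Cutoff functions\<close>

text \<open>The derivative of each member is a combination of two others, so all of them are smooth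
  by one induction. \<open>flat 0\<close> is the cutoff profile h, and \<open>flat 2\<close> is
  h'.\<close>

definition flat :: "nat \<Rightarrow> real \<Rightarrow> real" where
  "flat n t = (if t > 0 then (1/t) ^ n * exp (- (1/t)) else 0)"

text \<open>Only t = 0 needs an argument: the difference quotient is 0 from the left, and from the
  right it is y^(n+1) / exp y with y = 1/h, which tends to 0 as y grows.\<close>

lemma has_real_derivative_flat:
  "(flat n has_real_derivative flat (n + 2) t - real n * flat (n + 1) t) (at t)"
proof (cases t "0::real" rule: linorder_cases)
  case less
  have "((\<lambda>t. 0) has_real_derivative 0) (at t)" by simp
  then have "(flat n has_real_derivative 0) (at t)"
    by (rule has_field_derivative_transform_within_open[where S = "{..<0}"])
       (use less in \<open>auto simp: flat_def\<close>)
  then show ?thesis using less by (simp add: flat_def)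
next
  case greater
  have "((\<lambda>t. (1/t) ^ n * exp (- (1/t))) has_real_derivative flat (n + 2) t - real n * flat (n + 1) t) (at t)"
  proof (cases n)
    case 0
    then show ?thesis using greater
      by (auto intro!: derivative_eq_intros simp: flat_def power2_eq_square field_simps)
  next
    case (Suc m)
    then show ?thesis using greater
      by (auto intro!: derivative_eq_intros simp: flat_def power2_eq_square field_simps)
         (cases m; simp)
  qed
  then show ?thesis
    by (rule has_field_derivative_transform_within_open[where S = "{0<..}"])
       (use greater in \<open>auto simp: flat_def\<close>)
next
  case equal
  have "((\<lambda>h. flat n h / h) \<longlongrightarrow> 0) (at_left 0)"
    by (rule tendsto_eventually) (auto simp: eventually_at_filter flat_def)
  moreover have "((\<lambda>h::real. inverse h ^ (n + 1) / exp (inverse h)) \<longlongrightarrow> 0) (at_right 0)"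
    by (rule filterlim_compose[OF tendsto_power_div_exp_0 filterlim_inverse_at_top_right])
  then have "((\<lambda>h. flat n h / h) \<longlongrightarrow> 0) (at_right 0)"
    by (rule Lim_transform_eventually)
       (auto simp: eventually_at_filter flat_def exp_minus field_simps)
  ultimately have "((\<lambda>h. flat n h / h) \<longlongrightarrow> 0) (at 0)"
    by (simp add: filterlim_at_split)
  then show ?thesis using equal by (simp add: has_field_derivative_iff flat_def)
qed

lemma Ck_on_flat: "Ck_on k UNIV (flat n)"
proof (induction k arbitrary: n)
  case 0
  then show ?case
    using has_real_derivative_flat by (auto intro!: continuous_at_imp_continuous_on DERIV_isCont)
next
  case (Suc k)
  show ?case
    by (rule Ck_on_real_SucI[OF open_UNIV has_real_derivative_flat
          Ck_on_diff[OF open_UNIV Suc Ck_on_mult[OF open_UNIV Ck_on_const Suc]]])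
qed

lemma flat_nonneg: "0 \<le> flat n t"
  by (simp add: flat_def)

lemma flat_0_le_1: "flat 0 t \<le> 1"
  by (simp add: flat_def)

text \<open>With y = 1/t this is y^2 \<le> 2 exp y. The bound on h' does not depend on the radius of
  the cutoff, as dominated convergence will require.\<close>

lemma flat_2_le: "flat 2 t \<le> 2"
proof (cases "t > 0")
  case True
  have "(1/t)\<^sup>2 \<le> 2 * exp (1/t)"
  proof -
    have "0 \<le> 1/t" using True by simp
    then have "1 + 1/t + (1/t)\<^sup>2 / 2 \<le> exp (1/t)" by (rule exp_lower_Taylor_quadratic)
    then show ?thesis using \<open>0 \<le> 1/t\<close> by linarith
  qed
  then show ?thesis using True by (simp add: flat_def exp_minus field_simps)
qed (simp add: flat_def)

lemma flat_0_mono: "t \<le> t' \<Longrightarrow> flat 0 t \<le> flat 0 t'"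
  by (auto simp: flat_def frac_le)

lemma flat_at_top:
  "((\<lambda>R. flat 0 (R - s)) \<longlongrightarrow> 1) at_top" "((\<lambda>R. flat 2 (R - s)) \<longlongrightarrow> 0) at_top"
proof -
  have a: "filterlim (\<lambda>R. R - s) at_top at_top"
    using filterlim_tendsto_add_at_top[OF tendsto_const[of "-s"] filterlim_ident] by simp
  have i: "((\<lambda>t::real. 1/t) \<longlongrightarrow> 0) at_top"
    using tendsto_inverse_0_at_top[OF filterlim_ident] by (simp add: inverse_eq_divide)
  have e: "eventually (\<lambda>t::real. (1/t)^n * exp (- (1/t)) = flat n t) at_top" for n
    using eventually_gt_at_top[of 0] by eventually_elim (simp add: flat_def)
  have "((\<lambda>t::real. (1/t)^0 * exp (- (1/t))) \<longlongrightarrow> 0^0 * exp (-0)) at_top"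
    by (intro tendsto_intros i)
  then have "((\<lambda>t. flat 0 t) \<longlongrightarrow> 1) at_top"
    by (rule Lim_transform_eventually[THEN tendsto_eq_rhs, OF _ e]) simp
  then show "((\<lambda>R. flat 0 (R - s)) \<longlongrightarrow> 1) at_top" by (rule filterlim_compose[OF _ a])
  have "((\<lambda>t::real. (1/t)^2 * exp (- (1/t))) \<longlongrightarrow> 0^2 * exp (-0)) at_top"
    by (intro tendsto_intros i)
  then have "((\<lambda>t. flat 2 t) \<longlongrightarrow> 0) at_top"
    by (rule Lim_transform_eventually[THEN tendsto_eq_rhs, OF _ e]) simp
  then show "((\<lambda>R. flat 2 (R - s)) \<longlongrightarrow> 0) at_top" by (rule filterlim_compose[OF _ a])
qed

text \<open>A C^1 step from 1 (for t \<le> 1) to 0 (for t \<ge> 2). Squares of positive parts are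
  just regular enough; the function serves to localize the divergence theorem and never enters a
  Rayleigh quotient.\<close>

definition plateau :: "real \<Rightarrow> real" where
  "plateau t = (max 0 (1 - (max 0 (t - 1))\<^sup>2))\<^sup>2"

lemma has_real_derivative_max_0_sq: "((\<lambda>t. (max 0 t)\<^sup>2) has_real_derivative 2 * max 0 t) (at t)"
proof (cases t "0::real" rule: linorder_cases)
  case less
  have "((\<lambda>t. 0) has_real_derivative 0) (at t)" by simp
  then have "((\<lambda>t. (max 0 t)\<^sup>2) has_real_derivative 0) (at t)"
    by (rule has_field_derivative_transform_within_open[where S = "{..<0}"]) (use less in auto)
  then show ?thesis using less by simp
next
  case greater
  have "((\<lambda>t. t\<^sup>2) has_real_derivative 2 * t) (at t)" by (auto intro!: derivative_eq_intros)
  then have "((\<lambda>t. (max 0 t)\<^sup>2) has_real_derivative 2 * t) (at t)"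
    by (rule has_field_derivative_transform_within_open[where S = "{0<..}"]) (use greater in auto)
  then show ?thesis using greater by simp
next
  case equal
  have "((\<lambda>h::real. max 0 h) \<longlongrightarrow> max 0 0) (at 0)"
    by (intro tendsto_max tendsto_const tendsto_ident_at)
  then have "((\<lambda>h::real. (max 0 h)\<^sup>2 / h) \<longlongrightarrow> 0) (at 0)"
    by (rule Lim_transform_eventually[THEN tendsto_eq_rhs])
       (auto simp: eventually_at_filter power2_eq_square max_def)
  then show ?thesis using equal by (simp add: has_field_derivative_iff)
qed

lemma Ck_on_max_0_sq: "Ck_on 1 UNIV (\<lambda>t::real. (max 0 t)\<^sup>2)"
  unfolding One_nat_def
  by (rule Ck_on_real_SucI[OF open_UNIV has_real_derivative_max_0_sq])
     (auto intro!: continuous_intros)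

lemma Ck_on_plateau: "Ck_on 1 UNIV plateau"
proof -
  have "Ck_on 1 UNIV (\<lambda>t::real. (max 0 (t - 1))\<^sup>2)"
    by (rule Ck_on_compose_real[OF open_UNIV _ Ck_on_diff[OF open_UNIV
            Ck_on_bounded_linear[OF bounded_linear_ident] Ck_on_const] Ck_on_max_0_sq]) simp
  then have "Ck_on 1 UNIV (\<lambda>t::real. 1 - (max 0 (t - 1))\<^sup>2)"
    by (intro Ck_on_diff open_UNIV Ck_on_const)
  then show ?thesis
    unfolding plateau_def[abs_def]
    by (intro Ck_on_compose_real[OF open_UNIV _ _ Ck_on_max_0_sq]) auto
qed

lemma plateau_eq_1: "t \<le> 1 \<Longrightarrow> plateau t = 1"
  by (simp add: plateau_def)

lemma plateau_eq_0: "2 \<le> t \<Longrightarrow> plateau t = 0"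
proof -
  assume "2 \<le> t"
  then have "1\<^sup>2 \<le> (max 0 (t - 1))\<^sup>2" by (intro power_mono) auto
  then show ?thesis by (simp add: plateau_def)
qed

section \<open>Determinants and inverse matrices\<close>

lemma matrix_inv_mult:
  fixes A :: "real^'n^'n"
  assumes "det A \<noteq> 0"
  shows "A ** matrix_inv A = mat 1" "matrix_inv A ** A = mat 1"
  using assms someI_ex[of "\<lambda>A'. A ** A' = mat 1 \<and> A' ** A = mat 1"]
  unfolding matrix_inv_def invertible_det_nz[symmetric] invertible_def by blast+

lemma matrix_inv_unique:
  fixes A B :: "real^'n^'n"
  assumes "A ** B = mat 1"
  shows "matrix_inv A = B"
proof -
  have "det A * det B = 1" using assms det_mul[of A B] by simp
  then have "det A \<noteq> 0" by auto
  then show ?thesis using matrix_inv_mult[of A] assms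
    by (metis matrix_mul_assoc matrix_mul_lid matrix_mul_rid)
qed

text \<open>Cramer's rule exhibits the entries of the inverse as quotients of polynomials in the
  entries of \<open>A\<close>, from which their regularity follows.\<close>

lemma matrix_inv_cramer:
  fixes A :: "real^'n^'n"
  assumes "det A \<noteq> 0"
  shows "matrix_inv A $ k $ l = det (\<chi> i j. if j = k then axis l 1 $ i else A $ i $ j) / det A"
proof -
  have "A *v (matrix_inv A *v axis l 1) = axis l 1"
    by (simp add: matrix_vector_mul_assoc matrix_inv_mult assms)
  then have "det (\<chi> i j. if j = k then axis l 1 $ i else A $ i $ j)
      = (matrix_inv A *v axis l 1) $ k * det A"
    using cramer_lemma[of k A "matrix_inv A *v axis l 1"] by (simp only:)
  then show ?thesis using assms
    by (simp add: matrix_vector_mult_basis column_def)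
qed

lemma sum_delta_UNIV:
  fixes f :: "'n::finite \<Rightarrow> real"
  shows "(\<Sum>i\<in>UNIV. (if i = j then 1 else 0) * f i) = f j"
    "(\<Sum>i\<in>UNIV. (if j = i then 1 else 0) * f i) = f j"
    "(\<Sum>i\<in>UNIV. f i * (if i = j then 1 else 0)) = f j"
    "(\<Sum>i\<in>UNIV. f i * (if j = i then 1 else 0)) = f j"
  by (simp_all add: if_distrib if_distribR sum.delta cong: if_cong)

lemma matrix_mult_eq_mat_1_component:
  fixes A B :: "real^'n^'n"
  assumes "A ** B = mat 1"
  shows "(\<Sum>k\<in>UNIV. A $ i $ k * B $ k $ j) = (if i = j then 1 else 0)"
  using arg_cong[OF assms, of "\<lambda>M. M $ i $ j"] by (simp add: matrix_matrix_mult_def mat_def)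

lemma Ck_on_det:
  fixes A :: "'a::real_normed_vector \<Rightarrow> real^'n^'n"
  assumes "open S" "\<And>i j. Ck_on k S (\<lambda>x. A x $ i $ j)"
  shows "Ck_on k S (\<lambda>x. det (A x))"
  unfolding det_def by (intro Ck_on_sum Ck_on_mult Ck_on_const Ck_on_prod assms)

lemma Ck_on_inverse: "Ck_on 1 {0<..} (\<lambda>x::real. inverse x)"
  unfolding One_nat_def
  by (rule Ck_on_real_SucI[where g' = "\<lambda>x. - (inverse x ^ Suc (Suc 0))"])
     (rule open_greaterThan, rule DERIV_inverse, auto intro!: continuous_intros)

lemma Ck_on_sqrt: "Ck_on 1 {0<..} sqrt"
  unfolding One_nat_def
  by (rule Ck_on_real_SucI[where g' = "\<lambda>x. inverse (sqrt x) / 2"])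
     (auto intro!: DERIV_real_sqrt continuous_intros)

lemma Ck_on_matrix_inv:
  fixes A :: "'a::real_normed_vector \<Rightarrow> real^'n^'n"
  assumes "open S" "\<And>i j. Ck_on 1 S (\<lambda>x. A x $ i $ j)" "\<And>x. x \<in> S \<Longrightarrow> 0 < det (A x)"
  shows "Ck_on 1 S (\<lambda>x. matrix_inv (A x) $ k $ l)"
proof -
  have 1: "Ck_on 1 S (\<lambda>x. det (\<chi> i j. if j = k then axis l 1 $ i else A x $ i $ j))"
  proof (rule Ck_on_det[OF assms(1)])
    fix i j show "Ck_on 1 S (\<lambda>x. (\<chi> i j. if j = k then axis l 1 $ i else A x $ i $ j) $ i $ j)"
      by (cases "j = k") (use assms(2) Ck_on_const in auto)
  qed
  have 2: "Ck_on 1 S (\<lambda>x. inverse (det (A x)))"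
    by (rule Ck_on_compose_real[OF assms(1) _ Ck_on_det[OF assms(1,2)] Ck_on_inverse])
       (use assms(3) in auto)
  show ?thesis
    by (rule Ck_on_cong[OF assms(1) _ Ck_on_mult[OF assms(1) 1 2]])
       (use assms(3) in \<open>auto simp: matrix_inv_cramer less_imp_neq[symmetric] divide_inverse\<close>)
qed

text \<open>A permutation other than the identity moves at least two indices. After one factor has
  been differentiated, an off-diagonal entry of the identity matrix remains, so only the trace
  survives.\<close>

lemma has_derivative_det_at_mat_1:
  fixes B :: "'a::real_normed_vector \<Rightarrow> real^'n^'n"
  assumes "\<And>i j. ((\<lambda>y. B y $ i $ j) has_derivative B' i j) (at x)" "B x = mat 1"
  shows "((\<lambda>y. det (B y)) has_derivative (\<lambda>v. \<Sum>i\<in>UNIV. B' i i v)) (at x)"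
proof -
  have "((\<lambda>y. det (B y)) has_derivative (\<lambda>v. \<Sum>p\<in>{p. p permutes UNIV}. of_int (sign p) *
      (\<Sum>i\<in>UNIV. B' i (p i) v * (\<Prod>j\<in>UNIV - {i}. B x $ j $ p j)))) (at x)"
    unfolding det_def by (intro has_derivative_sum has_derivative_mult_right has_derivative_prod assms(1))
  moreover have "of_int (sign p) * (\<Sum>i\<in>UNIV. B' i (p i) v * (\<Prod>j\<in>UNIV - {i}. B x $ j $ p j))
     = (if p = id then \<Sum>i\<in>UNIV. B' i i v else 0)" if p: "p permutes UNIV" for p v
  proof (cases "p = id")
    case True
    then show ?thesis by (simp add: assms(2) mat_def sign_id)
  next
    case False
    have "(\<Prod>j\<in>UNIV - {i}. B x $ j $ p j) = 0" for i
    proof -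
      obtain k where k: "p k \<noteq> k" using False by (auto simp: fun_eq_iff)
      have "p (p k) \<noteq> p k" using k permutes_inj[OF p] by (auto dest: injD)
      then obtain j where "j \<noteq> i" "p j \<noteq> j" using k by metis
      then show ?thesis by (intro prod_zero) (auto simp: assms(2) mat_def intro!: bexI[of _ j])
    qed
    then show ?thesis using False by (simp del: prod_zero_iff)
  qed
  then have "(\<Sum>p\<in>{p. p permutes UNIV}. of_int (sign p) *
      (\<Sum>i\<in>UNIV. B' i (p i) v * (\<Prod>j\<in>UNIV - {i}. B x $ j $ p j))) = (\<Sum>i\<in>UNIV. B' i i v)" for v
    by (simp add: sum.delta permutes_id)
  ultimately show ?thesis by simp
qed

text \<open>Jacobi's formula. Multiplication by the constant matrix \<open>P\<close>, the inverse at
  \<open>x\<close>, moves the base point to the identity.\<close>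

lemma has_derivative_det:
  fixes A :: "'a::real_normed_vector \<Rightarrow> real^'n^'n"
  assumes A: "\<And>i j. ((\<lambda>y. A y $ i $ j) has_derivative A' i j) (at x)" and d: "det (A x) \<noteq> 0"
  shows "((\<lambda>y. det (A y)) has_derivative
    (\<lambda>v. det (A x) * (\<Sum>i\<in>UNIV. \<Sum>k\<in>UNIV. matrix_inv (A x) $ i $ k * A' k i v))) (at x)"
proof -
  define P where "P = matrix_inv (A x)"
  have "((\<lambda>y. (P ** A y) $ i $ j) has_derivative (\<lambda>v. \<Sum>k\<in>UNIV. P $ i $ k * A' k j v)) (at x)" for i j
    unfolding matrix_matrix_mult_def
    by (simp, intro has_derivative_sum has_derivative_mult_right A)
  from has_derivative_det_at_mat_1[OF this]
  have "((\<lambda>y. det (P ** A y)) has_derivative (\<lambda>v. \<Sum>i\<in>UNIV. \<Sum>k\<in>UNIV. P $ i $ k * A' k i v)) (at x)"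
    using matrix_inv_mult(2)[OF d] by (simp add: P_def)
  then have "((\<lambda>y. det (A x) * det (P ** A y)) has_derivative
     (\<lambda>v. det (A x) * (\<Sum>i\<in>UNIV. \<Sum>k\<in>UNIV. P $ i $ k * A' k i v))) (at x)"
    by (rule has_derivative_mult_right)
  moreover have "det (A x) * det (P ** A y) = det (A y)" for y
    using matrix_inv_mult(1)[OF d] det_mul[of "A x" P] by (simp add: det_mul P_def)
  ultimately show ?thesis by (simp add: P_def)
qed

text \<open>Differentiate inverse times \<open>A\<close> = 1 and multiply by the inverse from the
  right. Differentiability of the inverse is an assumption here; only the formula is
  derived.\<close>

lemma has_derivative_matrix_inv:
  fixes A :: "'a::real_normed_vector \<Rightarrow> real^'n^'n"
  assumes S: "open S" "x \<in> S" and A: "\<And>i j. ((\<lambda>y. A y $ i $ j) has_derivative A' i j) (at x)"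
    and d: "\<And>y. y \<in> S \<Longrightarrow> det (A y) \<noteq> 0"
    and P: "\<And>i j. ((\<lambda>y. matrix_inv (A y) $ i $ j) has_derivative P' i j) (at x)"
  shows "P' i l v = - (\<Sum>k\<in>UNIV. \<Sum>j\<in>UNIV. matrix_inv (A x) $ i $ k * A' k j v * matrix_inv (A x) $ j $ l)"
proof -
  define Q where "Q = matrix_inv (A x)"
  have D: "(\<Sum>k\<in>UNIV. Q $ i $ k * A' k j v + P' i k v * A x $ k $ j) = 0" for i j v
  proof -
    have 1: "((\<lambda>y. \<Sum>k\<in>UNIV. matrix_inv (A y) $ i $ k * A y $ k $ j) has_derivative
       (\<lambda>v. \<Sum>k\<in>UNIV. Q $ i $ k * A' k j v + P' i k v * A x $ k $ j)) (at x)"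
      unfolding Q_def by (intro has_derivative_sum has_derivative_mult A P)
    have 2: "((\<lambda>y. if i = j then 1 else 0 :: real) has_derivative
       (\<lambda>v. \<Sum>k\<in>UNIV. Q $ i $ k * A' k j v + P' i k v * A x $ k $ j)) (at x)"
      by (rule has_derivative_transform_within_open[OF 1 S])
         (simp add: matrix_mult_eq_mat_1_component[OF matrix_inv_mult(2)[OF d]])
    show ?thesis
      using fun_cong[OF has_derivative_unique[OF 2 has_derivative_const]] .
  qed
  have AQ: "A x ** Q = mat 1" using matrix_inv_mult(1)[OF d[OF S(2)]] Q_def by simp
  have "P' i l v = (\<Sum>k\<in>UNIV. P' i k v * (\<Sum>j\<in>UNIV. A x $ k $ j * Q $ j $ l))"
    by (simp add: matrix_mult_eq_mat_1_component[OF AQ] sum_delta_UNIV)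
  also have "\<dots> = (\<Sum>j\<in>UNIV. (\<Sum>k\<in>UNIV. P' i k v * A x $ k $ j) * Q $ j $ l)"
    unfolding sum_distrib_left sum_distrib_right by (subst sum.swap) (simp add: mult.assoc)
  also have "\<dots> = (\<Sum>j\<in>UNIV. - (\<Sum>k\<in>UNIV. Q $ i $ k * A' k j v) * Q $ j $ l)"
  proof -
    have "(\<Sum>k\<in>UNIV. P' i k v * A x $ k $ j) = - (\<Sum>k\<in>UNIV. Q $ i $ k * A' k j v)" for j
      using D[of i j v] by (simp add: sum.distrib)
    then show ?thesis by simp
  qed
  also have "\<dots> = - (\<Sum>j\<in>UNIV. \<Sum>k\<in>UNIV. Q $ i $ k * A' k j v * Q $ j $ l)"
    by (simp add: sum_negf sum_distrib_right)
  also have "\<dots> = - (\<Sum>k\<in>UNIV. \<Sum>j\<in>UNIV. Q $ i $ k * A' k j v * Q $ j $ l)"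
    by (subst sum.swap) simp
  finally show ?thesis by (simp add: Q_def)
qed

text \<open>The segment from the identity to \<open>A\<close> consists of positive definite, hence
  invertible, matrices. The determinant is 1 at one end, so by the intermediate value theorem it
  cannot be nonpositive at the other.\<close>

lemma det_pos_if_pos_def:
  fixes A :: "real^'n^'n"
  assumes "\<And>v. v \<noteq> 0 \<Longrightarrow> 0 < v \<bullet> (A *v v)"
  shows "0 < det A"
proof (rule ccontr)
  assume neg: "\<not> 0 < det A"
  define B where "B t = t *\<^sub>R A + (1 - t) *\<^sub>R mat 1" for t :: real
  have nz: "det (B t) \<noteq> 0" if t: "0 \<le> t" "t \<le> 1" for t
  proof
    assume "det (B t) = 0"
    then obtain v where v: "v \<noteq> 0" "B t *v v = 0"
      using matrix_left_invertible_ker[of "B t"] invertible_det_nz[of "B t"]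
      unfolding invertible_left_inverse by blast
    have "B t *v v = t *\<^sub>R (A *v v) + (1 - t) *\<^sub>R v"
      by (simp add: B_def matrix_vector_mult_add_rdistrib scaleR_matrix_vector_assoc[symmetric])
    then have "0 = v \<bullet> (t *\<^sub>R (A *v v) + (1 - t) *\<^sub>R v)" using v by simp
    also have "\<dots> = t * (v \<bullet> (A *v v)) + (1 - t) * (v \<bullet> v)" by (simp add: inner_add_right)
    finally have "t * (v \<bullet> (A *v v)) + (1 - t) * (v \<bullet> v) = 0" by simp
    moreover have "0 < v \<bullet> (A *v v)" "0 < v \<bullet> v" using assms v by auto
    then have "t * (v \<bullet> (A *v v)) + (1 - t) * (v \<bullet> v) > 0"
      using t by (cases "t = 0") (auto intro!: add_pos_nonneg mult_pos_pos)
    ultimately show False by simp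
  qed
  have "continuous_on {0..1} (\<lambda>t. det (B t))"
    unfolding B_def by (auto intro!: continuous_intros simp: det_def)
  then have "\<exists>t\<ge>0. t \<le> 1 \<and> det (B t) = 0"
    by (intro IVT2') (use neg in \<open>auto simp: B_def\<close>)
  then show False using nz by blast
qed

text \<open>A relabelling of indices that makes two fourfold sums in \<open>divergence_flux\<close>
  literally equal, so that they cancel.\<close>

lemma sum4_rotate:
  fixes f :: "'n::finite \<Rightarrow> 'n \<Rightarrow> 'n \<Rightarrow> 'n \<Rightarrow> real"
  shows "(\<Sum>i\<in>UNIV. \<Sum>j\<in>UNIV. \<Sum>k\<in>UNIV. \<Sum>l\<in>UNIV. f l j i k)
       = (\<Sum>i\<in>UNIV. \<Sum>j\<in>UNIV. \<Sum>k\<in>UNIV. \<Sum>l\<in>UNIV. f i j k l)"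
proof -
  have "(\<Sum>i\<in>UNIV. \<Sum>j\<in>UNIV. \<Sum>k\<in>UNIV. \<Sum>l\<in>UNIV. f l j i k)
      = (\<Sum>i\<in>UNIV. \<Sum>j\<in>UNIV. \<Sum>l\<in>UNIV. \<Sum>k\<in>UNIV. f l j i k)"
    by (intro sum.cong refl sum.swap)
  also have "\<dots> = (\<Sum>i\<in>UNIV. \<Sum>l\<in>UNIV. \<Sum>j\<in>UNIV. \<Sum>k\<in>UNIV. f l j i k)"
    by (intro sum.cong refl sum.swap)
  also have "\<dots> = (\<Sum>l\<in>UNIV. \<Sum>i\<in>UNIV. \<Sum>j\<in>UNIV. \<Sum>k\<in>UNIV. f l j i k)"
    by (rule sum.swap)
  also have "\<dots> = (\<Sum>l\<in>UNIV. \<Sum>j\<in>UNIV. \<Sum>i\<in>UNIV. \<Sum>k\<in>UNIV. f l j i k)"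
    by (intro sum.cong refl sum.swap)
  finally show ?thesis .
qed

section \<open>Geometry in one chart\<close>

lemma pd_mult:
  fixes a b :: "real^'n \<Rightarrow> real"
  assumes "a differentiable (at u)" "b differentiable (at u)"
  shows "pd (\<lambda>x. a x * b x) i u = a u * pd b i u + pd a i u * b u"
  using pd_eqI[OF has_derivative_mult[OF assms[unfolded frechet_derivative_works]], of i]
  by (simp add: pd_def)

lemma pd_inner:
  fixes a b :: "real^'n \<Rightarrow> 'e::euclidean_space"
  assumes "a differentiable (at u)" "b differentiable (at u)"
  shows "pd (\<lambda>x. a x \<bullet> b x) i u = a u \<bullet> pd b i u + pd a i u \<bullet> b u"
  using pd_eqI[OF has_derivative_inner[OF assms[unfolded frechet_derivative_works]], of i]
  by (simp add: pd_def)

lemma pd_sum: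
  fixes a :: "'i \<Rightarrow> real^'n \<Rightarrow> 'e::real_normed_vector"
  assumes "\<And>k. k \<in> I \<Longrightarrow> a k differentiable (at u)"
  shows "pd (\<lambda>x. \<Sum>k\<in>I. a k x) i u = (\<Sum>k\<in>I. pd (a k) i u)"
proof -
  have "((\<lambda>x. \<Sum>k\<in>I. a k x) has_derivative (\<lambda>v. \<Sum>k\<in>I. frechet_derivative (a k) (at u) v)) (at u)"
    using assms unfolding frechet_derivative_works by (rule has_derivative_sum)
  from pd_eqI[OF this, of i] show ?thesis by (simp add: pd_def)
qed

text \<open>The musical isomorphism: the tangent vector whose inner products with the coordinate
  fields are the numbers \<open>c i\<close>. Gradients and tangential projections are both of this
  form.\<close>

definition sharp :: "(real^'n::finite \<Rightarrow> 'e::euclidean_space) \<Rightarrow> ('n \<Rightarrow> real) \<Rightarrow> real^'n \<Rightarrow> 'e" where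
  "sharp X c u = (\<Sum>i\<in>UNIV. \<Sum>j\<in>UNIV. (loc_metric_inv X u $ i $ j * c i) *\<^sub>R pd X j u)"

lemma loc_gradient_eq_sharp: "loc_gradient X h u = sharp X (\<lambda>i. pd h i u) u"
  by (simp add: loc_gradient_def sharp_def)

lemma sharp_inner: "sharp X c u \<bullet> z = (\<Sum>i\<in>UNIV. \<Sum>j\<in>UNIV. loc_metric_inv X u $ i $ j * c i * (pd X j u \<bullet> z))"
  by (simp add: sharp_def inner_sum_left)

lemma tangential_part_eqI:
  assumes "subspace T" "y \<in> T" "\<And>w. w \<in> T \<Longrightarrow> (x - y) \<bullet> w = 0"
  shows "tangential_part T x = y"
  unfolding tangential_part_def
proof (rule the_equality)
  show "y \<in> T \<and> (\<forall>w\<in>T. orthogonal (x - y) w)" using assms by (simp add: orthogonal_def)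
  fix z assume z: "z \<in> T \<and> (\<forall>w\<in>T. orthogonal (x - z) w)"
  have d: "z - y \<in> T" using assms(1,2) z by (simp add: subspace_diff)
  have "(x - y) \<bullet> (z - y) - (x - z) \<bullet> (z - y) = 0"
    using assms(3)[OF d] z d by (simp add: orthogonal_def)
  then have "(z - y) \<bullet> (z - y) = 0" by (simp add: algebra_simps)
  then show "z = y" by simp
qed

text \<open>The codimension is left open; the lemmas that work with a unit normal assume
  \<open>DIM('e) = CARD('n) + 1\<close> themselves.\<close>

locale immersed_chart =
  fixes X :: "real^'n::finite \<Rightarrow> 'e::euclidean_space" and U :: "(real^'n) set"
  assumes open_U: "open U" and smooth_X: "smooth_on U X"
    and inj_DX: "\<And>u. u \<in> U \<Longrightarrow> inj (frechet_derivative X (at u))"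
begin

lemma Ck_X: "Ck_on k U X" and Ck_pd_X: "Ck_on k U (pd X i)" and Ck_pd_pd_X: "Ck_on k U (pd (pd X i) j)"
  using smooth_X smooth_on_pd unfolding smooth_on_def by blast+

lemma differentiable_X: "u \<in> U \<Longrightarrow> X differentiable (at u)"
  and differentiable_pd_X: "u \<in> U \<Longrightarrow> pd X i differentiable (at u)"
  using Ck_X[of 1] Ck_pd_X[of 1] by auto

lemma DX_eq: "u \<in> U \<Longrightarrow> frechet_derivative X (at u) v = (\<Sum>i\<in>UNIV. v $ i *\<^sub>R pd X i u)"
  by (rule frechet_derivative_eq_sum_pd[OF differentiable_X])

lemma linear_DX: "u \<in> U \<Longrightarrow> linear (frechet_derivative X (at u))"
  using differentiable_X linear_frechet_derivative by blast

lemma subspace_tangent: "u \<in> U \<Longrightarrow> subspace (loc_tangent X u)"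
  unfolding loc_tangent_def using linear_DX linear_subspace_image subspace_UNIV by blast

lemma pd_X_in_tangent: "u \<in> U \<Longrightarrow> pd X i u \<in> loc_tangent X u"
  unfolding loc_tangent_def pd_def by blast

lemma metric_quadratic:
  assumes "u \<in> U"
  shows "v \<bullet> (loc_metric X u *v w) = frechet_derivative X (at u) v \<bullet> frechet_derivative X (at u) w"
  unfolding DX_eq[OF assms] inner_vec_def matrix_vector_mult_def loc_metric_def
  by (simp add: inner_sum_left inner_sum_right sum_distrib_left)
     (subst sum.swap, simp add: mult_ac)

lemma det_pos:
  assumes u: "u \<in> U"
  shows "0 < det (loc_metric X u)"
proof (rule det_pos_if_pos_def)
  fix v :: "real^'n" assume "v \<noteq> 0"
  then have "frechet_derivative X (at u) v \<noteq> 0"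
    using inj_DX[OF u] linear_DX[OF u] linear_injective_0 by blast
  then show "0 < v \<bullet> (loc_metric X u *v v)" by (simp add: metric_quadratic[OF u])
qed

lemma inv_mult:
  "u \<in> U \<Longrightarrow> loc_metric X u ** loc_metric_inv X u = mat 1"
  "u \<in> U \<Longrightarrow> loc_metric_inv X u ** loc_metric X u = mat 1"
  using matrix_inv_mult det_pos unfolding loc_metric_inv_def by (metis less_irrefl)+

lemma metric_sym: "loc_metric X u $ i $ j = loc_metric X u $ j $ i"
  by (simp add: loc_metric_def inner_commute)

lemma transpose_inv: "u \<in> U \<Longrightarrow> transpose (loc_metric_inv X u) = loc_metric_inv X u"
proof -
  assume u: "u \<in> U"
  have "transpose (loc_metric X u) = loc_metric X u"
    by (simp add: transpose_def vec_eq_iff metric_sym)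
  then have "loc_metric X u ** transpose (loc_metric_inv X u) = mat 1"
    using arg_cong[OF inv_mult(2)[OF u], of transpose]
    by (simp add: matrix_transpose_mul transpose_mat)
  then show ?thesis using matrix_inv_unique unfolding loc_metric_inv_def by metis
qed

lemma inv_sym: "u \<in> U \<Longrightarrow> loc_metric_inv X u $ i $ j = loc_metric_inv X u $ j $ i"
  using transpose_inv by (simp add: transpose_def vec_eq_iff)

lemma inv_metric_component:
  "u \<in> U \<Longrightarrow> (\<Sum>k\<in>UNIV. loc_metric_inv X u $ i $ k * (pd X k u \<bullet> pd X j u)) = (if i = j then 1 else 0)"
  using matrix_mult_eq_mat_1_component[OF inv_mult(2)] by (simp add: loc_metric_def)

lemma Ck_metric: "Ck_on k U (\<lambda>u. loc_metric X u $ i $ j)"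
  unfolding loc_metric_def by (simp add: Ck_on_inner open_U Ck_pd_X)

lemma Ck_inv: "Ck_on 1 U (\<lambda>u. loc_metric_inv X u $ i $ j)"
  unfolding loc_metric_inv_def by (rule Ck_on_matrix_inv[OF open_U Ck_metric det_pos])

lemma Ck_sqrt_det: "Ck_on 1 U (\<lambda>u. sqrt (det (loc_metric X u)))"
  by (rule Ck_on_compose_real[OF open_U _ Ck_on_det[OF open_U Ck_metric] Ck_on_sqrt]) (use det_pos in auto)

lemma sharp_inner_pd:
  assumes u: "u \<in> U"
  shows "sharp X c u \<bullet> pd X k u = c k"
proof -
  have "sharp X c u \<bullet> pd X k u
      = (\<Sum>i\<in>UNIV. c i * (\<Sum>j\<in>UNIV. loc_metric_inv X u $ i $ j * (pd X j u \<bullet> pd X k u)))"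
    unfolding sharp_inner sum_distrib_left by (simp add: mult_ac)
  also have "\<dots> = c k" by (simp add: inv_metric_component[OF u] sum_delta_UNIV)
  finally show ?thesis .
qed

lemma sharp_in_tangent: "u \<in> U \<Longrightarrow> sharp X c u \<in> loc_tangent X u"
  unfolding sharp_def
  by (intro subspace_sum subspace_scale subspace_tangent pd_X_in_tangent)

lemma orthogonal_tangentI:
  assumes u: "u \<in> U" and "\<And>k. y \<bullet> pd X k u = 0" "w \<in> loc_tangent X u"
  shows "y \<bullet> w = 0"
  using assms(2,3) unfolding loc_tangent_def by (auto simp: DX_eq[OF u] inner_sum_right)

lemma tangent_eqI:
  assumes u: "u \<in> U" and "y \<in> loc_tangent X u" "z \<in> loc_tangent X u"
    "\<And>k. y \<bullet> pd X k u = z \<bullet> pd X k u"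
  shows "y = z"
proof -
  have "(y - z) \<bullet> (y - z) = 0"
    by (rule orthogonal_tangentI[OF u])
       (use assms subspace_diff[OF subspace_tangent[OF u]] in \<open>auto simp: inner_diff_left\<close>)
  then show ?thesis by simp
qed

text \<open>Replaces the definite description by a formula in the metric and the coordinate fields,
  which can be differentiated and is visibly continuous.\<close>

lemma tangential_part_eq:
  assumes u: "u \<in> U"
  shows "tangential_part (loc_tangent X u) x = sharp X (\<lambda>i. x \<bullet> pd X i u) u"
proof (rule tangential_part_eqI[OF subspace_tangent[OF u] sharp_in_tangent[OF u]])
  fix w assume "w \<in> loc_tangent X u"
  then show "(x - sharp X (\<lambda>i. x \<bullet> pd X i u) u) \<bullet> w = 0"
    by (rule orthogonal_tangentI[OF u, rotated]) (simp add: inner_diff_left sharp_inner_pd[OF u])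
qed

text \<open>\<open>flux f i\<close> is the \<open>i\<close>-th component of the tangential field \<open>f x\<^sup>T\<close> times the volume density.\<close>

definition flux :: "(real^'n \<Rightarrow> real) \<Rightarrow> 'n \<Rightarrow> real^'n \<Rightarrow> real" where
  "flux f i u = sqrt (det (loc_metric X u))
     * (\<Sum>j\<in>UNIV. loc_metric_inv X u $ i $ j * (X u \<bullet> pd X j u)) * f u"

lemma Ck_flux: "Ck_on 1 U f \<Longrightarrow> Ck_on 1 U (flux f i)"
  unfolding flux_def[abs_def]
  by (intro Ck_on_mult Ck_on_sum Ck_on_inner open_U Ck_sqrt_det Ck_inv Ck_X Ck_pd_X)

lemma pd_metric:
  "u \<in> U \<Longrightarrow> pd (\<lambda>u. loc_metric X u $ k $ l) i u = pd X k u \<bullet> pd (pd X l) i u + pd (pd X k) i u \<bullet> pd X l u"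
  unfolding loc_metric_def using pd_inner[OF differentiable_pd_X differentiable_pd_X] by simp

lemma Ck_1_differentiable: "Ck_on 1 U f \<Longrightarrow> u \<in> U \<Longrightarrow> f differentiable (at u)"
  by simp

text \<open>Jacobi's formula and the derivative of the square root give half the trace of the
  inverse metric against the derivative of the metric. The product rule splits the latter into two
  sums that agree by symmetry, which absorbs the factor 1/2.\<close>

lemma pd_sqrt_det:
  assumes u: "u \<in> U"
  shows "pd (\<lambda>u. sqrt (det (loc_metric X u))) i u = sqrt (det (loc_metric X u))
     * (\<Sum>k\<in>UNIV. \<Sum>l\<in>UNIV. loc_metric_inv X u $ k $ l * (pd (pd X k) i u \<bullet> pd X l u))"
proof -
  let ?d = "det (loc_metric X u)" and ?G = "\<lambda>k l. loc_metric_inv X u $ k $ l"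
  let ?S = "\<Sum>k\<in>UNIV. \<Sum>l\<in>UNIV. ?G k l * pd (\<lambda>u. loc_metric X u $ l $ k) i u"
  let ?T = "\<Sum>k\<in>UNIV. \<Sum>l\<in>UNIV. ?G k l * (pd (pd X k) i u \<bullet> pd X l u)"
  have A: "((\<lambda>y. loc_metric X y $ k $ l) has_derivative frechet_derivative (\<lambda>y. loc_metric X y $ k $ l) (at u)) (at u)" for k l
    using Ck_1_differentiable[OF Ck_metric u] frechet_derivative_works by blast
  have d: "?d > 0" by (rule det_pos[OF u])
  have "((\<lambda>y. sqrt (det (loc_metric X y))) has_derivative
     (\<lambda>v. (?d * (\<Sum>k\<in>UNIV. \<Sum>l\<in>UNIV. matrix_inv (loc_metric X u) $ k $ l *
        frechet_derivative (\<lambda>y. loc_metric X y $ l $ k) (at u) v)) * (inverse (sqrt ?d) / 2))) (at u)"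
    by (rule DERIV_compose_FDERIV[OF DERIV_real_sqrt[OF d] has_derivative_det[OF A]]) (use d in auto)
  from pd_eqI[OF this, of i]
  have "pd (\<lambda>u. sqrt (det (loc_metric X u))) i u = (?d * ?S) * (inverse (sqrt ?d) / 2)"
    unfolding pd_def loc_metric_inv_def .
  also have "\<dots> = (?d * inverse (sqrt ?d)) * ?S / 2" by simp
  also have "?d * inverse (sqrt ?d) = sqrt ?d"
    using d by (metis abs_of_pos divide_inverse real_div_sqrt less_imp_le)
  also have "?S = ?T + ?T"
  proof -
    have "?S = ?T + (\<Sum>k\<in>UNIV. \<Sum>l\<in>UNIV. ?G k l * (pd (pd X l) i u \<bullet> pd X k u))"
      unfolding pd_metric[OF u] sum.distrib[symmetric]
      by (simp add: algebra_simps inner_commute)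
    also have "(\<Sum>k\<in>UNIV. \<Sum>l\<in>UNIV. ?G k l * (pd (pd X l) i u \<bullet> pd X k u)) = ?T"
      by (subst sum.swap) (simp add: inv_sym[OF u])
    finally show ?thesis .
  qed
  finally show ?thesis by simp
qed

lemma pd_inv:
  assumes u: "u \<in> U"
  shows "pd (\<lambda>u. loc_metric_inv X u $ i $ l) m u
    = - (\<Sum>k\<in>UNIV. \<Sum>j\<in>UNIV. loc_metric_inv X u $ i $ k *
         (pd X k u \<bullet> pd (pd X j) m u + pd (pd X k) m u \<bullet> pd X j u) * loc_metric_inv X u $ j $ l)"
  unfolding pd_metric[OF u, symmetric] unfolding pd_def loc_metric_inv_def
  by (rule has_derivative_matrix_inv[OF open_U u])
     (use Ck_1_differentiable[OF Ck_metric u] Ck_1_differentiable[OF Ck_inv u] det_pos in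
       \<open>auto simp: frechet_derivative_works loc_metric_inv_def less_imp_neq[symmetric]\<close>)

lemma loc_sff_inner:
  assumes u: "u \<in> U"
  shows "loc_sff X i j u \<bullet> z = pd (pd X j) i u \<bullet> z - sharp X (\<lambda>l. pd (pd X j) i u \<bullet> pd X l u) u \<bullet> z"
  by (simp add: loc_sff_def normal_part_def tangential_part_eq[OF u] inner_diff_left)

text \<open>The formula div (f x^T) = f (n + \<langle>H, x\<rangle>) + \<langle>grad f, x\<rangle>
  in coordinates, with H the mean curvature vector. Differentiating the inverse metric gives two
  sums: one cancels the derivative of the volume density, the other is the tangential part that
  turns second derivatives of \<open>X\<close> into the second fundamental form.\<close>

lemma divergence_flux:
  assumes u: "u \<in> U" and f: "f differentiable (at u)"
  shows "(\<Sum>i\<in>UNIV. pd (flux f i) i u) = sqrt (det (loc_metric X u)) *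
    (f u * (real CARD('n) + loc_mean_curvature_vector X u \<bullet> X u) + loc_gradient X f u \<bullet> X u)"
proof -
  define D where "D u = sqrt (det (loc_metric X u))" for u
  define G where "G i j u = loc_metric_inv X u $ i $ j" for i j u
  define y where "y j u = X u \<bullet> pd X j u" for j u
  \<comment> \<open>The Christoffel symbols of the first kind; their symmetry \<open>bs\<close> is
    Schwarz's theorem.\<close>
  define b where "b i k l = pd (pd X k) i u \<bullet> pd X l u" for i k l
  note df = differentiable_X[OF u] differentiable_pd_X[OF u]
  have dD: "D differentiable (at u)" unfolding D_def[abs_def] by (rule Ck_1_differentiable[OF Ck_sqrt_det u])
  have dG: "G i j differentiable (at u)" for i j unfolding G_def[abs_def] by (rule Ck_1_differentiable[OF Ck_inv u])
  have dy: "y j differentiable (at u)" for j unfolding y_def[abs_def] using df by (simp add: differentiable_inner)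
  have Gs: "G i j u = G j i u" for i j using inv_sym[OF u] by (simp add: G_def)
  have bs: "b i k l = b k i l" for i k l using pd_commute[OF open_U Ck_X u] by (simp add: b_def)
  have pD: "pd D i u = D u * (\<Sum>k\<in>UNIV. \<Sum>l\<in>UNIV. G k l u * b i k l)" for i
    unfolding D_def[abs_def] pd_sqrt_det[OF u] by (simp add: G_def b_def)
  have pG: "pd (G i j) i u = - (\<Sum>k\<in>UNIV. \<Sum>l\<in>UNIV. G i k u * (b i l k + b i k l) * G l j u)" for i j
    unfolding G_def[abs_def] pd_inv[OF u] by (simp add: b_def inner_commute)
  have py: "pd (y j) i u = X u \<bullet> pd (pd X j) i u + pd X i u \<bullet> pd X j u" for i j
    unfolding y_def[abs_def] by (rule pd_inner[OF df])
  have dS: "(\<lambda>u. \<Sum>j\<in>UNIV. G i j u * y j u) differentiable (at u)" for i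
    using dG dy by (intro differentiable_sum differentiable_mult) auto
  have "pd (flux f i) i u = D u * (\<Sum>j\<in>UNIV. G i j u * y j u) * pd f i u
      + (D u * (\<Sum>j\<in>UNIV. G i j u * pd (y j) i u + pd (G i j) i u * y j u)
        + pd D i u * (\<Sum>j\<in>UNIV. G i j u * y j u)) * f u" for i
  proof -
    have "flux f i = (\<lambda>u. D u * (\<Sum>j\<in>UNIV. G i j u * y j u) * f u)"
      by (simp add: fun_eq_iff flux_def D_def G_def y_def)
    then show ?thesis
      using dS dG dy dD f by (simp add: pd_mult pd_sum differentiable_mult)
  qed
  then have "(\<Sum>i\<in>UNIV. pd (flux f i) i u) = D u * (\<Sum>i\<in>UNIV. (\<Sum>j\<in>UNIV. G i j u * y j u) * pd f i u)
     + D u * f u * ((\<Sum>i\<in>UNIV. \<Sum>j\<in>UNIV. G i j u * pd (y j) i u)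
       + (\<Sum>i\<in>UNIV. \<Sum>j\<in>UNIV. pd (G i j) i u * y j u)
       + (\<Sum>i\<in>UNIV. (\<Sum>k\<in>UNIV. \<Sum>l\<in>UNIV. G k l u * b i k l) * (\<Sum>j\<in>UNIV. G i j u * y j u)))"
    by (simp add: pD sum.distrib sum_distrib_left algebra_simps)
  also have "(\<Sum>i\<in>UNIV. (\<Sum>j\<in>UNIV. G i j u * y j u) * pd f i u) = loc_gradient X f u \<bullet> X u"
    unfolding loc_gradient_eq_sharp sharp_inner
    by (simp add: G_def y_def sum_distrib_left sum_distrib_right inner_commute mult_ac)
  \<comment> \<open>The dimension arises as the trace of the metric with respect to itself.\<close>
  also have "(\<Sum>i\<in>UNIV. \<Sum>j\<in>UNIV. G i j u * pd (y j) i u)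
      = (\<Sum>i\<in>UNIV. \<Sum>j\<in>UNIV. G i j u * (X u \<bullet> pd (pd X j) i u)) + real CARD('n)"
  proof -
    have "(\<Sum>j\<in>UNIV. G i j u * (pd X i u \<bullet> pd X j u)) = 1" for i
      using inv_metric_component[OF u, of i i] by (simp add: G_def inner_commute)
    then show ?thesis by (simp add: py distrib_left sum.distrib)
  qed
  also have "(\<Sum>i\<in>UNIV. (\<Sum>k\<in>UNIV. \<Sum>l\<in>UNIV. G k l u * b i k l) * (\<Sum>j\<in>UNIV. G i j u * y j u))
    = (\<Sum>i\<in>UNIV. \<Sum>j\<in>UNIV. \<Sum>k\<in>UNIV. \<Sum>l\<in>UNIV. G i j u * y j u * (G k l u * b i k l))"
    by (intro sum.cong refl)
       (simp only: sum_distrib_left[symmetric] sum_distrib_right[symmetric], rule mult.commute)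
  also have "(\<Sum>i\<in>UNIV. \<Sum>j\<in>UNIV. pd (G i j) i u * y j u)
    = - (\<Sum>i\<in>UNIV. \<Sum>j\<in>UNIV. \<Sum>k\<in>UNIV. \<Sum>l\<in>UNIV. G i j u * y j u * (G k l u * b i k l))
      - (\<Sum>i\<in>UNIV. \<Sum>k\<in>UNIV. G i k u * (sharp X (\<lambda>l. b i k l) u \<bullet> X u))"
  proof -
    have "(\<Sum>i\<in>UNIV. \<Sum>j\<in>UNIV. pd (G i j) i u * y j u)
      = - (\<Sum>i\<in>UNIV. \<Sum>j\<in>UNIV. \<Sum>k\<in>UNIV. \<Sum>l\<in>UNIV. G i k u * b i l k * G l j u * y j u)
        - (\<Sum>i\<in>UNIV. \<Sum>j\<in>UNIV. \<Sum>k\<in>UNIV. \<Sum>l\<in>UNIV. G i k u * b i k l * G l j u * y j u)"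
      by (simp add: pG sum_distrib_right distrib_left distrib_right left_diff_distrib
          sum.distrib sum_subtractf sum_negf)
    \<comment> \<open>The half that will cancel against the derivative of the density;
      \<open>bs\<close> and a relabelling bring it into the same shape.\<close>
    also have "(\<Sum>i\<in>UNIV. \<Sum>j\<in>UNIV. \<Sum>k\<in>UNIV. \<Sum>l\<in>UNIV. G i k u * b i l k * G l j u * y j u)
      = (\<Sum>i\<in>UNIV. \<Sum>j\<in>UNIV. \<Sum>k\<in>UNIV. \<Sum>l\<in>UNIV. G l j u * y j u * (G i k u * b l i k))"
      using bs by (intro sum.cong refl) (simp add: mult_ac)
    also have "\<dots> = (\<Sum>i\<in>UNIV. \<Sum>j\<in>UNIV. \<Sum>k\<in>UNIV. \<Sum>l\<in>UNIV. G i j u * y j u * (G k l u * b i k l))"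
      by (rule sum4_rotate)
    also have "(\<Sum>i\<in>UNIV. \<Sum>j\<in>UNIV. \<Sum>k\<in>UNIV. \<Sum>l\<in>UNIV. G i k u * b i k l * G l j u * y j u)
      = (\<Sum>i\<in>UNIV. \<Sum>k\<in>UNIV. \<Sum>l\<in>UNIV. \<Sum>j\<in>UNIV. G i k u * b i k l * G l j u * y j u)"
      by (rule sum.cong[OF refl], rule trans[OF sum.swap], rule sum.cong[OF refl], rule sum.swap)
    also have "\<dots> = (\<Sum>i\<in>UNIV. \<Sum>k\<in>UNIV. G i k u * (sharp X (\<lambda>l. b i k l) u \<bullet> X u))"
      unfolding sharp_inner sum_distrib_left
      by (simp add: G_def y_def inner_commute mult_ac)
    finally show ?thesis .
  qed
  also have "(\<Sum>i\<in>UNIV. \<Sum>j\<in>UNIV. G i j u * (X u \<bullet> pd (pd X j) i u)) + real CARD('n)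
     + (- (\<Sum>i\<in>UNIV. \<Sum>j\<in>UNIV. \<Sum>k\<in>UNIV. \<Sum>l\<in>UNIV. G i j u * y j u * (G k l u * b i k l))
      - (\<Sum>i\<in>UNIV. \<Sum>k\<in>UNIV. G i k u * (sharp X (\<lambda>l. b i k l) u \<bullet> X u)))
     + (\<Sum>i\<in>UNIV. \<Sum>j\<in>UNIV. \<Sum>k\<in>UNIV. \<Sum>l\<in>UNIV. G i j u * y j u * (G k l u * b i k l))
     = real CARD('n) + loc_mean_curvature_vector X u \<bullet> X u"
    by (simp add: loc_mean_curvature_vector_def inner_sum_left loc_sff_inner[OF u] G_def b_def
        right_diff_distrib sum_subtractf inner_commute[of "X u"])
  finally show ?thesis by (simp add: D_def algebra_simps)
qed

end

section \<open>Codimension one: unit normals, traces of the second fundamental form, gradients by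
  duality\<close>

lemma Ck_on_Un:
  assumes "open S" "open T" "Ck_on k S f" "Ck_on k T f"
  shows "Ck_on k (S \<union> T) f"
  using assms(3,4) by (induction k arbitrary: f) (auto intro: continuous_on_open_Un assms(1,2))

text \<open>By dimension count \<open>T\<close> is the whole hyperplane orthogonal to
  \<open>N\<close>, so subtracting the component along \<open>N\<close> lands in
  \<open>T\<close>.\<close>

lemma normal_part_codim_1:
  fixes T :: "'e::euclidean_space set"
  assumes "subspace T" "Suc (dim T) = DIM('e)" "norm N = 1" "\<And>w. w \<in> T \<Longrightarrow> N \<bullet> w = 0"
  shows "normal_part T x = (x \<bullet> N) *\<^sub>R N"
proof -
  have "N \<noteq> 0" using assms(3) by auto
  have T: "T = {x. N \<bullet> x = 0}"
    by (rule subspace_dim_equal[OF assms(1) subspace_hyperplane])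
       (use assms dim_hyperplane[OF \<open>N \<noteq> 0\<close>] in auto)
  have "N \<bullet> N = 1" using assms(3) by (simp add: norm_eq_1)
  then have "tangential_part T x = x - (x \<bullet> N) *\<^sub>R N"
    by (intro tangential_part_eqI[OF assms(1)])
       (auto simp: T inner_diff_right inner_diff_left inner_commute)
  then show ?thesis by (simp add: normal_part_def)
qed

definition sff_matrix :: "(real^'n::finite \<Rightarrow> 'e::euclidean_space) \<Rightarrow> 'e \<Rightarrow> real^'n \<Rightarrow> real^'n^'n" where
  "sff_matrix X N u = (\<chi> i j. pd (pd X j) i u \<bullet> N)"

text \<open>\<open>N\<close> is a single vector at one point and not a field. It is never
  differentiated, so no local choice of orientation is involved.\<close>

definition chart_normal :: "(real^'n::finite \<Rightarrow> 'e::euclidean_space) \<Rightarrow> 'e \<Rightarrow> real^'n \<Rightarrow> bool" where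
  "chart_normal X N u \<longleftrightarrow> norm N = 1 \<and> (\<forall>w\<in>loc_tangent X u. N \<bullet> w = 0)"

context immersed_chart
begin

lemma dim_tangent: "u \<in> U \<Longrightarrow> dim (loc_tangent X u) = CARD('n)"
  unfolding loc_tangent_def using dim_image_eq[OF linear_DX inj_on_subset[OF inj_DX]]
  by (metis DIM_cart DIM_real dim_UNIV mult.right_neutral subset_UNIV)

lemma normal_part_eq:
  assumes "DIM('e) = CARD('n) + 1" "u \<in> U" "chart_normal X N u"
  shows "normal_part (loc_tangent X u) x = (x \<bullet> N) *\<^sub>R N"
  using assms by (intro normal_part_codim_1 subspace_tangent) (auto simp: chart_normal_def dim_tangent)

lemma loc_mean_curvature_vector_eq:
  assumes "DIM('e) = CARD('n) + 1" "u \<in> U" "chart_normal X N u"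
  shows "loc_mean_curvature_vector X u = trace (loc_metric_inv X u ** transpose (sff_matrix X N u)) *\<^sub>R N"
  by (simp add: loc_mean_curvature_vector_def loc_sff_def normal_part_eq[OF assms] trace_def
      matrix_matrix_mult_def transpose_def sff_matrix_def scaleR_left.sum)

text \<open>Like the mean curvature, |A|^2 becomes a trace of matrix products. A change of charts
  conjugates these products, which a trace does not see.\<close>

lemma loc_sff_norm2_eq:
  assumes "DIM('e) = CARD('n) + 1" "u \<in> U" "chart_normal X N u"
  shows "loc_sff_norm2 X u = trace ((loc_metric_inv X u ** sff_matrix X N u)
    ** (loc_metric_inv X u ** transpose (sff_matrix X N u)))"
proof -
  let ?G = "\<lambda>i j. loc_metric_inv X u $ i $ j" and ?h = "\<lambda>i j. pd (pd X j) i u \<bullet> N"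
  have "N \<bullet> N = 1" using assms(3) by (simp add: chart_normal_def norm_eq_1)
  then have "loc_sff_norm2 X u
      = (\<Sum>i\<in>UNIV. \<Sum>j\<in>UNIV. \<Sum>k\<in>UNIV. \<Sum>l\<in>UNIV. ?G k i * ?G j l * (?h i j * ?h k l))"
    by (simp add: loc_sff_norm2_def loc_sff_def normal_part_eq[OF assms] inv_sym[OF assms(2)] mult_ac)
  also have "\<dots> = (\<Sum>i\<in>UNIV. \<Sum>k\<in>UNIV. \<Sum>j\<in>UNIV. \<Sum>l\<in>UNIV. ?G k i * ?G j l * (?h i j * ?h k l))"
    by (rule sum.cong[OF refl], rule sum.swap)
  also have "\<dots> = (\<Sum>k\<in>UNIV. \<Sum>i\<in>UNIV. \<Sum>j\<in>UNIV. \<Sum>l\<in>UNIV. ?G k i * ?G j l * (?h i j * ?h k l))"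
    by (rule sum.swap)
  also have "\<dots> = (\<Sum>k\<in>UNIV. \<Sum>j\<in>UNIV. \<Sum>i\<in>UNIV. \<Sum>l\<in>UNIV. ?G k i * ?G j l * (?h i j * ?h k l))"
    by (rule sum.cong[OF refl], rule sum.swap)
  also have "\<dots> = trace ((loc_metric_inv X u ** sff_matrix X N u)
    ** (loc_metric_inv X u ** transpose (sff_matrix X N u)))"
    by (simp add: trace_def matrix_matrix_mult_def transpose_def sff_matrix_def sum_product mult_ac)
  finally show ?thesis .
qed

lemma loc_gradient_in_tangent: "u \<in> U \<Longrightarrow> loc_gradient X h u \<in> loc_tangent X u"
  unfolding loc_gradient_eq_sharp by (rule sharp_in_tangent)

lemma loc_gradient_inner:
  assumes "u \<in> U" "h differentiable (at u)"
  shows "loc_gradient X h u \<bullet> frechet_derivative X (at u) a = frechet_derivative h (at u) a"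
  using assms by (simp add: DX_eq inner_sum_right loc_gradient_eq_sharp sharp_inner_pd
      frechet_derivative_eq_sum_pd)

text \<open>The gradient is the tangent vector dual to the differential. This description is free of
  coordinates; it yields chart independence and the gradients of radial functions.\<close>

lemma loc_gradient_eqI:
  assumes "u \<in> U" "z \<in> loc_tangent X u"
    "\<And>a. z \<bullet> frechet_derivative X (at u) a = frechet_derivative h (at u) a"
  shows "loc_gradient X h u = z"
proof (rule tangent_eqI[OF assms(1) loc_gradient_in_tangent[OF assms(1)] assms(2)])
  fix k
  have "z \<bullet> pd X k u = pd h k u" using assms(3) by (simp add: pd_def)
  then show "loc_gradient X h u \<bullet> pd X k u = z \<bullet> pd X k u"
    using assms(1) by (simp add: loc_gradient_eq_sharp sharp_inner_pd)
qed

end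

section \<open>Change of charts\<close>

lemma trace_conjugate:
  fixes K J M :: "real^'n^'n"
  assumes "J ** K = mat 1"
  shows "trace (K ** M ** J) = trace M"
  using trace_mul_sym[of "K ** M" J] assms by (simp add: matrix_mul_assoc)

text \<open>Only the transition map \<tau> in one direction is given. That its derivative is
  invertible follows from \<open>Y\<close> being an immersion.\<close>

locale chart_change = X: immersed_chart X U + Y: immersed_chart Y V
  for X :: "real^'n::finite \<Rightarrow> 'e::euclidean_space" and U and Y :: "real^'n \<Rightarrow> 'e" and V +
  fixes \<tau> :: "real^'n \<Rightarrow> real^'n" and W
  assumes open_W: "open W" and W_subset: "W \<subseteq> V" and smooth_\<tau>: "smooth_on W \<tau>"
    and \<tau>_in_U: "\<And>w. w \<in> W \<Longrightarrow> \<tau> w \<in> U" and Y_eq: "\<And>w. w \<in> W \<Longrightarrow> Y w = X (\<tau> w)"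
begin

lemma differentiable_\<tau>: "w \<in> W \<Longrightarrow> \<tau> differentiable (at w)"
  using smooth_\<tau>[unfolded smooth_on_def, rule_format, of 1] by simp

lemma derivative_compose_\<tau>:
  assumes w: "w \<in> W" and h: "h differentiable (at (\<tau> w))" and k: "\<And>w. w \<in> W \<Longrightarrow> k w = h (\<tau> w)"
  shows "(k has_derivative (\<lambda>a. frechet_derivative h (at (\<tau> w)) (frechet_derivative \<tau> (at w) a))) (at w)"
proof -
  have "((\<lambda>w. h (\<tau> w)) has_derivative
      (\<lambda>a. frechet_derivative h (at (\<tau> w)) (frechet_derivative \<tau> (at w) a))) (at w)"
    using diff_chain_at[OF differentiable_\<tau>[OF w, unfolded frechet_derivative_works]
        h[unfolded frechet_derivative_works]] by (simp add: o_def)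
  then show ?thesis
    by (rule has_derivative_transform_within_open[OF _ open_W w]) (simp add: k)
qed

lemma DY_eq:
  "w \<in> W \<Longrightarrow> frechet_derivative Y (at w) a = frechet_derivative X (at (\<tau> w)) (frechet_derivative \<tau> (at w) a)"
  using frechet_derivative_at[OF derivative_compose_\<tau>[of w X Y, OF _ X.differentiable_X Y_eq]] \<tau>_in_U
  by metis

lemma surj_D\<tau>:
  assumes w: "w \<in> W"
  shows "surj (frechet_derivative \<tau> (at w))"
proof -
  have "frechet_derivative Y (at w) = frechet_derivative X (at (\<tau> w)) \<circ> frechet_derivative \<tau> (at w)"
    using DY_eq[OF w] by auto
  moreover have "inj (frechet_derivative Y (at w))" using Y.inj_DX w W_subset by blast
  ultimately have "inj (frechet_derivative \<tau> (at w))" using inj_on_imageI2 by metis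
  then show ?thesis
    using linear_injective_imp_surjective linear_frechet_derivative[OF differentiable_\<tau>[OF w]] by blast
qed

lemma loc_tangent_eq:
  assumes w: "w \<in> W"
  shows "loc_tangent Y w = loc_tangent X (\<tau> w)"
proof -
  have "frechet_derivative Y (at w) = frechet_derivative X (at (\<tau> w)) \<circ> frechet_derivative \<tau> (at w)"
    using DY_eq[OF w] by auto
  then show ?thesis unfolding loc_tangent_def by (simp only: image_comp[symmetric] surj_D\<tau>[OF w])
qed

lemma loc_gradient_change:
  assumes w: "w \<in> W" and h: "h differentiable (at (\<tau> w))" and k: "\<And>w. w \<in> W \<Longrightarrow> k w = h (\<tau> w)"
  shows "loc_gradient Y k w = loc_gradient X h (\<tau> w)"
proof (rule Y.loc_gradient_eqI)
  show "w \<in> V" using w W_subset by blast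
  show "loc_gradient X h (\<tau> w) \<in> loc_tangent Y w"
    using loc_tangent_eq[OF w] X.loc_gradient_in_tangent[OF \<tau>_in_U[OF w]] by simp
  fix a
  show "loc_gradient X h (\<tau> w) \<bullet> frechet_derivative Y (at w) a = frechet_derivative k (at w) a"
    using frechet_derivative_at[OF derivative_compose_\<tau>[OF w h k]] DY_eq[OF w]
      X.loc_gradient_inner[OF \<tau>_in_U[OF w] h] by metis
qed

definition jac :: "real^'n \<Rightarrow> real^'n^'n" where
  "jac w = (\<chi> a i. pd \<tau> i w $ a)"

lemma pd_compose_\<tau>:
  assumes w: "w \<in> W" and h: "h differentiable (at (\<tau> w))" and k: "\<And>w. w \<in> W \<Longrightarrow> k w = h (\<tau> w)"
  shows "pd k i w = (\<Sum>a\<in>UNIV. (jac w $ a $ i) *\<^sub>R pd h a (\<tau> w))"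
proof -
  have "pd k i w = frechet_derivative h (at (\<tau> w)) (frechet_derivative \<tau> (at w) (axis i 1))"
    by (rule pd_eqI[OF derivative_compose_\<tau>[OF w h k]])
  then show ?thesis
    unfolding frechet_derivative_eq_sum_pd[OF h] by (simp add: jac_def pd_def[of \<tau>])
qed

lemma pd_Y: "w \<in> W \<Longrightarrow> pd Y i w = (\<Sum>a\<in>UNIV. (jac w $ a $ i) *\<^sub>R pd X a (\<tau> w))"
  using pd_compose_\<tau>[of w X Y] X.differentiable_X[OF \<tau>_in_U] Y_eq by blast

lemma loc_metric_change:
  assumes w: "w \<in> W"
  shows "loc_metric Y w = transpose (jac w) ** loc_metric X (\<tau> w) ** jac w"
  unfolding vec_eq_iff
proof (intro allI)
  fix i j
  have "(transpose (jac w) ** loc_metric X (\<tau> w) ** jac w) $ i $ j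
     = (\<Sum>b\<in>UNIV. \<Sum>a\<in>UNIV. jac w $ a $ i * (pd X a (\<tau> w) \<bullet> pd X b (\<tau> w)) * jac w $ b $ j)"
    by (simp add: matrix_matrix_mult_def transpose_def loc_metric_def sum_distrib_right)
  also have "\<dots> = pd Y i w \<bullet> pd Y j w"
    unfolding pd_Y[OF w] inner_sum_left inner_sum_right
    by (simp add: sum_distrib_left mult_ac)
  finally show "loc_metric Y w $ i $ j = (transpose (jac w) ** loc_metric X (\<tau> w) ** jac w) $ i $ j"
    by (simp add: loc_metric_def)
qed

lemma det_jac: "w \<in> W \<Longrightarrow> det (jac w) \<noteq> 0"
  using Y.det_pos[of w] W_subset loc_metric_change[of w] by (auto simp: det_mul)

text \<open>The chain rule for second derivatives also produces the second derivatives of \<tau>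
  times coordinate fields of \<open>X\<close>. These terms are tangential, and pairing with the
  fixed vector \<open>N\<close> removes them by \<open>N0\<close>.\<close>

lemma sff_matrix_change:
  assumes w: "w \<in> W" and N: "chart_normal X N (\<tau> w)"
  shows "sff_matrix Y N w = transpose (jac w) ** sff_matrix X N (\<tau> w) ** jac w"
  unfolding vec_eq_iff
proof (intro allI)
  fix i j
  let ?J = "\<lambda>w a i. jac w $ a $ i"
  have u: "\<tau> w \<in> U" and wV: "w \<in> V" using \<tau>_in_U w W_subset by auto
  have Ck\<tau>: "Ck_on k W \<tau>" for k using smooth_\<tau> unfolding smooth_on_def by blast
  have dJ: "(\<lambda>w. ?J w a j) differentiable (at w)" for a
  proof -
    have "Ck_on (Suc 0) W (pd \<tau> j)" by (rule Ck_on_Suc_pd[OF Ck\<tau>])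
    from bounded_linear.has_derivative[OF bounded_linear_vec_nth Ck_on_Suc_has_derivative[OF this w]]
    show ?thesis by (auto simp: jac_def intro: differentiableI)
  qed
  have dX: "(\<lambda>u. pd X a u \<bullet> N) differentiable (at (\<tau> w))" for a
    by (simp add: differentiable_inner X.differentiable_pd_X[OF u])
  have dX\<tau>: "(\<lambda>w. pd X a (\<tau> w) \<bullet> N) differentiable (at w)" for a
    by (rule differentiableI, rule derivative_compose_\<tau>[OF w dX refl])
  have N0: "pd X a (\<tau> w) \<bullet> N = 0" for a
    using N X.pd_X_in_tangent[OF u] by (auto simp: chart_normal_def inner_commute)
  have pdN: "pd (\<lambda>w. Z w \<bullet> N) i w = pd Z i w \<bullet> N" if "Z differentiable (at w)" for Z :: "real^'n \<Rightarrow> 'e" and i w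
    using frechet_derivative_inner_left[OF that] by (simp add: pd_def)
  have "pd (pd Y j) i w \<bullet> N = pd (\<lambda>w. pd Y j w \<bullet> N) i w"
    by (rule pdN[symmetric, OF Y.differentiable_pd_X[OF wV]])
  also have "\<dots> = pd (\<lambda>w. \<Sum>a\<in>UNIV. ?J w a j * (pd X a (\<tau> w) \<bullet> N)) i w"
    unfolding pd_def
    by (rule fun_cong[OF frechet_derivative_transform_within_open[OF _ open_W w]])
       (use Y.differentiable_pd_X[OF wV, of j] in
         \<open>auto simp: differentiable_inner pd_Y[unfolded pd_def] inner_sum_left pd_def[abs_def]\<close>)
  also have "\<dots> = (\<Sum>a\<in>UNIV. ?J w a j * pd (\<lambda>w. pd X a (\<tau> w) \<bullet> N) i w)"
    using dJ dX\<tau> by (subst pd_sum) (auto simp: pd_mult N0 intro!: differentiable_mult)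
  also have "\<dots> = (\<Sum>a\<in>UNIV. ?J w a j * (\<Sum>b\<in>UNIV. ?J w b i * (pd (pd X a) b (\<tau> w) \<bullet> N)))"
    using pd_compose_\<tau>[OF w dX refl] by (simp add: pdN[OF X.differentiable_pd_X[OF u]])
  also have "\<dots> = (transpose (jac w) ** sff_matrix X N (\<tau> w) ** jac w) $ i $ j"
    by (simp add: matrix_matrix_mult_def transpose_def sff_matrix_def sum_distrib_right sum_distrib_left mult_ac)
  finally show "sff_matrix Y N w $ i $ j = (transpose (jac w) ** sff_matrix X N (\<tau> w) ** jac w) $ i $ j"
    by (simp add: sff_matrix_def)
qed

lemma chart_normal_change: "w \<in> W \<Longrightarrow> chart_normal Y N w = chart_normal X N (\<tau> w)"
  by (simp add: chart_normal_def loc_tangent_eq)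

lemma loc_metric_inv_change:
  assumes w: "w \<in> W"
  shows "loc_metric_inv Y w = matrix_inv (jac w) ** loc_metric_inv X (\<tau> w) ** transpose (matrix_inv (jac w))"
proof -
  let ?J = "jac w" and ?K = "matrix_inv (jac w)"
  have JK: "?J ** ?K = mat 1" and "?K ** ?J = mat 1" using matrix_inv_mult[OF det_jac[OF w]] by auto
  then have T: "transpose ?J ** transpose ?K = mat 1" by (simp add: matrix_transpose_mul[symmetric] transpose_mat)
  have "loc_metric Y w ** (?K ** loc_metric_inv X (\<tau> w) ** transpose ?K)
     = transpose ?J ** (loc_metric X (\<tau> w) ** (?J ** ?K) ** loc_metric_inv X (\<tau> w)) ** transpose ?K"
    unfolding loc_metric_change[OF w] by (simp add: matrix_mul_assoc)
  also have "\<dots> = mat 1"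
    using X.inv_mult(1)[OF \<tau>_in_U[OF w]] by (simp add: JK T)
  finally show ?thesis unfolding loc_metric_inv_def[of Y] by (rule matrix_inv_unique)
qed

text \<open>Raising an index of a bilinear form gives an endomorphism, which transforms by
  conjugation. \<open>M\<close> is arbitrary so that the second fundamental form and its transpose
  are both covered.\<close>

lemma inv_sff_change:
  assumes w: "w \<in> W" and M: "M' = transpose (jac w) ** M ** jac w"
  shows "loc_metric_inv Y w ** M' = matrix_inv (jac w) ** (loc_metric_inv X (\<tau> w) ** M) ** jac w"
proof -
  let ?J = "jac w" and ?K = "matrix_inv (jac w)"
  have "?J ** ?K = mat 1" using matrix_inv_mult[OF det_jac[OF w]] by auto
  then have T: "transpose ?K ** transpose ?J = mat 1" by (simp add: matrix_transpose_mul[symmetric] transpose_mat)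
  have "loc_metric_inv Y w ** M'
      = ?K ** loc_metric_inv X (\<tau> w) ** (transpose ?K ** transpose ?J) ** M ** ?J"
    unfolding loc_metric_inv_change[OF w] M by (simp add: matrix_mul_assoc)
  then show ?thesis by (simp add: T matrix_mul_assoc)
qed

lemma mean_curvature_change:
  assumes w: "w \<in> W" and N: "chart_normal X N (\<tau> w)" and d: "DIM('e) = CARD('n) + 1"
  shows "loc_mean_curvature_vector Y w = loc_mean_curvature_vector X (\<tau> w)"
    and "loc_sff_norm2 Y w = loc_sff_norm2 X (\<tau> w)"
proof -
  let ?J = "jac w" and ?K = "matrix_inv (jac w)"
  have JK: "?J ** ?K = mat 1" using matrix_inv_mult[OF det_jac[OF w]] by auto
  have wV: "w \<in> V" using w W_subset by auto
  note 1 = inv_sff_change[OF w sff_matrix_change[OF w N]]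
  have 2: "loc_metric_inv Y w ** transpose (sff_matrix Y N w)
     = ?K ** (loc_metric_inv X (\<tau> w) ** transpose (sff_matrix X N (\<tau> w))) ** ?J"
    by (rule inv_sff_change[OF w]) (simp add: sff_matrix_change[OF w N] matrix_transpose_mul matrix_mul_assoc)
  have NY: "chart_normal Y N w" using N chart_normal_change[OF w] by simp
  show "loc_mean_curvature_vector Y w = loc_mean_curvature_vector X (\<tau> w)"
    unfolding X.loc_mean_curvature_vector_eq[OF d \<tau>_in_U[OF w] N] Y.loc_mean_curvature_vector_eq[OF d wV NY] 2
    by (simp add: trace_conjugate[OF JK])
  have "(loc_metric_inv Y w ** sff_matrix Y N w) ** (loc_metric_inv Y w ** transpose (sff_matrix Y N w))
    = ?K ** ((loc_metric_inv X (\<tau> w) ** sff_matrix X N (\<tau> w)) ** (?J ** ?K) **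
       (loc_metric_inv X (\<tau> w) ** transpose (sff_matrix X N (\<tau> w)))) ** ?J"
    unfolding 1 2 by (simp add: matrix_mul_assoc)
  then show "loc_sff_norm2 Y w = loc_sff_norm2 X (\<tau> w)"
    unfolding X.loc_sff_norm2_eq[OF d \<tau>_in_U[OF w] N] Y.loc_sff_norm2_eq[OF d wV NY]
    by (simp add: trace_conjugate[OF JK] JK)
qed

end

section \<open>The divergence theorem in one chart\<close>

text \<open>By translation invariance the difference quotients of \<open>V\<close> have integral \<open>0\<close>.\<close>

lemma integral_pd_eq_0:
  fixes V :: "real^'n::finite \<Rightarrow> real"
  assumes V: "Ck_on 1 UNIV V" and K: "compact K" "\<And>x. x \<notin> K \<Longrightarrow> V x = 0"
  shows "integrable lborel (pd V i)" "(LINT x|lborel. pd V i x) = 0"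
proof -
  define e :: "real^'n" where "e = axis i 1"
  have ne: "norm e = 1" by (simp add: e_def)
  have cV: "continuous_on UNIV V" using Ck_on_imp_continuous_on[OF V] .
  have cD: "continuous_on UNIV (pd V i)" using Ck_on_Suc_pd[of 0 UNIV V i] V by simp
  have mD: "pd V i \<in> borel_measurable lborel" using cD borel_measurable_continuous_onI by auto
  have dV: "((\<lambda>t. V (x + t *\<^sub>R e)) has_real_derivative pd V i (x + t *\<^sub>R e)) (at t)" for x t
  proof -
    have d: "(V has_derivative frechet_derivative V (at y)) (at y)" for y
      using Ck_on_Suc_has_derivative[of 0 UNIV V y] V by simp
    have "((\<lambda>t. V (x + t *\<^sub>R e)) has_derivative
        (\<lambda>r. frechet_derivative V (at (x + t *\<^sub>R e)) (r *\<^sub>R e))) (at t)"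
      by (rule has_derivative_compose[where f = "\<lambda>t. x + t *\<^sub>R e", OF _ d])
         (auto intro!: derivative_eq_intros)
    then show ?thesis
      unfolding has_field_derivative_def
      by (rule has_derivative_eq_rhs)
         (auto simp: fun_eq_iff linear_scale[OF has_derivative_linear[OF d]] pd_def e_def)
  qed
  have D0: "pd V i x = 0" if "x \<notin> K" for x
  proof -
    have "((\<lambda>x. 0) has_derivative (\<lambda>v. 0)) (at x)" by simp
    then have "(V has_derivative (\<lambda>v. 0)) (at x)"
      by (rule has_derivative_transform_within_open[where s = "- K"])
         (use that K compact_imp_closed in auto)
    then show ?thesis by (simp add: pd_eqI)
  qed
  obtain R where R: "\<And>x. x \<in> K \<Longrightarrow> norm x \<le> R" using K(1) compact_imp_bounded bounded_iff by metis
  \<comment> \<open>The difference quotients shift by at most 1, so they all vanish outside the ball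
    enlarged by 1.\<close>
  define B :: "(real^'n) set" where "B = cball 0 (R + 1)"
  have KB: "K \<subseteq> B" using R by (force simp: B_def)
  have iB: "integrable lborel (indicator B :: _ \<Rightarrow> real)"
    using emeasure_lborel_cball_finite[of 0 "R + 1"] by (simp add: B_def integrable_indicator_iff)
  obtain C where C: "\<And>x. \<bar>pd V i x\<bar> \<le> C"
  proof -
    have "bounded (pd V i ` K)"
      by (intro compact_imp_bounded compact_continuous_image continuous_on_subset[OF cD] K) simp
    then obtain c where "\<And>x. x \<in> K \<Longrightarrow> \<bar>pd V i x\<bar> \<le> c" unfolding bounded_iff by auto
    then have "\<bar>pd V i x\<bar> \<le> max c 0" for x using D0[of x] by (cases "x \<in> K") fastforce+
    then show ?thesis using that by blast
  qed
  have iV: "integrable lborel V"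
  proof -
    have "integrable lborel (\<lambda>x. indicator K x *\<^sub>R V x)"
      by (rule borel_integrable_compact[OF K(1) continuous_on_subset[OF cV]]) simp
    moreover have "(\<lambda>x. indicator K x *\<^sub>R V x) = V" using K(2) by (fastforce simp: indicator_def)
    ultimately show ?thesis by simp
  qed
  define s where "s n x = real (Suc n) * (V (x + (1 / real (Suc n)) *\<^sub>R e) - V x)" for n x
  have shift: "integrable lborel (\<lambda>x. V (x + c)) \<and> (LINT x|lborel. V (x + c)) = (LINT x|lborel. V x)" for c
  proof -
    have "(LINT x|lborel. V x) = (LINT x|distr lborel borel ((+) c). V x)"
      by (simp add: lborel_distr_plus)
    also have "\<dots> = (LINT x|lborel. V (c + x))"
      by (rule integral_distr) (use cV in \<open>auto simp: borel_measurable_continuous_onI\<close>)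
    moreover have "integrable lborel (\<lambda>x. V (c + x))"
      by (rule integrable_distr[of "(+) c" lborel borel V]) (use iV in \<open>auto simp: lborel_distr_plus\<close>)
    ultimately show ?thesis by (simp add: add.commute)
  qed
  have s0: "(LINT x|lborel. s n x) = 0" for n
    unfolding s_def using shift iV by simp
  have lim: "(\<lambda>n. s n x) \<longlonglongrightarrow> pd V i x" for x
  proof -
    have "((\<lambda>h. (V (x + h *\<^sub>R e) - V x) / h) \<longlongrightarrow> pd V i x) (at 0)"
      using dV[of x 0] by (simp add: has_field_derivative_iff)
    moreover have "filterlim (\<lambda>n. 1 / real (Suc n)) (at 0) sequentially"
      using LIMSEQ_inverse_real_of_nat by (simp add: filterlim_at inverse_eq_divide)
    ultimately have "(\<lambda>n. (V (x + (1 / real (Suc n)) *\<^sub>R e) - V x) / (1 / real (Suc n))) \<longlonglongrightarrow> pd V i x"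
      by (rule filterlim_compose)
    then show ?thesis by (simp add: s_def mult.commute)
  qed
  have bound: "\<bar>s n x\<bar> \<le> C * indicator B x" for n x
  proof (cases "x \<in> B")
    case True
    have "\<exists>z>0. z < 1 / real (Suc n) \<and> V (x + (1 / real (Suc n)) *\<^sub>R e) - V (x + 0 *\<^sub>R e)
        = (1 / real (Suc n) - 0) * pd V i (x + z *\<^sub>R e)"
      by (rule MVT2[OF _ dV]) simp
    then obtain z where "V (x + (1 / real (Suc n)) *\<^sub>R e) - V x = 1 / real (Suc n) * pd V i (x + z *\<^sub>R e)"
      by auto
    then have "s n x = pd V i (x + z *\<^sub>R e)" unfolding s_def by (simp del: of_nat_Suc)
    then show ?thesis using C True by simp
  next
    case False
    have "x + (1 / real (Suc n)) *\<^sub>R e \<notin> K"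
    proof
      assume a: "x + (1 / real (Suc n)) *\<^sub>R e \<in> K"
      define d where "d = (1 / real (Suc n)) *\<^sub>R e"
      have "norm d \<le> 1" using ne by (simp add: d_def)
      moreover have "norm (x + d) \<le> R" using R[OF a] by (simp add: d_def)
      moreover have "norm x \<le> norm (x + d) + norm d" using norm_triangle_ineq4[of "x + d" d] by simp
      ultimately have "norm x \<le> R + 1" by linarith
      then show False using False by (simp add: B_def)
    qed
    then have "s n x = 0" using False KB K(2) unfolding s_def by (metis diff_self mult_zero_right subsetD)
    then show ?thesis using False by simp
  qed
  have m: "s n \<in> borel_measurable lborel" for n
    unfolding s_def[abs_def]
    by (auto intro!: borel_measurable_continuous_onI continuous_intros continuous_on_compose2[OF cV])
  note D = integrable_mult_right[OF iB, of C]
  have b: "AE x in lborel. norm (s n x) \<le> C * indicator B x" for n using bound by simp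
  show "integrable lborel (pd V i)"
    by (rule integrable_dominated_convergence[where s = s, OF mD m D _ b]) (use lim in auto)
  have "(\<lambda>n. LINT x|lborel. s n x) \<longlonglongrightarrow> (LINT x|lborel. pd V i x)"
    by (rule integral_dominated_convergence[where s = s, OF mD m D _ b]) (use lim in auto)
  then show "(LINT x|lborel. pd V i x) = 0"
    unfolding s0 using LIMSEQ_unique[OF tendsto_const] by metis
qed

context immersed_chart
begin

text \<open>The flux extends by 0 to a C^1 function on the whole space, since \<open>U\<close> and
  the complement of \<open>K\<close> are open and cover it. Then each partial derivative integrates
  to 0.\<close>

lemma integral_divergence:
  assumes f: "Ck_on 1 U f" and K: "compact K" "K \<subseteq> U" "\<And>u. u \<in> U - K \<Longrightarrow> f u = 0"
  defines "dens \<equiv> \<lambda>u. indicator U u * (sqrt (det (loc_metric X u)) *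
    (f u * (real CARD('n) + loc_mean_curvature_vector X u \<bullet> X u) + loc_gradient X f u \<bullet> X u))"
  shows "integrable lborel dens" "integral\<^sup>L lborel dens = 0"
proof -
  define V where "V i u = (if u \<in> U then flux f i u else 0)" for i u
  have V: "Ck_on 1 UNIV (V i)" for i
  proof -
    have "Ck_on 1 U (V i)"
      by (rule Ck_on_cong[OF open_U _ Ck_flux[OF f, of i]]) (simp add: V_def)
    moreover have "Ck_on 1 (- K) (V i)"
      by (rule Ck_on_cong[OF _ _ Ck_on_const[of 1 _ 0]])
         (use K compact_imp_closed in \<open>auto simp: V_def flux_def\<close>)
    ultimately have "Ck_on 1 (U \<union> - K) (V i)"
      by (intro Ck_on_Un open_U) (use K compact_imp_closed in auto)
    moreover have "U \<union> - K = UNIV" using K by auto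
    ultimately show ?thesis by simp
  qed
  have V0: "V i u = 0" if "u \<notin> K" for i u using that K by (auto simp: V_def flux_def)
  note I = integral_pd_eq_0[OF V K(1) V0]
  have eq: "dens u = (\<Sum>i\<in>UNIV. pd (V i) i u)" for u
  proof (cases "u \<in> U")
    case True
    have "pd (V i) i u = pd (flux f i) i u" for i
      unfolding pd_def
      by (rule fun_cong[OF frechet_derivative_transform_within_open[OF _ open_U True]])
         (use V[of i] in \<open>auto simp: V_def\<close>)
    then show ?thesis
      unfolding dens_def using True divergence_flux[OF True Ck_1_differentiable[OF f True]] by simp
  next
    case False
    have Z: "(V i has_derivative (\<lambda>v. 0)) (at u)" for i
      by (rule has_derivative_transform_within_open[OF has_derivative_const, where s = "- K"])
         (use False K compact_imp_closed V0 in auto)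
    have "pd (V i) i u = 0" for i using pd_eqI[OF Z] .
    then show ?thesis unfolding dens_def using False by simp
  qed
  show "integrable lborel dens" "integral\<^sup>L lborel dens = 0"
    unfolding eq[abs_def] using I by auto
qed

end

section \<open>Continuity of the local quantities, and |A|^2 as a sum of squares\<close>

context immersed_chart
begin

lemma continuous_sharp:
  assumes "\<And>i. continuous_on U (\<lambda>u. c u i)"
  shows "continuous_on U (\<lambda>u. sharp X (c u) u)"
  unfolding sharp_def
  by (intro continuous_intros assms Ck_on_imp_continuous_on[OF Ck_inv] Ck_on_imp_continuous_on[OF Ck_pd_X[of 0]])

lemma continuous_loc_gradient:
  assumes "Ck_on 1 U h"
  shows "continuous_on U (loc_gradient X h)"
  unfolding loc_gradient_eq_sharp[abs_def]
  using assms by (intro continuous_sharp) (simp add: pd_def)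

lemma continuous_tangential_part:
  "continuous_on U (\<lambda>u. tangential_part (loc_tangent X u) (X u))"
proof -
  have "continuous_on U (\<lambda>u. sharp X (\<lambda>i. X u \<bullet> pd X i u) u)"
    by (intro continuous_sharp continuous_intros Ck_on_imp_continuous_on[OF Ck_X[of 0]]
        Ck_on_imp_continuous_on[OF Ck_pd_X[of 0]])
  then show ?thesis by (simp add: tangential_part_eq cong: continuous_on_cong)
qed

lemma continuous_loc_sff_norm2: "continuous_on U (loc_sff_norm2 X)"
proof -
  have "continuous_on U (\<lambda>u. loc_sff X i j u)" for i j
  proof -
    have "continuous_on U (\<lambda>u. pd (pd X j) i u - sharp X (\<lambda>l. pd (pd X j) i u \<bullet> pd X l u) u)"
      by (intro continuous_sharp continuous_intros Ck_on_imp_continuous_on[OF Ck_pd_X[of 0]]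
          Ck_on_imp_continuous_on[OF Ck_pd_pd_X[of 0]])
    then show ?thesis
      by (simp add: loc_sff_def normal_part_def tangential_part_eq cong: continuous_on_cong)
  qed
  then show ?thesis
    unfolding loc_sff_norm2_def[abs_def] by (intro continuous_intros Ck_on_imp_continuous_on[OF Ck_inv])
qed

lemma sharp_inner_sharp:
  "u \<in> U \<Longrightarrow> sharp X c u \<bullet> sharp X d u = (\<Sum>i\<in>UNIV. \<Sum>j\<in>UNIV. loc_metric_inv X u $ i $ j * c i * d j)"
  unfolding sharp_inner[of X c u] by (simp add: inner_commute[of "pd X _ u"] sharp_inner_pd)

text \<open>Raising the two indices of each component of the second fundamental form in turn gives
  vectors \<open>S b b'\<close> whose squared norms add up to \<open>|A|\<^sup>2\<close>.\<close>

lemma loc_sff_norm2_nonneg: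
  assumes u: "u \<in> U"
  shows "0 \<le> loc_sff_norm2 X u"
proof -
  let ?G = "\<lambda>i j. loc_metric_inv X u $ i $ j"
  define V where "V b i = sharp X (\<lambda>j. loc_sff X i j u \<bullet> b) u" for b i
  define S where "S b b' = sharp X (\<lambda>i. V b i \<bullet> b') u" for b b'
  have "(\<Sum>b'\<in>Basis. S b b' \<bullet> S b b') = (\<Sum>i\<in>UNIV. \<Sum>k\<in>UNIV. ?G i k * (V b i \<bullet> V b k))" for b
  proof -
    have "(\<Sum>b'\<in>Basis. S b b' \<bullet> S b b')
        = (\<Sum>b'\<in>Basis. \<Sum>i\<in>UNIV. \<Sum>k\<in>UNIV. ?G i k * ((V b i \<bullet> b') * (V b k \<bullet> b')))"
      by (simp add: S_def sharp_inner_sharp[OF u] mult.assoc)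
    also have "\<dots> = (\<Sum>i\<in>UNIV. \<Sum>k\<in>UNIV. \<Sum>b'\<in>Basis. ?G i k * ((V b i \<bullet> b') * (V b k \<bullet> b')))"
      by (rule trans[OF sum.swap], rule sum.cong[OF refl], rule sum.swap)
    finally show ?thesis by (simp add: sum_distrib_left[symmetric] euclidean_inner[symmetric])
  qed
  then have "(\<Sum>b\<in>Basis. \<Sum>b'\<in>Basis. S b b' \<bullet> S b b')
      = (\<Sum>b\<in>Basis. \<Sum>i\<in>UNIV. \<Sum>k\<in>UNIV. \<Sum>j\<in>UNIV. \<Sum>l\<in>UNIV.
          ?G i k * ?G j l * ((loc_sff X i j u \<bullet> b) * (loc_sff X k l u \<bullet> b)))"
    by (simp add: V_def sharp_inner_sharp[OF u] sum_distrib_left mult.assoc)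
  also have "\<dots> = (\<Sum>i\<in>UNIV. \<Sum>k\<in>UNIV. \<Sum>j\<in>UNIV. \<Sum>l\<in>UNIV. \<Sum>b\<in>Basis.
          ?G i k * ?G j l * ((loc_sff X i j u \<bullet> b) * (loc_sff X k l u \<bullet> b)))"
    by (rule trans[OF sum.swap], rule sum.cong[OF refl])+ (rule refl)
  also have "\<dots> = (\<Sum>i\<in>UNIV. \<Sum>k\<in>UNIV. \<Sum>j\<in>UNIV. \<Sum>l\<in>UNIV.
          ?G i k * ?G j l * (loc_sff X i j u \<bullet> loc_sff X k l u))"
    by (simp add: sum_distrib_left[symmetric] euclidean_inner[symmetric])
  also have "\<dots> = loc_sff_norm2 X u"
    unfolding loc_sff_norm2_def by (rule sum.cong[OF refl], rule sum.swap)
  finally have "loc_sff_norm2 X u = (\<Sum>b\<in>Basis. \<Sum>b'\<in>Basis. S b b' \<bullet> S b b')" by simp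
  then show ?thesis by (simp add: sum_nonneg)
qed

end

section \<open>Immersed hypersurfaces\<close>

locale hypersurface =
  fixes \<A> :: "('n::finite, 'm::t2_space) atlas" and F :: "'m \<Rightarrow> 'e::euclidean_space"
    and N :: "'m \<Rightarrow> 'e" and \<sigma> :: "'m measure"
  assumes immersed: "immersed_hypersurface \<A> F"
    and unit: "unit_normal \<A> F N" and volume: "volume_measure \<A> F \<sigma>"
begin

lemma chart_props:
  assumes "(U, \<phi>) \<in> \<A>"
  shows "open U" "open (\<phi> ` U)" "inj_on \<phi> U" "continuous_on U \<phi>"
    "continuous_on (\<phi> ` U) (the_inv_into U \<phi>)"
  using immersed assms unfolding immersed_hypersurface_def smooth_atlas_def homeomorphism_def by blast+

lemma DIM_eq: "DIM('e) = CARD('n) + 1"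
  using immersed unfolding immersed_hypersurface_def by blast

lemma smooth_F: "(U, \<phi>) \<in> \<A> \<Longrightarrow> smooth_on U (F \<circ> \<phi>)"
  using immersed unfolding immersed_hypersurface_def smooth_map_def by blast

lemma immersed_chart: "(U, \<phi>) \<in> \<A> \<Longrightarrow> immersed_chart (F \<circ> \<phi>) U"
  using chart_props(1) smooth_F immersed unfolding immersed_hypersurface_def
  by unfold_locales blast+

lemma chartE:
  obtains U \<phi> u where "(U, \<phi>) \<in> \<A>" "u \<in> U" "\<phi> u = p"
proof -
  have "p \<in> (\<Union>(U, \<phi>)\<in>\<A>. \<phi> ` U)"
    using immersed unfolding immersed_hypersurface_def smooth_atlas_def by blast
  then show ?thesis using that by auto
qed

lemma chart_change:
  assumes "(U, \<phi>) \<in> \<A>" "(V, \<psi>) \<in> \<A>"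
  shows "chart_change (F \<circ> \<phi>) U (F \<circ> \<psi>) V (the_inv_into U \<phi> \<circ> \<psi>) {v\<in>V. \<psi> v \<in> \<phi> ` U}"
proof -
  interpret X: immersed_chart "F \<circ> \<phi>" U by (rule immersed_chart[OF assms(1)])
  interpret Y: immersed_chart "F \<circ> \<psi>" V by (rule immersed_chart[OF assms(2)])
  note inj = chart_props(3)[OF assms(1)]
  show ?thesis
  proof
    show "open {v\<in>V. \<psi> v \<in> \<phi> ` U}"
      using continuous_open_preimage[OF chart_props(4,1)[OF assms(2)] chart_props(2)[OF assms(1)]]
      by (simp add: vimage_def Int_def)
    show "smooth_on {v\<in>V. \<psi> v \<in> \<phi> ` U} (the_inv_into U \<phi> \<circ> \<psi>)"
      using immersed assms unfolding immersed_hypersurface_def smooth_atlas_def by blast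
  qed (auto simp: the_inv_into_f_f[OF inj])
qed

lemma local_repE:
  obtains U \<phi> u where "(U, \<phi>) \<in> \<A>" "u \<in> U" "\<phi> u = p" "local_rep \<A> p = (\<phi>, u)"
proof -
  obtain U \<phi> u where "(U, \<phi>) \<in> \<A>" "u \<in> U" "\<phi> u = p" by (rule chartE)
  then have "\<exists>x. case x of (\<phi>, u) \<Rightarrow> \<exists>U. (U, \<phi>) \<in> \<A> \<and> u \<in> U \<and> \<phi> u = p" by blast
  from someI_ex[OF this] show ?thesis
    unfolding local_rep_def[symmetric] using that by (auto split: prod.splits)
qed

text \<open>The choice in \<open>local_rep\<close> may return any parametrization through the point,
  so invariance under transition maps at that point is what allows evaluation in the chart at
  hand.\<close>

lemma at_point_eq:
  assumes "(V, \<psi>) \<in> \<A>" "v \<in> V"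
    and "\<And>U \<phi>. (U, \<phi>) \<in> \<A> \<Longrightarrow> v \<in> {v\<in>V. \<psi> v \<in> \<phi> ` U} \<Longrightarrow> Q \<psi> v = Q \<phi> ((the_inv_into U \<phi> \<circ> \<psi>) v)"
  shows "at_point \<A> Q (\<psi> v) = Q \<psi> v"
proof -
  obtain U \<phi> u where *: "(U, \<phi>) \<in> \<A>" "u \<in> U" "\<phi> u = \<psi> v" "local_rep \<A> (\<psi> v) = (\<phi>, u)"
    by (rule local_repE)
  have "\<psi> v \<in> \<phi> ` U" using *(2,3) by (metis imageI)
  then have "Q \<psi> v = Q \<phi> (the_inv_into U \<phi> (\<psi> v))" using assms(3)[OF *(1)] assms(2) by simp
  also have "the_inv_into U \<phi> (\<psi> v) = u"
    using the_inv_into_f_f[OF chart_props(3)[OF *(1)] *(2)] *(3) by simp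
  finally show ?thesis using *(4) by (simp add: at_point_def)
qed

lemma tangent_space_chart:
  assumes "(V, \<psi>) \<in> \<A>" "v \<in> V"
  shows "tangent_space \<A> F (\<psi> v) = loc_tangent (F \<circ> \<psi>) v"
  unfolding tangent_space_def
  by (rule at_point_eq[OF assms]) (rule chart_change.loc_tangent_eq[OF chart_change[OF _ assms(1)]])

lemma chart_normal:
  assumes "(V, \<psi>) \<in> \<A>" "v \<in> V"
  shows "chart_normal (F \<circ> \<psi>) (N (\<psi> v)) v"
  using unit unfolding unit_normal_def chart_normal_def
  by (simp add: tangent_space_chart[OF assms, symmetric] orthogonal_def)

lemma chart_normal_inv:
  assumes "(U, \<phi>) \<in> \<A>" "v \<in> {v\<in>V. \<psi> v \<in> \<phi> ` U}"
  shows "chart_normal (F \<circ> \<phi>) (N (\<psi> v)) ((the_inv_into U \<phi> \<circ> \<psi>) v)"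
proof -
  obtain u where "u \<in> U" "\<psi> v = \<phi> u" using assms(2) by auto
  then show ?thesis using chart_normal[OF assms(1)] by (simp add: the_inv_into_f_f[OF chart_props(3)[OF assms(1)]])
qed

lemma mean_curvature_vector_chart:
  assumes "(V, \<psi>) \<in> \<A>" "v \<in> V"
  shows "mean_curvature_vector \<A> F (\<psi> v) = loc_mean_curvature_vector (F \<circ> \<psi>) v"
  unfolding mean_curvature_vector_def
  by (rule at_point_eq[OF assms])
     (rule chart_change.mean_curvature_change(1)[OF chart_change[OF _ assms(1)] _ chart_normal_inv DIM_eq])

lemma sff_norm2_chart:
  assumes "(V, \<psi>) \<in> \<A>" "v \<in> V"
  shows "sff_norm2 \<A> F (\<psi> v) = loc_sff_norm2 (F \<circ> \<psi>) v"
  unfolding sff_norm2_def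
  by (rule at_point_eq[OF assms])
     (rule chart_change.mean_curvature_change(2)[OF chart_change[OF _ assms(1)] _ chart_normal_inv DIM_eq])

text \<open>The class to which the divergence theorem applies. It contains the bumps built from
  \<open>plateau\<close>, which are not smooth.\<close>

definition C1 :: "('m \<Rightarrow> real) \<Rightarrow> bool" where
  "C1 f \<longleftrightarrow> (\<forall>(U, \<phi>)\<in>\<A>. Ck_on 1 U (f \<circ> \<phi>))"

lemma C1D: "C1 f \<Longrightarrow> (U, \<phi>) \<in> \<A> \<Longrightarrow> Ck_on 1 U (\<lambda>u. f (\<phi> u))"
  unfolding C1_def o_def by blast

lemma C1I: "(\<And>U \<phi>. (U, \<phi>) \<in> \<A> \<Longrightarrow> Ck_on 1 U (\<lambda>u. f (\<phi> u))) \<Longrightarrow> C1 f"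
  unfolding C1_def o_def by blast

lemma C1_differentiable:
  "C1 f \<Longrightarrow> (U, \<phi>) \<in> \<A> \<Longrightarrow> u \<in> U \<Longrightarrow> (\<lambda>u. f (\<phi> u)) differentiable (at u)"
  by (drule (1) C1D) simp

lemma C1_const: "C1 (\<lambda>p. c)"
  by (intro C1I Ck_on_const)

lemma C1_mult: "C1 f \<Longrightarrow> C1 g \<Longrightarrow> C1 (\<lambda>p. f p * g p)"
proof (rule C1I)
  fix U \<phi> assume *: "C1 f" "C1 g" "(U, \<phi>) \<in> \<A>"
  show "Ck_on 1 U (\<lambda>u. f (\<phi> u) * g (\<phi> u))"
    by (rule Ck_on_mult[OF chart_props(1)[OF *(3)] C1D[OF *(1,3)] C1D[OF *(2,3)]])
qed

lemma C1_diff: "C1 f \<Longrightarrow> C1 g \<Longrightarrow> C1 (\<lambda>p. f p - g p)"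
proof (rule C1I)
  fix U \<phi> assume *: "C1 f" "C1 g" "(U, \<phi>) \<in> \<A>"
  show "Ck_on 1 U (\<lambda>u. f (\<phi> u) - g (\<phi> u))"
    by (rule Ck_on_diff[OF chart_props(1)[OF *(3)] C1D[OF *(1,3)] C1D[OF *(2,3)]])
qed

lemma gradient_chart:
  assumes "(V, \<psi>) \<in> \<A>" "v \<in> V" and f: "C1 f"
  shows "gradient \<A> F f (\<psi> v) = loc_gradient (F \<circ> \<psi>) (f \<circ> \<psi>) v"
  unfolding gradient_def
proof (rule at_point_eq[OF assms(1,2)])
  fix U \<phi> assume U: "(U, \<phi>) \<in> \<A>" and v: "v \<in> {v\<in>V. \<psi> v \<in> \<phi> ` U}"
  note inv = the_inv_into_f_f[OF chart_props(3)[OF U]]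
  show "loc_gradient (F \<circ> \<psi>) (f \<circ> \<psi>) v
      = loc_gradient (F \<circ> \<phi>) (f \<circ> \<phi>) ((the_inv_into U \<phi> \<circ> \<psi>) v)"
    by (rule chart_change.loc_gradient_change[OF chart_change[OF U assms(1)] v C1_differentiable[OF f U, folded o_def]])
       (use v in \<open>auto simp: inv\<close>)
qed

lemma continuous_chartI:
  assumes "\<And>U \<phi>. (U, \<phi>) \<in> \<A> \<Longrightarrow> continuous_on U (\<lambda>u. g (\<phi> u))"
  shows "continuous_on UNIV g"
proof -
  have "continuous_on (\<phi> ` U) g" if "(U, \<phi>) \<in> \<A>" for U \<phi>
  proof -
    have inv: "the_inv_into U \<phi> (\<phi> u) = u" if "u \<in> U" for u
      using the_inv_into_f_f[OF chart_props(3)[OF \<open>(U, \<phi>) \<in> \<A>\<close>] that] .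
    have "continuous_on (\<phi> ` U) (\<lambda>p. g (\<phi> (the_inv_into U \<phi> p)))"
      by (rule continuous_on_compose2[OF assms[OF that] chart_props(5)[OF that]]) (auto simp: inv)
    then show ?thesis by (rule continuous_on_eq) (auto simp: inv)
  qed
  then have "continuous_on (\<Union>(U, \<phi>)\<in>\<A>. \<phi> ` U) g"
    by (intro continuous_on_open_UN) (auto simp: chart_props)
  moreover have "(\<Union>(U, \<phi>)\<in>\<A>. \<phi> ` U) = UNIV"
    using immersed unfolding immersed_hypersurface_def smooth_atlas_def by blast
  ultimately show ?thesis by simp
qed

lemma Ck_F: "(U, \<phi>) \<in> \<A> \<Longrightarrow> Ck_on k U (\<lambda>u. F (\<phi> u))"
  using smooth_F unfolding smooth_on_def o_def by blast

lemma continuous_F: "continuous_on UNIV F"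
  by (intro continuous_chartI Ck_on_imp_continuous_on[OF Ck_F[of _ _ 0]])

lemma continuous_C1: "C1 f \<Longrightarrow> continuous_on UNIV f"
  by (intro continuous_chartI Ck_on_imp_continuous_on[OF C1D])

lemma continuous_sff_norm2: "continuous_on UNIV (sff_norm2 \<A> F)"
proof (rule continuous_chartI)
  fix U \<phi> assume U: "(U, \<phi>) \<in> \<A>"
  show "continuous_on U (\<lambda>u. sff_norm2 \<A> F (\<phi> u))"
    using immersed_chart.continuous_loc_sff_norm2[OF immersed_chart[OF U]]
    by (rule continuous_on_eq) (simp add: sff_norm2_chart[OF U])
qed

lemma sff_norm2_nonneg: "0 \<le> sff_norm2 \<A> F p"
proof -
  obtain U \<phi> u where u: "(U, \<phi>) \<in> \<A>" "u \<in> U" "\<phi> u = p" by (rule chartE)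
  then show ?thesis
    using immersed_chart.loc_sff_norm2_nonneg[OF immersed_chart[OF u(1)] u(2)] sff_norm2_chart[OF u(1,2)] by simp
qed

lemma continuous_pos_tangential: "continuous_on UNIV (pos_tangential \<A> F)"
proof (rule continuous_chartI)
  fix U \<phi> assume U: "(U, \<phi>) \<in> \<A>"
  show "continuous_on U (\<lambda>u. pos_tangential \<A> F (\<phi> u))"
    using immersed_chart.continuous_tangential_part[OF immersed_chart[OF U]]
    by (rule continuous_on_eq) (simp add: pos_tangential_def tangent_space_chart[OF U])
qed

lemma continuous_gradient:
  assumes "C1 f"
  shows "continuous_on UNIV (gradient \<A> F f)"
proof (rule continuous_chartI)
  fix U \<phi> assume U: "(U, \<phi>) \<in> \<A>"
  show "continuous_on U (\<lambda>u. gradient \<A> F f (\<phi> u))"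
    using immersed_chart.continuous_loc_gradient[OF immersed_chart[OF U] C1D[OF assms U, folded o_def]]
    by (rule continuous_on_eq) (simp add: gradient_chart[OF U _ assms])
qed

lemma normal_part_eq: "normal_part (tangent_space \<A> F p) x = (x \<bullet> N p) *\<^sub>R N p"
proof -
  obtain U \<phi> u where u: "(U, \<phi>) \<in> \<A>" "u \<in> U" "\<phi> u = p" by (rule chartE)
  show ?thesis
    using immersed_chart.normal_part_eq[OF immersed_chart[OF u(1)] DIM_eq u(2) chart_normal[OF u(1,2)]]
      tangent_space_chart[OF u(1,2)] u(3) by simp
qed

lemma norm_N: "N p \<bullet> N p = 1"
  using unit by (simp add: unit_normal_def norm_eq_1)

lemma pos_tangential_eq: "pos_tangential \<A> F p = F p - (F p \<bullet> N p) *\<^sub>R N p"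
  using normal_part_eq[of p "F p"] by (simp add: pos_tangential_def normal_part_def algebra_simps)

lemma pos_tangential_inner_F: "pos_tangential \<A> F p \<bullet> F p = (norm (pos_tangential \<A> F p))\<^sup>2"
  unfolding power2_norm_eq_inner pos_tangential_eq
  by (simp add: inner_diff_left inner_diff_right norm_N inner_commute)

lemma norm_pos_tangential_sq: "(norm (pos_tangential \<A> F p))\<^sup>2 = (norm (F p))\<^sup>2 - (F p \<bullet> N p)\<^sup>2"
  unfolding pos_tangential_inner_F[symmetric]
  unfolding power2_norm_eq_inner pos_tangential_eq
  by (simp add: inner_diff_left inner_diff_right inner_commute power2_eq_square)

text \<open>\<open>N\<close> may be discontinuous, but the square of its pairing with x equals |x|^2
  - |x^T|^2.\<close>

lemma continuous_normal_sq: "continuous_on UNIV (\<lambda>p. (F p \<bullet> N p)\<^sup>2)"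
proof -
  have "continuous_on UNIV (\<lambda>p. (norm (F p))\<^sup>2 - (norm (pos_tangential \<A> F p))\<^sup>2)"
    by (intro continuous_intros continuous_F continuous_pos_tangential)
  then show ?thesis by (simp add: norm_pos_tangential_sq)
qed

section \<open>The volume measure in charts\<close>

lemma sets_\<sigma>: "sets \<sigma> = sets borel"
  using volume by (simp add: volume_measure_def)

lemma space_\<sigma>: "space \<sigma> = UNIV"
  using sets_eq_imp_space_eq[OF sets_\<sigma>] by simp

lemma measurable_continuous: "continuous_on UNIV f \<Longrightarrow> f \<in> borel_measurable \<sigma>"
  using borel_measurable_continuous_onI measurable_cong_sets[OF sets_\<sigma> refl] by blast

definition chart_density :: "(real^'n \<Rightarrow> 'm) \<Rightarrow> (real^'n) set \<Rightarrow> real^'n \<Rightarrow> real" where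
  "chart_density \<phi> U u = indicator U u * sqrt (det (loc_metric (F \<circ> \<phi>) u))"

text \<open>A parametrization is arbitrary outside its domain. A constant value there makes it Borel
  measurable on the whole space, so that push-forwards can be formed.\<close>

definition extend :: "(real^'n \<Rightarrow> 'm) \<Rightarrow> (real^'n) set \<Rightarrow> real^'n \<Rightarrow> 'm" where
  "extend \<phi> U u = (if u \<in> U then \<phi> u else undefined)"

lemma chart_density_nonneg: "(U, \<phi>) \<in> \<A> \<Longrightarrow> 0 \<le> chart_density \<phi> U u"
  using immersed_chart.det_pos[OF immersed_chart, of U \<phi> u]
  by (auto simp: chart_density_def indicator_def intro: less_imp_le)

lemma measurable_chart_density:
  assumes "(U, \<phi>) \<in> \<A>"
  shows "chart_density \<phi> U \<in> borel_measurable lborel"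
proof -
  have "(\<lambda>u. indicator U u *\<^sub>R sqrt (det (loc_metric (F \<circ> \<phi>) u))) \<in> borel_measurable borel"
    by (rule borel_measurable_continuous_on_indicator)
       (use chart_props[OF assms] Ck_on_imp_continuous_on[OF immersed_chart.Ck_sqrt_det[OF immersed_chart[OF assms]]]
         in auto)
  then show ?thesis by (simp add: chart_density_def[abs_def])
qed

lemma measurable_extend:
  assumes "(U, \<phi>) \<in> \<A>"
  shows "extend \<phi> U \<in> borel_measurable lborel"
proof -
  have "extend \<phi> U \<in> borel_measurable borel"
  proof (rule borel_measurableI)
    fix S :: "'m set" assume "open S"
    then have "open (U \<inter> \<phi> -` S)"
      using continuous_open_preimage chart_props[OF assms] by blast
    moreover have "extend \<phi> U -` S \<inter> space borel
        = (U \<inter> \<phi> -` S) \<union> (if undefined \<in> S then - U else {})"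
      by (auto simp: extend_def split: if_splits)
    ultimately show "extend \<phi> U -` S \<inter> space borel \<in> sets borel"
      using chart_props(1)[OF assms] by auto
  qed
  then show ?thesis by simp
qed

lemma emeasure_chart:
  assumes "(U, \<phi>) \<in> \<A>" "B \<in> sets borel" "B \<subseteq> \<phi> ` U"
  shows "emeasure \<sigma> B = (\<integral>\<^sup>+ u\<in>{u\<in>U. \<phi> u \<in> B}. ennreal (sqrt (det (loc_metric (F \<circ> \<phi>) u))) \<partial>lborel)"
  using volume assms unfolding volume_measure_def by blast

text \<open>\<open>volume_measure\<close> prescribes only the measures of Borel sets inside a chart.
  Read as an equality of measures, this makes the transformation rules for integrals
  available.\<close>

lemma distr_chart:
  assumes U: "(U, \<phi>) \<in> \<A>"
  shows "density \<sigma> (indicator (\<phi> ` U)) = distr (density lborel (\<lambda>u. ennreal (chart_density \<phi> U u))) borel (extend \<phi> U)"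
proof (rule measure_eqI)
  fix B assume "B \<in> sets (density \<sigma> (indicator (\<phi> ` U)))"
  then have B: "B \<in> sets borel" by (simp add: sets_\<sigma>)
  have "\<phi> ` U \<in> sets borel" using chart_props(2)[OF U] by simp
  then have UB: "\<phi> ` U \<inter> B \<in> sets borel" "\<phi> ` U \<in> sets \<sigma>" "B \<in> sets \<sigma>" using B sets_\<sigma> by auto
  note [measurable] = measurable_chart_density[OF U]
  have mE: "extend \<phi> U \<in> measurable (density lborel (\<lambda>u. ennreal (chart_density \<phi> U u))) borel"
    using measurable_extend[OF U] by simp
  have mS: "extend \<phi> U -` B \<inter> space lborel \<in> sets lborel"
    using measurable_sets[OF measurable_extend[OF U] B] .
  have "emeasure (density \<sigma> (indicator (\<phi> ` U))) B = emeasure \<sigma> (\<phi> ` U \<inter> B)"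
    using UB by (simp add: emeasure_density Int_commute indicator_inter_arith[symmetric] mult.commute)
  also have "\<dots> = (\<integral>\<^sup>+ u\<in>{u\<in>U. \<phi> u \<in> \<phi> ` U \<inter> B}. ennreal (sqrt (det (loc_metric (F \<circ> \<phi>) u))) \<partial>lborel)"
    by (rule emeasure_chart[OF U UB(1)]) simp
  also have "\<dots> = (\<integral>\<^sup>+ u\<in>extend \<phi> U -` B \<inter> space lborel. ennreal (chart_density \<phi> U u) \<partial>lborel)"
    by (rule nn_integral_cong) (auto simp: chart_density_def extend_def indicator_def)
  also have "\<dots> = emeasure (density lborel (\<lambda>u. ennreal (chart_density \<phi> U u))) (extend \<phi> U -` B \<inter> space lborel)"
    using mS by (simp add: emeasure_density)
  also have "\<dots> = emeasure (distr (density lborel (\<lambda>u. ennreal (chart_density \<phi> U u))) borel (extend \<phi> U)) B"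
    using emeasure_distr[OF mE B] by simp
  finally show "emeasure (density \<sigma> (indicator (\<phi> ` U))) B
    = emeasure (distr (density lborel (\<lambda>u. ennreal (chart_density \<phi> U u))) borel (extend \<phi> U)) B" .
qed (simp add: sets_\<sigma>)

lemma integral_chart:
  fixes g :: "'m \<Rightarrow> real"
  assumes U: "(U, \<phi>) \<in> \<A>" and g: "continuous_on UNIV g" and g0: "\<And>p. p \<notin> \<phi> ` U \<Longrightarrow> g p = 0"
  shows "integrable \<sigma> g \<longleftrightarrow> integrable lborel (\<lambda>u. chart_density \<phi> U u * g (\<phi> u))"
    and "integral\<^sup>L \<sigma> g = (LINT u|lborel. chart_density \<phi> U u * g (\<phi> u))"
proof -
  let ?\<nu> = "density lborel (\<lambda>u. ennreal (chart_density \<phi> U u))"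
  have gm: "g \<in> borel_measurable borel" using g borel_measurable_continuous_onI by blast
  have mE: "extend \<phi> U \<in> measurable ?\<nu> borel" using measurable_extend[OF U] by simp
  have gE: "(\<lambda>u. g (extend \<phi> U u)) \<in> borel_measurable lborel"
    using measurable_compose[OF measurable_extend[OF U] gm] .
  have "\<phi> ` U \<in> sets \<sigma>" using chart_props(2)[OF U] sets_\<sigma> by simp
  then have im: "(\<lambda>p. indicator (\<phi> ` U) p :: real) \<in> borel_measurable \<sigma>" by simp
  have ind: "density \<sigma> (indicator (\<phi> ` U)) = density \<sigma> (\<lambda>p. ennreal (indicator (\<phi> ` U) p))"
    by (simp add: ennreal_indicator)
  have gi: "(\<lambda>p. indicator (\<phi> ` U) p *\<^sub>R g p) = g"
    using g0 by (fastforce simp: indicator_def)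
  have ge: "chart_density \<phi> U u *\<^sub>R g (extend \<phi> U u) = chart_density \<phi> U u * g (\<phi> u)" for u
    by (simp add: chart_density_def extend_def)
  have nonneg: "AE u in lborel. 0 \<le> chart_density \<phi> U u" using chart_density_nonneg[OF U] by simp
  have "integrable \<sigma> g \<longleftrightarrow> integrable (density \<sigma> (indicator (\<phi> ` U))) g"
    unfolding ind using integrable_density[OF measurable_continuous[OF g] im] gi by simp
  also have "\<dots> \<longleftrightarrow> integrable ?\<nu> (\<lambda>u. g (extend \<phi> U u))"
    unfolding distr_chart[OF U] by (rule integrable_distr_eq[OF mE gm])
  also have "\<dots> \<longleftrightarrow> integrable lborel (\<lambda>u. chart_density \<phi> U u * g (\<phi> u))"
    using integrable_density[OF gE measurable_chart_density[OF U] nonneg] by (simp only: ge)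
  finally show "integrable \<sigma> g \<longleftrightarrow> integrable lborel (\<lambda>u. chart_density \<phi> U u * g (\<phi> u))" .
  have "integral\<^sup>L \<sigma> g = integral\<^sup>L (density \<sigma> (indicator (\<phi> ` U))) g"
    unfolding ind using integral_density[OF measurable_continuous[OF g] im] gi by simp
  also have "\<dots> = integral\<^sup>L ?\<nu> (\<lambda>u. g (extend \<phi> U u))"
    unfolding distr_chart[OF U] by (rule integral_distr[OF mE gm])
  also have "\<dots> = (LINT u|lborel. chart_density \<phi> U u * g (\<phi> u))"
    using integral_density[OF gE measurable_chart_density[OF U] nonneg] by (simp only: ge)
  finally show "integral\<^sup>L \<sigma> g = (LINT u|lborel. chart_density \<phi> U u * g (\<phi> u))" .
qed

lemma compact_chart_image: "(U, \<phi>) \<in> \<A> \<Longrightarrow> compact K \<Longrightarrow> K \<subseteq> U \<Longrightarrow> compact (\<phi> ` K)"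
  by (rule compact_continuous_image[OF continuous_on_subset[OF chart_props(4)]])

text \<open>Around each point there is a coordinate ball on which the density is bounded; finitely
  many of their images cover \<open>K\<close>.\<close>

lemma emeasure_compact_finite:
  assumes K: "compact K"
  shows "emeasure \<sigma> K < \<infinity>"
proof -
  have "\<exists>S. open S \<and> p \<in> S \<and> emeasure \<sigma> S < \<infinity>" for p
  proof -
    obtain U \<phi> u where u: "(U, \<phi>) \<in> \<A>" "u \<in> U" "\<phi> u = p" by (rule chartE)
    obtain r where r: "r > 0" "cball u r \<subseteq> U" using chart_props(1)[OF u(1)] u(2) open_contains_cball by blast
    let ?g = "\<lambda>u. sqrt (det (loc_metric (F \<circ> \<phi>) u))"
    have cont: "continuous_on U ?g"
      by (rule Ck_on_imp_continuous_on[OF immersed_chart.Ck_sqrt_det[OF immersed_chart[OF u(1)]]])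
    obtain C where C: "\<And>x. x \<in> cball u r \<Longrightarrow> ?g x \<le> C"
    proof -
      have "bounded (?g ` cball u r)"
        by (intro compact_imp_bounded compact_continuous_image continuous_on_subset[OF cont r(2)]) simp
      then show ?thesis using that unfolding bounded_iff by (metis abs_le_D1 imageI real_norm_def)
    qed
    let ?O = "\<phi> ` ball u r"
    have bU: "ball u r \<subseteq> U" using r(2) by auto
    have "?O = \<phi> ` U \<inter> the_inv_into U \<phi> -` ball u r"
      using bU by (force simp: the_inv_into_f_f[OF chart_props(3)[OF u(1)]])
    then have oO: "open ?O"
      using continuous_open_preimage[OF chart_props(5,2)[OF u(1)] open_ball] by simp
    have "emeasure \<sigma> ?O = (\<integral>\<^sup>+ x\<in>{x\<in>U. \<phi> x \<in> ?O}. ennreal (?g x) \<partial>lborel)"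
      by (rule emeasure_chart[OF u(1)]) (use oO bU in auto)
    also have "\<dots> \<le> (\<integral>\<^sup>+ x. ennreal C * indicator (cball u r) x \<partial>lborel)"
    proof (rule nn_integral_mono)
      fix x
      have "x \<in> cball u r" if "x \<in> U" "\<phi> x \<in> ?O"
        using that bU inj_onD[OF chart_props(3)[OF u(1)]] by (metis ball_subset_cball imageE subsetD)
      then show "ennreal (?g x) * indicator {x\<in>U. \<phi> x \<in> ?O} x \<le> ennreal C * indicator (cball u r) x"
        using C by (auto simp: indicator_def ennreal_leI)
    qed
    also have "\<dots> = ennreal C * emeasure lborel (cball u r)"
      by (rule nn_integral_cmult_indicator) simp
    also have "\<dots> < \<infinity>"
      using emeasure_lborel_cball_finite[of u r] by (simp add: ennreal_mult_less_top)
    finally show ?thesis using oO r(1) u(3) by (intro exI[of _ ?O]) auto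
  qed
  then obtain Q where Q: "\<And>p. open (Q p)" "\<And>p. p \<in> Q p" "\<And>p. emeasure \<sigma> (Q p) < \<infinity>" by metis
  obtain D where D: "D \<subseteq> K" "finite D" "K \<subseteq> (\<Union>p\<in>D. Q p)"
    by (rule compactE_image[OF K, of K Q]) (use Q in auto)
  have "emeasure \<sigma> K \<le> emeasure \<sigma> (\<Union>p\<in>D. Q p)"
    by (rule emeasure_mono[OF D(3)]) (use D(2) Q(1) sets_\<sigma> in auto)
  also have "\<dots> \<le> (\<Sum>p\<in>D. emeasure \<sigma> (Q p))"
    by (rule emeasure_subadditive_finite[OF D(2)]) (use Q(1) sets_\<sigma> in auto)
  also have "\<dots> < \<infinity>" using D(2) Q(3) by (simp add: less_top)
  finally show ?thesis .
qed

lemma integrable_continuous_compact: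
  fixes g :: "'m \<Rightarrow> real"
  assumes g: "continuous_on UNIV g" and K: "compact K" "\<And>p. p \<notin> K \<Longrightarrow> g p = 0"
  shows "integrable \<sigma> g"
proof -
  have Ks: "K \<in> sets \<sigma>" using compact_imp_closed[OF K(1)] sets_\<sigma> by simp
  have "bounded (g ` K)"
    by (intro compact_imp_bounded compact_continuous_image continuous_on_subset[OF g] K) simp
  then obtain c where c: "\<And>x. x \<in> K \<Longrightarrow> \<bar>g x\<bar> \<le> c" unfolding bounded_iff by auto
  have "integrable \<sigma> (\<lambda>x. c * indicator K x)"
    using emeasure_compact_finite[OF K(1)] Ks by simp
  then show ?thesis
  proof (rule Bochner_Integration.integrable_bound[OF _ measurable_continuous[OF g]])
    show "AE x in \<sigma>. norm (g x) \<le> norm (c * indicator K x)"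
    proof (rule AE_I2)
      fix x show "norm (g x) \<le> norm (c * indicator K x)"
        using c[of x] K(2)[of x] by (cases "x \<in> K") auto
    qed
  qed
qed

text \<open>The density is positive on a nonempty open chart domain. This keeps the denominator of
  the final quotient away from 0.\<close>

lemma emeasure_\<sigma>_nonzero: "emeasure \<sigma> UNIV \<noteq> 0"
proof
  assume 0: "emeasure \<sigma> UNIV = 0"
  \<comment> \<open>Any point will do; the type is inhabited.\<close>
  obtain U \<phi> u where u: "(U, \<phi>) \<in> \<A>" "u \<in> U" by (rule chartE[of undefined]) blast
  have UB: "\<phi> ` U \<in> sets borel" using chart_props(2)[OF u(1)] by simp
  have "emeasure \<sigma> (\<phi> ` U) = 0"
    using emeasure_mono[of "\<phi> ` U" UNIV \<sigma>] 0 sets_\<sigma> by (metis bot.extremum_uniqueI bot_ennreal sets.top space_\<sigma> subset_UNIV)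
  moreover have "emeasure \<sigma> (\<phi> ` U)
     = (\<integral>\<^sup>+ x\<in>{x\<in>U. \<phi> x \<in> \<phi> ` U}. ennreal (sqrt (det (loc_metric (F \<circ> \<phi>) x))) \<partial>lborel)"
    by (rule emeasure_chart[OF u(1) UB]) simp
  moreover have "\<dots> = (\<integral>\<^sup>+ x. ennreal (chart_density \<phi> U x) \<partial>lborel)"
    by (rule nn_integral_cong) (auto simp: chart_density_def indicator_def)
  ultimately have "(\<integral>\<^sup>+ x. ennreal (chart_density \<phi> U x) \<partial>lborel) = 0" by simp
  then have "AE x in lborel. ennreal (chart_density \<phi> U x) = 0"
    using measurable_chart_density[OF u(1)] by (subst (asm) nn_integral_0_iff_AE) auto
  then have "AE x in lborel. x \<notin> U"
    by eventually_elim
       (use immersed_chart.det_pos[OF immersed_chart[OF u(1)]] in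
         \<open>fastforce simp: chart_density_def indicator_def ennreal_eq_0_iff split: if_splits\<close>)
  then have "emeasure lborel U = 0"
    using AE_iff_measurable[of U lborel "\<lambda>x. x \<notin> U"] chart_props(1)[OF u(1)] by auto
  obtain r where r: "r > 0" "ball u r \<subseteq> U" using chart_props(1)[OF u(1)] u(2) openE by blast
  have "emeasure lborel (ball u r) \<le> emeasure lborel U"
    by (rule emeasure_mono[OF r(2)]) (use chart_props(1)[OF u(1)] in auto)
  then have "emeasure lborel (ball u r) = 0" using \<open>emeasure lborel U = 0\<close> by simp
  moreover have "0 < measure lborel (ball u r)" using content_ball_pos[OF r(1)] by simp
  ultimately show False by (simp add: measure_def)
qed

end

section \<open>The divergence theorem on a self-expander\<close>

lemma pd_add:
  fixes a b :: "real^'n \<Rightarrow> real"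
  assumes "a differentiable (at u)" "b differentiable (at u)"
  shows "pd (\<lambda>x. a x + b x) i u = pd a i u + pd b i u"
  using pd_eqI[OF has_derivative_add[OF assms[unfolded frechet_derivative_works]], of i]
  by (simp add: pd_def)

locale expander_hypersurface = hypersurface \<A> F N \<sigma>
  for \<A> :: "('n::finite, 'm::t2_space) atlas" and F :: "'m \<Rightarrow> 'e::euclidean_space"
    and N :: "'m \<Rightarrow> 'e" and \<sigma> :: "'m measure" +
  assumes proper: "properly_immersed F" and expander: "self_expander \<A> F"
begin

text \<open>The divergence of \<open>f x\<^sup>T\<close>: here \<open>\<langle>\<^bold>H, x\<rangle> = |x\<^sup>\<bottom>|\<^sup>2 / 2\<close>, because \<open>\<^bold>H = x\<^sup>\<bottom> / 2\<close>.\<close>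

definition divergence :: "('m \<Rightarrow> real) \<Rightarrow> 'm \<Rightarrow> real" where
  "divergence f p = f p * (real CARD('n) + (F p \<bullet> N p)\<^sup>2 / 2) + gradient \<A> F f p \<bullet> F p"

lemma mean_curvature_vector_eq: "mean_curvature_vector \<A> F p = ((F p \<bullet> N p) / 2) *\<^sub>R N p"
  using expander by (simp add: self_expander_def pos_normal_def normal_part_eq)

lemma continuous_divergence: "C1 f \<Longrightarrow> continuous_on UNIV (divergence f)"
  unfolding divergence_def[abs_def]
  by (intro continuous_on_add continuous_on_mult continuous_on_divide continuous_on_inner
      continuous_on_const continuous_C1 continuous_gradient continuous_F continuous_normal_sq) auto

lemma gradient_eq_0:
  assumes f: "C1 f" and S: "open S" "p \<in> S" "\<And>q. q \<in> S \<Longrightarrow> f q = 0"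
  shows "gradient \<A> F f p = 0"
proof -
  obtain U \<phi> u where u: "(U, \<phi>) \<in> \<A>" "u \<in> U" "\<phi> u = p" by (rule chartE)
  have "open (U \<inter> \<phi> -` S)"
    by (rule continuous_open_preimage[OF chart_props(4,1)[OF u(1)] S(1)])
  then have "((f \<circ> \<phi>) has_derivative (\<lambda>v. 0)) (at u)"
    by (rule has_derivative_transform_within_open[OF has_derivative_const]) (use u S in auto)
  then have "pd (f \<circ> \<phi>) i u = 0" for i using pd_eqI by fast
  then have "loc_gradient (F \<circ> \<phi>) (f \<circ> \<phi>) u = 0" by (simp add: loc_gradient_def)
  then show ?thesis using gradient_chart[OF u(1,2) f] u(3) by simp
qed

lemma divergence_eq_0:
  assumes "C1 f" "open S" "p \<in> S" "\<And>q. q \<in> S \<Longrightarrow> f q = 0"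
  shows "divergence f p = 0"
  using gradient_eq_0[OF assms] assms(3,4) by (simp add: divergence_def)

lemma divergence_add:
  assumes f: "C1 f" and g: "C1 g" and fg: "C1 (\<lambda>p. f p + g p)"
  shows "divergence (\<lambda>p. f p + g p) p = divergence f p + divergence g p"
proof -
  obtain U \<phi> u where u: "(U, \<phi>) \<in> \<A>" "u \<in> U" "\<phi> u = p" by (rule chartE)
  have "gradient \<A> F (\<lambda>p. f p + g p) p = gradient \<A> F f p + gradient \<A> F g p"
    using gradient_chart[OF u(1,2) f] gradient_chart[OF u(1,2) g] gradient_chart[OF u(1,2) fg] u(3)
      C1_differentiable[OF f u(1,2)] C1_differentiable[OF g u(1,2)]
    by (simp add: loc_gradient_def o_def pd_add algebra_simps sum.distrib)
  then show ?thesis by (simp add: divergence_def algebra_simps)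
qed

lemma integral_divergence_chart:
  assumes U: "(U, \<phi>) \<in> \<A>" and f: "C1 f" and K: "compact K" "K \<subseteq> U"
    and f0: "\<And>p. p \<notin> \<phi> ` K \<Longrightarrow> f p = 0"
  shows "integrable \<sigma> (divergence f)" "integral\<^sup>L \<sigma> (divergence f) = 0"
proof -
  interpret X: immersed_chart "F \<circ> \<phi>" U by (rule immersed_chart[OF U])
  have cl: "closed (\<phi> ` K)" by (rule compact_imp_closed[OF compact_chart_image[OF U K]])
  have D0: "divergence f p = 0" if "p \<notin> \<phi> ` U" for p
    by (rule divergence_eq_0[OF f, of "- \<phi> ` K"]) (use cl that K f0 in auto)
  have eq: "indicator U u * (sqrt (det (loc_metric (F \<circ> \<phi>) u)) *
     ((f \<circ> \<phi>) u * (real CARD('n) + loc_mean_curvature_vector (F \<circ> \<phi>) u \<bullet> (F \<circ> \<phi>) u)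
       + loc_gradient (F \<circ> \<phi>) (f \<circ> \<phi>) u \<bullet> (F \<circ> \<phi>) u)) = chart_density \<phi> U u * divergence f (\<phi> u)" for u
  proof (cases "u \<in> U")
    case True
    have "loc_mean_curvature_vector (F \<circ> \<phi>) u \<bullet> F (\<phi> u) = (F (\<phi> u) \<bullet> N (\<phi> u))\<^sup>2 / 2"
      using mean_curvature_vector_chart[OF U True] mean_curvature_vector_eq[of "\<phi> u"]
      by (metis inner_commute inner_scaleR_left power2_eq_square times_divide_eq_left)
    then show ?thesis
      using True by (simp add: chart_density_def divergence_def gradient_chart[OF U True f])
  qed (simp add: chart_density_def)
  have Ck: "Ck_on 1 U (f \<circ> \<phi>)" using C1D[OF f U] by (simp add: o_def)
  have f0': "(f \<circ> \<phi>) u = 0" if "u \<in> U - K" for u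
    using that f0[of "\<phi> u"] K inj_onD[OF chart_props(3)[OF U]] by auto
  note I = X.integral_divergence[OF Ck K f0', unfolded eq]
  show "integrable \<sigma> (divergence f)"
    using integral_chart(1)[OF U continuous_divergence[OF f] D0] I(1) by simp
  show "integral\<^sup>L \<sigma> (divergence f) = 0"
    using integral_chart(2)[OF U continuous_divergence[OF f] D0] I(2) by simp
qed

section \<open>From one chart to compact support\<close>

definition bump :: "('m \<Rightarrow> real) \<Rightarrow> bool" where
  "bump \<beta> \<longleftrightarrow> C1 \<beta> \<and> (\<exists>(U, \<phi>)\<in>\<A>. \<exists>K. compact K \<and> K \<subseteq> U \<and> (\<forall>p. p \<notin> \<phi> ` K \<longrightarrow> \<beta> p = 0))"

text \<open>A radial plateau in one chart, extended by 0. The extension is C^1 in every other chart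
  because compact sets are closed in a Hausdorff space.\<close>

lemma bump_exists: "\<exists>\<beta> S. bump \<beta> \<and> open S \<and> p \<in> S \<and> (\<forall>q\<in>S. \<beta> q = 1)"
proof -
  obtain U \<phi> u where u: "(U, \<phi>) \<in> \<A>" "u \<in> U" "\<phi> u = p" by (rule chartE)
  note inv = the_inv_into_f_f[OF chart_props(3)[OF u(1)]]
  obtain r where r: "r > 0" "cball u r \<subseteq> U" using chart_props(1)[OF u(1)] u(2) open_contains_cball by blast
  \<comment> \<open>The factor 2 sends the sphere of radius \<open>r\<close> to the value 2, where
    \<open>plateau\<close> vanishes; on the ball of radius \<open>r / 2\<close> the value stays
    below 1.\<close>
  define c where "c x = 2 * ((x - u) \<bullet> (x - u)) / r\<^sup>2" for x
  define \<beta> where "\<beta> q = (if q \<in> \<phi> ` U then plateau (c (the_inv_into U \<phi> q)) else 0)" for q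
  have c2: "2 \<le> c x" if "x \<notin> cball u r" for x
  proof -
    have "r < norm (x - u)" using that by (simp add: dist_norm norm_minus_commute)
    then have "r\<^sup>2 \<le> (norm (x - u))\<^sup>2" using r(1) by (intro power_mono) auto
    then show ?thesis using r(1) by (simp add: c_def power2_norm_eq_inner field_simps)
  qed
  have \<beta>0: "\<beta> q = 0" if "q \<notin> \<phi> ` cball u r" for q
  proof (cases "q \<in> \<phi> ` U")
    case True
    then obtain x where x: "x \<in> U" "q = \<phi> x" by blast
    then have "x \<notin> cball u r" using that by blast
    then show ?thesis using plateau_eq_0[OF c2] x by (simp add: \<beta>_def inv)
  qed (simp add: \<beta>_def)
  have cK: "compact (\<phi> ` cball u r)" by (rule compact_chart_image[OF u(1) compact_cball r(2)])
  have C1\<beta>: "C1 \<beta>"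
  proof (rule C1I)
    fix V \<psi> assume V: "(V, \<psi>) \<in> \<A>"
    interpret C: chart_change "F \<circ> \<phi>" U "F \<circ> \<psi>" V "the_inv_into U \<phi> \<circ> \<psi>" "{v\<in>V. \<psi> v \<in> \<phi> ` U}"
      by (rule chart_change[OF u(1) V])
    \<comment> \<open>The overlap of the charts and the part that avoids the compact support: two
      open sets that cover \<open>V\<close>, with a formula for the bump on each.\<close>
    let ?W = "{v\<in>V. \<psi> v \<in> \<phi> ` U}" and ?W' = "V \<inter> \<psi> -` (- \<phi> ` cball u r)"
    have W': "open ?W'"
      by (rule continuous_open_preimage[OF chart_props(4,1)[OF V]]) (use cK compact_imp_closed in auto)
    have "Ck_on 1 ?W (\<lambda>v. (the_inv_into U \<phi> \<circ> \<psi>) v - u)"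
      by (rule Ck_on_diff[OF C.open_W C.smooth_\<tau>[unfolded smooth_on_def, rule_format] Ck_on_const])
    then have "Ck_on 1 ?W (\<lambda>v. 2 / r\<^sup>2 * (((the_inv_into U \<phi> \<circ> \<psi>) v - u) \<bullet> ((the_inv_into U \<phi> \<circ> \<psi>) v - u)))"
      by (intro Ck_on_mult Ck_on_inner C.open_W Ck_on_const)
    then have "Ck_on 1 ?W (\<lambda>v. plateau (2 / r\<^sup>2 * (((the_inv_into U \<phi> \<circ> \<psi>) v - u) \<bullet> ((the_inv_into U \<phi> \<circ> \<psi>) v - u))))"
      by (rule Ck_on_compose_real[OF C.open_W subset_UNIV _ Ck_on_plateau])
    then have 1: "Ck_on 1 ?W (\<lambda>v. \<beta> (\<psi> v))"
      by (rule Ck_on_cong[OF C.open_W, rotated]) (simp add: \<beta>_def c_def)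
    have 2: "Ck_on 1 ?W' (\<lambda>v. \<beta> (\<psi> v))"
      by (rule Ck_on_cong[OF W' _ Ck_on_const[of 1 _ 0]]) (simp add: \<beta>0)
    have "?W \<union> ?W' = V" using r(2) by blast
    then show "Ck_on 1 V (\<lambda>v. \<beta> (\<psi> v))" using Ck_on_Un[OF C.open_W W' 1 2] by simp
  qed
  let ?S = "\<phi> ` U \<inter> the_inv_into U \<phi> -` ball u (r / 2)"
  have "open ?S" by (rule continuous_open_preimage[OF chart_props(5,2)[OF u(1)] open_ball])
  moreover have "p \<in> ?S" using u r(1) by (auto simp: inv)
  moreover have "\<beta> q = 1" if "q \<in> ?S" for q
  proof -
    let ?x = "the_inv_into U \<phi> q"
    have "norm (?x - u) \<le> r / 2" using that by (simp add: dist_norm norm_minus_commute)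
    then have "(norm (?x - u))\<^sup>2 \<le> (r / 2)\<^sup>2" by (intro power_mono) auto
    then have "4 * ((?x - u) \<bullet> (?x - u)) \<le> r\<^sup>2" by (simp add: power2_norm_eq_inner field_simps)
    moreover have "0 \<le> (?x - u) \<bullet> (?x - u)" by simp
    ultimately have "2 * ((?x - u) \<bullet> (?x - u)) \<le> r\<^sup>2" by linarith
    then have "c ?x \<le> 1" using r(1) by (simp add: c_def)
    then show ?thesis using that plateau_eq_1 by (simp add: \<beta>_def)
  qed
  moreover have "bump \<beta>" unfolding bump_def using C1\<beta> u(1) \<beta>0 r(2) by (blast intro: compact_cball)
  ultimately show ?thesis by blast
qed

text \<open>In place of a partition of unity: split \<open>f = f \<beta> + f (1 - \<beta>)\<close> for one bump \<open>\<beta>\<close> at a time.\<close>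

lemma integral_divergence_bumps:
  assumes "finite B" "\<And>\<beta>. \<beta> \<in> B \<Longrightarrow> bump \<beta>" "C1 f" "\<And>p. f p \<noteq> 0 \<Longrightarrow> \<exists>\<beta>\<in>B. \<beta> p = 1"
  shows "integrable \<sigma> (divergence f) \<and> integral\<^sup>L \<sigma> (divergence f) = 0"
  using assms
proof (induction B arbitrary: f rule: finite_induct)
  case empty
  then have "divergence f p = 0" for p by (intro divergence_eq_0[of f UNIV]) auto
  then have "divergence f = (\<lambda>p. 0)" by auto
  then show ?case by simp
next
  case (insert \<beta> B)
  have \<beta>: "C1 \<beta>" using insert.prems(1) by (simp add: bump_def)
  obtain U \<phi> K where K: "(U, \<phi>) \<in> \<A>" "compact K" "K \<subseteq> U" "\<And>p. p \<notin> \<phi> ` K \<Longrightarrow> \<beta> p = 0"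
    using insert.prems(1)[of \<beta>] unfolding bump_def by blast
  define f1 where "f1 p = f p * \<beta> p" for p
  define f2 where "f2 p = f p * (1 - \<beta> p)" for p
  have f1: "C1 f1" unfolding f1_def[abs_def] by (rule C1_mult[OF insert.prems(2) \<beta>])
  have f2: "C1 f2" unfolding f2_def[abs_def]
    by (rule C1_mult[OF insert.prems(2) C1_diff[OF C1_const \<beta>]])
  have I1: "integrable \<sigma> (divergence f1)" "integral\<^sup>L \<sigma> (divergence f1) = 0"
    using integral_divergence_chart[OF K(1) f1 K(2,3)] K(4) by (simp_all add: f1_def)
  \<comment> \<open>\<open>f2\<close> vanishes wherever \<beta> is 1, so the remaining bumps suffice
    for it.\<close>
  have "\<exists>\<beta>'\<in>B. \<beta>' p = 1" if "f2 p \<noteq> 0" for p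
    using insert.prems(3)[of p] that by (auto simp: f2_def)
  then have I2: "integrable \<sigma> (divergence f2) \<and> integral\<^sup>L \<sigma> (divergence f2) = 0"
    by (intro insert.IH f2) (use insert.prems in auto)
  have f12: "(\<lambda>p. f1 p + f2 p) = f" by (auto simp: f1_def f2_def algebra_simps)
  have "divergence f = (\<lambda>p. divergence f1 p + divergence f2 p)"
    using divergence_add[OF f1 f2] insert.prems(2) unfolding f12 by auto
  then show ?case using I1 I2 by simp
qed

lemma integral_divergence_compact:
  assumes f: "C1 f" and K: "compact K" "\<And>p. p \<notin> K \<Longrightarrow> f p = 0"
  shows "integrable \<sigma> (divergence f)" "integral\<^sup>L \<sigma> (divergence f) = 0"
proof -
  obtain \<beta> S where \<beta>: "\<And>p. bump (\<beta> p)" "\<And>p. open (S p)" "\<And>p. p \<in> S p" "\<And>p q. q \<in> S p \<Longrightarrow> \<beta> p q = (1::real)"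
    using bump_exists by metis
  obtain D where D: "D \<subseteq> K" "finite D" "K \<subseteq> (\<Union>p\<in>D. S p)"
    by (rule compactE_image[OF K(1), of K S]) (use \<beta> in auto)
  have "\<exists>b\<in>\<beta> ` D. b p = 1" if "f p \<noteq> 0" for p
    using K(2)[of p] that D(3) \<beta>(4) by blast
  then have "integrable \<sigma> (divergence f) \<and> integral\<^sup>L \<sigma> (divergence f) = 0"
    by (intro integral_divergence_bumps[of "\<beta> ` D"] f) (use D(2) \<beta>(1) in auto)
  then show "integrable \<sigma> (divergence f)" "integral\<^sup>L \<sigma> (divergence f) = 0" by auto
qed

text \<open>Here properness enters: it gives every cutoff in |x|^2 compact support.\<close>

lemma compact_sublevel: "compact {p. (norm (F p))\<^sup>2 \<le> R}"
proof (cases "R \<ge> 0")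
  case True
  have "{p. (norm (F p))\<^sup>2 \<le> R} = F -` cball 0 (sqrt R)"
    using True by (auto simp: real_le_rsqrt sqrt_ge_absD)
  then show ?thesis using proper by (simp add: properly_immersed_def)
next
  case False
  then have "{p. (norm (F p))\<^sup>2 \<le> R} = {}"
    by (auto simp: not_le) (meson less_le_trans zero_le_power2)
  then show ?thesis by simp
qed

lemma Ck_norm_F_sq: "(U, \<phi>) \<in> \<A> \<Longrightarrow> Ck_on k U (\<lambda>u. (norm (F (\<phi> u)))\<^sup>2)"
  unfolding power2_norm_eq_inner by (intro Ck_on_inner Ck_F chart_props(1))

lemma Ck_radial:
  fixes G :: "real \<Rightarrow> real"
  assumes "Ck_on k UNIV G" "(U, \<phi>) \<in> \<A>"
  shows "Ck_on k U (\<lambda>u. G ((norm (F (\<phi> u)))\<^sup>2))"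
  by (rule Ck_on_compose_real[OF chart_props(1)[OF assms(2)] subset_UNIV Ck_norm_F_sq[OF assms(2)] assms(1)])

lemma C1_radial: "Ck_on 1 UNIV (G :: real \<Rightarrow> real) \<Longrightarrow> C1 (\<lambda>p. G ((norm (F p))\<^sup>2))"
  by (rule C1I) (rule Ck_radial)

lemma smooth_radial: "(\<And>k. Ck_on k UNIV (G :: real \<Rightarrow> real)) \<Longrightarrow> smooth_map \<A> (\<lambda>p. G ((norm (F p))\<^sup>2))"
  unfolding smooth_map_def smooth_on_def o_def using Ck_radial by blast

text \<open>The ambient gradient of G(|x|^2) is 2 G' x; its tangential projection has the required
  pairings with tangent vectors, because the normal component pairs to 0.\<close>

lemma gradient_radial:
  assumes G: "Ck_on 1 UNIV G" "\<And>s. (G has_real_derivative G' s) (at s)"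
  shows "gradient \<A> F (\<lambda>p. G ((norm (F p))\<^sup>2)) p = (2 * G' ((norm (F p))\<^sup>2)) *\<^sub>R pos_tangential \<A> F p"
proof -
  obtain U \<phi> u where u: "(U, \<phi>) \<in> \<A>" "u \<in> U" "\<phi> u = p" by (rule chartE)
  interpret X: immersed_chart "F \<circ> \<phi>" U by (rule immersed_chart[OF u(1)])
  let ?DX = "frechet_derivative (F \<circ> \<phi>) (at u)"
  let ?h = "(\<lambda>p. G ((norm (F p))\<^sup>2)) \<circ> \<phi>"
  have dX: "((F \<circ> \<phi>) has_derivative ?DX) (at u)"
    using X.differentiable_X[OF u(2)] frechet_derivative_works by blast
  have "((\<lambda>x. (F \<circ> \<phi>) x \<bullet> (F \<circ> \<phi>) x) has_derivative (\<lambda>a. 2 * (F p \<bullet> ?DX a))) (at u)"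
    by (rule has_derivative_eq_rhs[OF has_derivative_inner[OF dX dX]])
       (simp add: fun_eq_iff u(3) inner_commute)
  then have "((\<lambda>x. G ((F \<circ> \<phi>) x \<bullet> (F \<circ> \<phi>) x)) has_derivative
      (\<lambda>a. 2 * (F p \<bullet> ?DX a) * G' ((F \<circ> \<phi>) u \<bullet> (F \<circ> \<phi>) u))) (at u)"
    by (rule DERIV_compose_FDERIV[OF G(2)])
  then have dh: "(?h has_derivative (\<lambda>a. 2 * (F p \<bullet> ?DX a) * G' ((norm (F p))\<^sup>2))) (at u)"
    by (simp add: o_def power2_norm_eq_inner u(3))
  have T: "loc_tangent (F \<circ> \<phi>) u = tangent_space \<A> F p" using tangent_space_chart[OF u(1,2)] u(3) by simp
  have "loc_gradient (F \<circ> \<phi>) ?h u = (2 * G' ((norm (F p))\<^sup>2)) *\<^sub>R pos_tangential \<A> F p"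
  proof (rule X.loc_gradient_eqI[OF u(2)])
    have "pos_tangential \<A> F p \<in> loc_tangent (F \<circ> \<phi>) u"
      unfolding pos_tangential_def T[symmetric] X.tangential_part_eq[OF u(2)]
      by (rule X.sharp_in_tangent[OF u(2)])
    then show "(2 * G' ((norm (F p))\<^sup>2)) *\<^sub>R pos_tangential \<A> F p \<in> loc_tangent (F \<circ> \<phi>) u"
      by (rule subspace_scale[OF X.subspace_tangent[OF u(2)]])
    fix a
    have "?DX a \<in> loc_tangent (F \<circ> \<phi>) u" by (simp add: loc_tangent_def)
    then have "N p \<bullet> ?DX a = 0"
      using chart_normal[OF u(1,2)] u(3) by (simp add: chart_normal_def)
    then show "(2 * G' ((norm (F p))\<^sup>2)) *\<^sub>R pos_tangential \<A> F p \<bullet> ?DX a = frechet_derivative ?h (at u) a"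
      using frechet_derivative_at[OF dh, symmetric] by (simp add: pos_tangential_eq inner_diff_left)
  qed
  then show ?thesis using gradient_chart[OF u(1,2) C1_radial[OF G(1)]] u(3) by simp
qed

end

section \<open>The weighted integrals\<close>

text \<open>Monotone convergence in the form of Beppo Levi: a uniform bound on the integrals yields
  integrability of the limit. Its contrapositive detects divergence of the |A|^2 integral.\<close>

lemma integrable_bounded_incseq:
  fixes f :: "nat \<Rightarrow> 'a \<Rightarrow> real"
  assumes f: "\<And>i. integrable M (f i)" "\<And>x. mono (\<lambda>i. f i x)" "\<And>i x. 0 \<le> f i x"
    and lim: "\<And>x. (\<lambda>i. f i x) \<longlonglongrightarrow> u x" and bound: "\<And>i. integral\<^sup>L M (f i) \<le> C"
    and u: "u \<in> borel_measurable M"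
  shows "integrable M u" "(\<lambda>i. integral\<^sup>L M (f i)) \<longlonglongrightarrow> integral\<^sup>L M u"
proof -
  have mono: "incseq (\<lambda>i. integral\<^sup>L M (f i))"
    unfolding incseq_def by (auto intro!: integral_mono f monoD[OF f(2)])
  obtain L where L: "(\<lambda>i. integral\<^sup>L M (f i)) \<longlonglongrightarrow> L"
    using incseq_convergent[OF mono, of C] bound by metis
  show "integrable M u" and "(\<lambda>i. integral\<^sup>L M (f i)) \<longlonglongrightarrow> integral\<^sup>L M u"
    using integral_monotone_convergence_nonneg[of M f u L] f lim L u by auto
qed

lemma ext_integral_eq_integral:
  assumes "integrable M f"
  shows "ext_integral M f = ereal (integral\<^sup>L M f)"
proof -
  have *: "enn2ereal x = ereal (enn2real x)" if "x < \<infinity>" for x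
    using that by (cases x) auto
  have "(\<integral>\<^sup>+ p. ennreal (f p) \<partial>M) < \<infinity>" "(\<integral>\<^sup>+ p. ennreal (- f p) \<partial>M) < \<infinity>"
    using assms unfolding real_integrable_def by (auto simp: less_top)
  then show ?thesis
    unfolding ext_integral_def real_lebesgue_integral_def[OF assms] by (simp add: *)
qed

text \<open>The positive part of u - v is at most |u|, hence has finite integral. As v is at most
  the negative part plus |u|, the negative part has infinite integral.\<close>

lemma ext_integral_diff_eq_MInf:
  assumes u: "integrable M u" and v: "v \<in> borel_measurable M" "\<And>x. 0 \<le> v x" "\<not> integrable M v"
  shows "ext_integral M (\<lambda>x. u x - v x) = -\<infinity>"
proof -
  have m: "(\<lambda>x. ennreal (u x - v x)) \<in> borel_measurable M" "(\<lambda>x. ennreal (- (u x - v x))) \<in> borel_measurable M"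
    using u v(1) by auto
  have ui: "(\<integral>\<^sup>+ x. ennreal \<bar>u x\<bar> \<partial>M) < \<infinity>" using u by (simp add: integrable_iff_bounded)
  have vi: "(\<integral>\<^sup>+ x. ennreal (v x) \<partial>M) = \<infinity>"
    using v by (auto simp: integrable_iff_bounded less_top[symmetric])
  have "(\<integral>\<^sup>+ x. ennreal (u x - v x) \<partial>M) \<le> (\<integral>\<^sup>+ x. ennreal \<bar>u x\<bar> \<partial>M)"
    using v(2) by (intro nn_integral_mono ennreal_leI) (smt (verit))
  then have pos: "(\<integral>\<^sup>+ x. ennreal (u x - v x) \<partial>M) < \<infinity>" using ui by simp
  have "(\<integral>\<^sup>+ x. ennreal (v x) \<partial>M) \<le> (\<integral>\<^sup>+ x. ennreal (- (u x - v x)) + ennreal \<bar>u x\<bar> \<partial>M)"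
  proof (rule nn_integral_mono)
    fix x
    show "ennreal (v x) \<le> ennreal (- (u x - v x)) + ennreal \<bar>u x\<bar>"
    proof (cases "0 \<le> v x - u x")
      case True
      then show ?thesis by (simp flip: ennreal_plus add: ennreal_leI)
    next
      case False
      then have "ennreal (v x) \<le> ennreal \<bar>u x\<bar>" by (intro ennreal_leI) simp
      then show ?thesis by (simp add: add_increasing)
    qed
  qed
  also have "\<dots> = (\<integral>\<^sup>+ x. ennreal (- (u x - v x)) \<partial>M) + (\<integral>\<^sup>+ x. ennreal \<bar>u x\<bar> \<partial>M)"
    by (rule nn_integral_add) (use m u in auto)
  finally have "(\<integral>\<^sup>+ x. ennreal (- (u x - v x)) \<partial>M) = \<infinity>"
    using vi ui by (metis ennreal_add_eq_top infinity_ennreal_def less_top top.extremum_uniqueI)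
  moreover obtain r where "(\<integral>\<^sup>+ x. ennreal (u x - v x) \<partial>M) = ennreal r" "0 \<le> r"
    using pos by (cases "\<integral>\<^sup>+ x. ennreal (u x - v x) \<partial>M") auto
  ultimately show ?thesis unfolding ext_integral_def by simp
qed

text \<open>Applied to \<open>s = |x|\<^sup>2\<close> and \<open>q = \<langle>x, N\<rangle>\<^sup>2 = 4 H\<^sup>2\<close>. The condition on \<open>\<alpha>\<close> says exactly that
  \<open>\<alpha>/2 > 2 (\<alpha> + 1) a\<^sup>2\<close>.\<close>

lemma quadratic_growth:
  fixes a b \<alpha> n :: real
  assumes ab: "0 \<le> a" "a < 1/2" "0 < b" and \<alpha>: "a\<^sup>2 / (1/4 - a\<^sup>2) < \<alpha>" and n: "0 \<le> n"
  obtains \<kappa> M s0 where "0 < \<kappa>" "0 \<le> M"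
    "\<And>s q. 0 \<le> s \<Longrightarrow> q \<le> 4 * (a * sqrt s + b)\<^sup>2 \<Longrightarrow>
      \<kappa> * (s + 1) \<le> \<alpha> / 2 * (s - q) - n - q / 2 + (if s \<le> s0 then M else 0)"
proof -
  have "a\<^sup>2 < (1/2)\<^sup>2" using ab by (intro power_strict_mono) auto
  then have d: "1/4 - a\<^sup>2 > 0" by (simp add: power2_eq_square)
  have \<alpha>0: "0 < \<alpha>" using \<alpha> d by (smt (verit) divide_nonneg_pos zero_le_power2)
  have "a\<^sup>2 < \<alpha> * (1/4 - a\<^sup>2)" using \<alpha> d by (simp add: pos_divide_less_eq)
  \<comment> \<open>The coefficient of s that remains once q is replaced by its bound, whose leading
    term is 4 a^2 s.\<close>
  define k where "k = \<alpha> / 2 - 2 * (\<alpha> + 1) * a\<^sup>2"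
  have k: "k > 0" using \<open>a\<^sup>2 < \<alpha> * (1/4 - a\<^sup>2)\<close> by (simp add: k_def algebra_simps)
  \<comment> \<open>The cross term of the square. Young's inequality trades it for half of
    \<open>k * s\<close> plus the constant m^2 / (2 k) inside \<open>C\<close>.\<close>
  define m where "m = 4 * (\<alpha> + 1) * a * b"
  define C where "C = m\<^sup>2 / (2 * k) + 2 * (\<alpha> + 1) * b\<^sup>2 + n"
  have C: "0 \<le> C" using k \<alpha>0 n by (auto simp: C_def intro!: add_nonneg_nonneg)
  \<comment> \<open>Beyond \<open>s0\<close> the bound k/2 s - C already exceeds k/4 (s + 1); below
    it, \<open>M\<close> makes up for the deficit.\<close>
  define s0 where "s0 = 4 / k * (C + k / 4)"
  have s0: "k / 4 * s0 = C + k / 4" using k by (simp add: s0_def)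
  define M where "M = k / 4 * (s0 + 1) + C"
  have M: "0 \<le> M" using s0 k C by (simp add: M_def distrib_left)
  have main: "k / 2 * s - C \<le> \<alpha> / 2 * (s - q) - n - q / 2"
    if s: "0 \<le> s" and q: "q \<le> 4 * (a * sqrt s + b)\<^sup>2" for s q
  proof -
    have "(\<alpha> + 1) / 2 * q \<le> (\<alpha> + 1) / 2 * (4 * (a * sqrt s + b)\<^sup>2)"
      using q \<alpha>0 by (intro mult_left_mono) auto
    also have "\<dots> = 2 * (\<alpha> + 1) * a\<^sup>2 * s + m * sqrt s + 2 * (\<alpha> + 1) * b\<^sup>2"
      using s by (simp add: power2_sum power_mult_distrib m_def field_simps)
    also have "m * sqrt s \<le> k / 2 * s + m\<^sup>2 / (2 * k)"
    proof -
      have "0 \<le> (k * sqrt s - m)\<^sup>2" by simp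
      then have "2 * k * (m * sqrt s) \<le> k\<^sup>2 * s + m\<^sup>2"
        using s by (simp add: power2_diff power_mult_distrib algebra_simps)
      then show ?thesis using k by (simp add: field_simps power2_eq_square)
    qed
    finally have "(\<alpha> + 1) / 2 * q \<le> 2 * (\<alpha> + 1) * a\<^sup>2 * s + k / 2 * s + C - n"
      by (simp add: C_def)
    then show ?thesis by (simp add: k_def field_simps)
  qed
  show ?thesis
  proof (rule that[of "k / 4" M s0])
    fix s q assume sq: "0 \<le> s" "q \<le> 4 * (a * sqrt s + b)\<^sup>2"
    show "k / 4 * (s + 1) \<le> \<alpha> / 2 * (s - q) - n - q / 2 + (if s \<le> s0 then M else 0)"
    proof (cases "s \<le> s0")
      case True
      then have "k / 4 * s \<le> k / 4 * s0" using k by (intro mult_left_mono) auto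
      moreover have "0 \<le> k / 2 * s" using k sq by simp
      ultimately have "k / 4 * (s + 1) \<le> k / 2 * s - C + M" by (simp add: M_def distrib_left)
      then show ?thesis using main[OF sq] True by simp
    next
      case False
      then have "k / 4 * s0 \<le> k / 4 * s" using k by (intro mult_left_mono) auto
      then have "k / 4 * (s + 1) \<le> k / 2 * s - C" using s0 by (simp add: distrib_left)
      then show ?thesis using main[OF sq] False by simp
    qed
  qed (use k M in auto)
qed

section \<open>Integrability against the Gaussian weight\<close>

context expander_hypersurface
begin

abbreviation sqn :: "'m \<Rightarrow> real" where "sqn p \<equiv> (norm (F p))\<^sup>2"
abbreviation nsq :: "'m \<Rightarrow> real" where "nsq p \<equiv> (F p \<bullet> N p)\<^sup>2"
abbreviation tsq :: "'m \<Rightarrow> real" where "tsq p \<equiv> (norm (pos_tangential \<A> F p))\<^sup>2"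
abbreviation weight :: "real \<Rightarrow> 'm \<Rightarrow> real" where "weight \<alpha> p \<equiv> exp (- (\<alpha>/4) * sqn p)"

lemma tsq_le: "tsq p \<le> sqn p" and nsq_le: "nsq p \<le> sqn p"
  using norm_pos_tangential_sq[of p] zero_le_power2[of "norm (pos_tangential \<A> F p)"]
    zero_le_power2[of "F p \<bullet> N p"] by linarith+

lemma continuous_tsq: "continuous_on UNIV tsq"
  by (intro continuous_intros continuous_pos_tangential)

lemma continuous_weight: "continuous_on UNIV (weight \<alpha>)"
  by (intro continuous_intros continuous_F)

lemma continuous_flat: "continuous_on UNIV (\<lambda>p. flat n (R - sqn p))"
  by (rule continuous_on_compose2[OF Ck_on_imp_continuous_on[OF Ck_on_flat[of 0]]])
     (intro continuous_intros continuous_F, simp)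

lemma flat_cutoff: "p \<notin> {p. sqn p \<le> R} \<Longrightarrow> flat n (R - sqn p) = 0"
  by (simp add: flat_def)

lemma Ck_on_cutoff: "Ck_on k UNIV (\<lambda>s. exp (c * s) * flat 0 (R - s))"
proof -
  have "Ck_on k UNIV (\<lambda>s. R - s)"
    by (intro Ck_on_diff open_UNIV Ck_on_const Ck_on_bounded_linear bounded_linear_ident)
  then have "Ck_on k UNIV (\<lambda>s. flat 0 (R - s))"
    by (rule Ck_on_compose_real[OF open_UNIV subset_UNIV _ Ck_on_flat])
  then show ?thesis
    using Ck_on_mult[OF open_UNIV Ck_on_exp_linear[of k 1 c]] by simp
qed

lemma has_real_derivative_cutoff:
  "((\<lambda>s. exp (c * s) * flat 0 (R - s)) has_real_derivative
     exp (c * s) * (c * flat 0 (R - s) - flat 2 (R - s))) (at s)"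
proof -
  have "((\<lambda>s. R - s) has_real_derivative -1) (at s)" by (auto intro!: derivative_eq_intros)
  from DERIV_chain2[OF has_real_derivative_flat[of 0 "R - s"] this]
  have 1: "((\<lambda>s. flat 0 (R - s)) has_real_derivative - flat 2 (R - s)) (at s)"
    by (simp add: numeral_2_eq_2)
  have 2: "((\<lambda>s. exp (c * s)) has_real_derivative exp (c * s) * c) (at s)"
    by (auto intro!: derivative_eq_intros)
  show ?thesis
    by (rule DERIV_cong[OF DERIV_mult[OF 2 1]]) (simp add: algebra_simps)
qed

text \<open>\<open>g\<close> is the divergence of w h (R - |x|^2) x^T. The weight contributes the
  term with \<alpha>/2, and the cutoff the term with \<open>flat 2\<close>.\<close>

lemma integral_cutoff_identity:
  fixes \<alpha> R
  defines "g \<equiv> \<lambda>p. weight \<alpha> p * (flat 0 (R - sqn p) * (real CARD('n) + nsq p / 2 - \<alpha>/2 * tsq p)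
     - 2 * flat 2 (R - sqn p) * tsq p)"
  shows "integrable \<sigma> g" "integral\<^sup>L \<sigma> g = 0"
proof -
  let ?G = "\<lambda>s. exp (- (\<alpha>/4) * s) * flat 0 (R - s)"
  let ?f = "\<lambda>p. ?G (sqn p)"
  note Ck = Ck_on_cutoff[of 1 "- (\<alpha>/4)" R]
  have f: "C1 ?f" by (rule C1_radial[OF Ck])
  have D: "divergence ?f p = g p" for p
    unfolding divergence_def gradient_radial[OF Ck has_real_derivative_cutoff] inner_scaleR_left
      pos_tangential_inner_F g_def by (simp add: algebra_simps)
  have "?f p = 0" if "p \<notin> {p. sqn p \<le> R}" for p using flat_cutoff[OF that] by simp
  from integral_divergence_compact[OF f compact_sublevel this]
  show "integrable \<sigma> g" "integral\<^sup>L \<sigma> g = 0" unfolding D[abs_def] by auto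
qed

lemma mono_flat_real: "mono (\<lambda>k. flat 0 (real k - s))"
  by (auto intro!: monoI flat_0_mono)

lemma flat_LIMSEQ: "(\<lambda>k. flat 0 (real k - s)) \<longlonglongrightarrow> 1" "(\<lambda>k. flat 2 (real k - s)) \<longlonglongrightarrow> 0"
  by (rule filterlim_compose[OF flat_at_top(1) filterlim_real_sequentially],
      rule filterlim_compose[OF flat_at_top(2) filterlim_real_sequentially])

text \<open>Since the \<open>g k\<close> integrate to 0, the pointwise estimate \<open>pt\<close>
  bounds all truncated integrals by one number: the measure of a compact sublevel set times M /
  \<kappa>. Monotone convergence does the rest.\<close>

lemma integrable_weight:
  assumes ab: "0 \<le> a" "a < 1/2" "0 < b" and \<alpha>: "a\<^sup>2 / (1/4 - a\<^sup>2) < \<alpha>"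
    and H: "\<And>p. \<bar>mean_curvature \<A> F N p\<bar> \<le> a * norm (F p) + b"
  shows "integrable \<sigma> (\<lambda>p. weight \<alpha> p * (sqn p + 1))"
proof -
  obtain \<kappa> M s0 where \<kappa>: "0 < \<kappa>" and M: "0 \<le> M" and
    growth: "\<And>s q. 0 \<le> s \<Longrightarrow> q \<le> 4 * (a * sqrt s + b)\<^sup>2 \<Longrightarrow>
      \<kappa> * (s + 1) \<le> \<alpha> / 2 * (s - q) - real CARD('n) - q / 2 + (if s \<le> s0 then M else 0)"
    using quadratic_growth[OF ab \<alpha> of_nat_0_le_iff] by metis
  \<comment> \<open>Positivity of \<alpha> makes the weight at most 1, so that on the compact set
    the correction \<open>M\<close> can be kept without it.\<close>
  have \<alpha>0: "0 \<le> \<alpha>"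
  proof -
    have "a\<^sup>2 < (1/2)\<^sup>2" using ab by (intro power_strict_mono) auto
    then have "0 \<le> a\<^sup>2 / (1/4 - a\<^sup>2)" by (simp add: power2_eq_square)
    then show ?thesis using \<alpha> by simp
  qed
  have q: "nsq p \<le> 4 * (a * sqrt (sqn p) + b)\<^sup>2" for p
  proof -
    have "\<bar>F p \<bullet> N p\<bar> / 2 \<le> a * norm (F p) + b"
      using H[of p] by (simp add: mean_curvature_def mean_curvature_vector_eq norm_N)
    then have "\<bar>F p \<bullet> N p\<bar>\<^sup>2 \<le> (2 * (a * norm (F p) + b))\<^sup>2" by (intro power_mono) auto
    also have "(2 * (a * norm (F p) + b))\<^sup>2 = 4 * (a * norm (F p) + b)\<^sup>2"
      by (simp only: power_mult_distrib) simp
    finally show ?thesis by simp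
  qed
  let ?K = "{p. sqn p \<le> s0}"
  have Ks: "?K \<in> sets \<sigma>" using compact_imp_closed[OF compact_sublevel] sets_\<sigma> by simp
  define f where "f k p = weight \<alpha> p * flat 0 (real k - sqn p) * (sqn p + 1)" for k p
  define g where "g k p = weight \<alpha> p * (flat 0 (real k - sqn p) * (real CARD('n) + nsq p / 2 - \<alpha>/2 * tsq p)
     - 2 * flat 2 (real k - sqn p) * tsq p)" for k p
  note g = integral_cutoff_identity[of \<alpha> "real k" for k, folded g_def]
  have fi: "integrable \<sigma> (f k)" for k
    unfolding f_def[abs_def]
    by (rule integrable_continuous_compact[OF _ compact_sublevel[of "real k"]])
       (intro continuous_intros continuous_weight continuous_flat continuous_F, simp add: flat_def)
  have iK: "integrable \<sigma> (\<lambda>p. M * indicator ?K p)"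
    using emeasure_compact_finite[OF compact_sublevel] Ks by simp
  \<comment> \<open>The growth estimate times weight and cutoff. The term with \<open>flat 2\<close>
    has a favourable sign and is dropped.\<close>
  have pt: "\<kappa> * f k p \<le> M * indicator ?K p - g k p" for k p
  proof -
    let ?h = "flat 0 (real k - sqn p)"
    have w: "0 < weight \<alpha> p" "weight \<alpha> p \<le> 1" using \<alpha>0 by auto
    have h: "0 \<le> ?h" "?h \<le> 1" by (rule flat_nonneg, rule flat_0_le_1)
    have wh: "0 \<le> weight \<alpha> p * ?h" "weight \<alpha> p * ?h \<le> 1" using w h by (auto intro: mult_le_one)
    have "weight \<alpha> p * ?h * (\<kappa> * (sqn p + 1)) \<le> weight \<alpha> p * ?h *
       (\<alpha> / 2 * (sqn p - nsq p) - real CARD('n) - nsq p / 2 + (if sqn p \<le> s0 then M else 0))"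
      by (rule mult_left_mono[OF growth[OF _ q] wh(1)]) simp
    also have "\<dots> = - g k p - weight \<alpha> p * (2 * flat 2 (real k - sqn p) * tsq p)
        + weight \<alpha> p * ?h * (M * indicator ?K p)"
      by (auto simp: g_def norm_pos_tangential_sq indicator_def algebra_simps)
    also have "\<dots> \<le> - g k p + 1 * (M * indicator ?K p)"
    proof -
      have "0 \<le> weight \<alpha> p * (2 * flat 2 (real k - sqn p) * tsq p)"
        using flat_nonneg by (intro mult_nonneg_nonneg) auto
      moreover have "weight \<alpha> p * ?h * (M * indicator ?K p) \<le> 1 * (M * indicator ?K p)"
        using wh M by (intro mult_right_mono) auto
      ultimately show ?thesis by linarith
    qed
    finally show ?thesis by (simp add: f_def mult_ac)
  qed
  have bound: "integral\<^sup>L \<sigma> (f k) \<le> (LINT p|\<sigma>. M * indicator ?K p) / \<kappa>" for k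
  proof -
    have "(LINT p|\<sigma>. \<kappa> * f k p) \<le> (LINT p|\<sigma>. M * indicator ?K p - g k p)"
      by (rule integral_mono[OF _ _ pt]) (use fi iK g in auto)
    also have "\<dots> = (LINT p|\<sigma>. M * indicator ?K p)"
      using Bochner_Integration.integral_diff[OF iK g(1)[of k]] g(2)[of k] by simp
    finally show ?thesis using \<kappa> by (simp add: field_simps)
  qed
  show ?thesis
  proof (rule integrable_bounded_incseq(1)[OF fi _ _ _ bound])
    fix p
    show "mono (\<lambda>k. f k p)"
      unfolding f_def by (intro monoI mult_right_mono mult_left_mono monoD[OF mono_flat_real]) auto
    show "0 \<le> f k p" for k unfolding f_def using flat_nonneg by (intro mult_nonneg_nonneg) auto
    have "(\<lambda>k. weight \<alpha> p * flat 0 (real k - sqn p) * (sqn p + 1)) \<longlonglongrightarrow> weight \<alpha> p * 1 * (sqn p + 1)"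
      by (intro tendsto_intros flat_LIMSEQ)
    then show "(\<lambda>k. f k p) \<longlonglongrightarrow> weight \<alpha> p * (sqn p + 1)" by (simp add: f_def)
  next
    show "(\<lambda>p. weight \<alpha> p * (sqn p + 1)) \<in> borel_measurable \<sigma>"
      by (intro measurable_continuous continuous_intros continuous_weight continuous_F)
  qed
qed

end

section \<open>Passage to the limit and the Rayleigh quotients\<close>

context expander_hypersurface
begin

lemma integrable_weight_bound:
  assumes w: "integrable \<sigma> (\<lambda>p. weight \<alpha> p * (sqn p + 1))" and g: "g \<in> borel_measurable \<sigma>"
    and bound: "\<And>p. \<bar>g p\<bar> \<le> C * (sqn p + 1)"
  shows "integrable \<sigma> (\<lambda>p. weight \<alpha> p * g p)"
proof (rule Bochner_Integration.integrable_bound[OF integrable_mult_right[OF w, of C]])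
  show "(\<lambda>p. weight \<alpha> p * g p) \<in> borel_measurable \<sigma>"
    by (intro borel_measurable_times g measurable_continuous continuous_weight)
  show "AE p in \<sigma>. norm (weight \<alpha> p * g p) \<le> norm (C * (weight \<alpha> p * (sqn p + 1)))"
  proof (rule AE_I2)
    fix p
    have "weight \<alpha> p * \<bar>g p\<bar> \<le> weight \<alpha> p * (C * (sqn p + 1))"
      by (rule mult_left_mono[OF bound]) simp
    also have "\<dots> \<le> \<bar>C * (weight \<alpha> p * (sqn p + 1))\<bar>" by (simp add: mult_ac)
    finally show "norm (weight \<alpha> p * g p) \<le> norm (C * (weight \<alpha> p * (sqn p + 1)))"
      by (simp add: abs_mult)
  qed
qed

lemma tendsto_weight_integral:
  assumes w: "integrable \<sigma> (\<lambda>p. weight \<alpha> p * (sqn p + 1))"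
    and g: "\<And>k. continuous_on UNIV (g k)" "continuous_on UNIV g'"
    and bound: "\<And>k p. \<bar>g k p\<bar> \<le> C * (sqn p + 1)" and lim: "\<And>p. (\<lambda>k. g k p) \<longlonglongrightarrow> g' p"
  shows "(\<lambda>k. LINT p|\<sigma>. weight \<alpha> p * g k p) \<longlonglongrightarrow> (LINT p|\<sigma>. weight \<alpha> p * g' p)"
proof (rule integral_dominated_convergence[where w = "\<lambda>p. C * (weight \<alpha> p * (sqn p + 1))"])
  show "(\<lambda>p. weight \<alpha> p * g' p) \<in> borel_measurable \<sigma>"
    by (intro measurable_continuous continuous_on_mult continuous_weight g)
  show "(\<lambda>p. weight \<alpha> p * g k p) \<in> borel_measurable \<sigma>" for k
    by (intro measurable_continuous continuous_on_mult continuous_weight g)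
  show "integrable \<sigma> (\<lambda>p. C * (weight \<alpha> p * (sqn p + 1)))" using w by simp
  show "AE p in \<sigma>. (\<lambda>k. weight \<alpha> p * g k p) \<longlonglongrightarrow> weight \<alpha> p * g' p"
    by (intro AE_I2 tendsto_mult tendsto_const lim)
  show "AE p in \<sigma>. norm (weight \<alpha> p * g k p) \<le> C * (weight \<alpha> p * (sqn p + 1))" for k
  proof (rule AE_I2)
    fix p
    have "weight \<alpha> p * \<bar>g k p\<bar> \<le> weight \<alpha> p * (C * (sqn p + 1))"
      by (rule mult_left_mono[OF bound]) simp
    then show "norm (weight \<alpha> p * g k p) \<le> C * (weight \<alpha> p * (sqn p + 1))"
      by (simp add: abs_mult mult_ac)
  qed
qed

lemma flat_abs_le: "\<bar>flat 0 t\<bar> \<le> 1" "\<bar>flat 2 t\<bar> \<le> 2"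
  using flat_nonneg flat_0_le_1 flat_2_le by (simp_all add: abs_of_nonneg)

lemma tsq_abs_le: "\<bar>tsq p\<bar> \<le> sqn p + 1" and nsq_abs_le: "\<bar>nsq p\<bar> \<le> sqn p + 1"
  using tsq_le[of p] nsq_le[of p] unfolding abs_of_nonneg[OF zero_le_power2] by linarith+

text \<open>The cutoff identity for growing radius. The term with \<open>flat 2\<close> tends to 0
  pointwise and is dominated by a multiple of (1 + |x|^2) w.\<close>

lemma weight_identity:
  assumes w: "integrable \<sigma> (\<lambda>p. weight \<alpha> p * (sqn p + 1))"
  shows "(LINT p|\<sigma>. weight \<alpha> p * (real CARD('n) + nsq p / 2 - \<alpha>/2 * tsq p)) = 0"
proof -
  let ?n = "real CARD('n)"
  define e where "e p = ?n + nsq p / 2 - \<alpha>/2 * tsq p" for p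
  define g where "g k p = flat 0 (real k - sqn p) * e p - 2 * flat 2 (real k - sqn p) * tsq p" for k p
  have ce: "continuous_on UNIV e"
    unfolding e_def[abs_def]
    by (intro continuous_on_add continuous_on_diff continuous_on_mult continuous_on_divide continuous_on_const
        continuous_tsq continuous_normal_sq) auto
  have be: "\<bar>e p\<bar> \<le> (?n + 1 + \<bar>\<alpha>\<bar>) * (sqn p + 1)" for p
  proof -
    have "\<bar>e p\<bar> \<le> ?n + \<bar>nsq p\<bar> / 2 + \<bar>\<alpha>\<bar> / 2 * \<bar>tsq p\<bar>"
      unfolding e_def using abs_triangle_ineq4[of "?n + nsq p / 2" "\<alpha>/2 * tsq p"]
      by (simp add: abs_mult)
    also have "\<dots> \<le> ?n * (sqn p + 1) + (sqn p + 1) + \<bar>\<alpha>\<bar> * (sqn p + 1)"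
    proof (intro add_mono)
      show "?n \<le> ?n * (sqn p + 1)" by (simp add: distrib_left)
      show "\<bar>nsq p\<bar> / 2 \<le> sqn p + 1"
        using nsq_le[of p] zero_le_power2[of "norm (F p)"]
        unfolding abs_of_nonneg[OF zero_le_power2] by linarith
      show "\<bar>\<alpha>\<bar> / 2 * \<bar>tsq p\<bar> \<le> \<bar>\<alpha>\<bar> * (sqn p + 1)"
        by (intro mult_mono tsq_abs_le) auto
    qed
    finally show ?thesis by (simp add: algebra_simps)
  qed
  have "(\<lambda>k. LINT p|\<sigma>. weight \<alpha> p * g k p) \<longlonglongrightarrow> (LINT p|\<sigma>. weight \<alpha> p * e p)"
  \<comment> \<open>The constant is the one from \<open>be\<close>, plus 4 = 2 * 2 for the term with
    \<open>flat 2\<close>.\<close>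
  proof (rule tendsto_weight_integral[OF w _ ce, where C = "?n + 1 + \<bar>\<alpha>\<bar> + 4"])
    show "continuous_on UNIV (g k)" for k
      unfolding g_def[abs_def]
      by (intro continuous_on_diff continuous_on_mult continuous_on_const ce continuous_flat continuous_tsq)
    fix p
    show "\<bar>g k p\<bar> \<le> (?n + 1 + \<bar>\<alpha>\<bar> + 4) * (sqn p + 1)" for k
    proof -
      have "\<bar>g k p\<bar> \<le> \<bar>flat 0 (real k - sqn p)\<bar> * \<bar>e p\<bar> + 2 * \<bar>flat 2 (real k - sqn p)\<bar> * \<bar>tsq p\<bar>"
        unfolding g_def using abs_triangle_ineq4 by (simp add: abs_mult order_trans[OF abs_triangle_ineq4])
      also have "\<dots> \<le> 1 * ((?n + 1 + \<bar>\<alpha>\<bar>) * (sqn p + 1)) + (2 * 2) * (sqn p + 1)"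
        by (intro add_mono mult_mono be flat_abs_le tsq_abs_le) auto
      finally show ?thesis by (simp add: algebra_simps)
    qed
    have "(\<lambda>k. g k p) \<longlonglongrightarrow> 1 * e p - 2 * 0 * tsq p"
      unfolding g_def by (intro tendsto_intros flat_LIMSEQ)
    then show "(\<lambda>k. g k p) \<longlonglongrightarrow> e p" by simp
  qed
  moreover have "(LINT p|\<sigma>. weight \<alpha> p * g k p) = 0" for k
    unfolding g_def e_def by (rule integral_cutoff_identity(2))
  ultimately have "(LINT p|\<sigma>. weight \<alpha> p * e p) = 0" by (simp add: LIMSEQ_const_iff)
  then show ?thesis by (simp add: e_def)
qed

text \<open>For the truncated test function f, this times the weight is (|grad f|^2 + f^2 / 2) exp
  (|x|^2 / 4): the Rayleigh numerator without |A|^2. The latter is kept apart because its integral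
  may diverge in the limit.\<close>

definition test_kin :: "real \<Rightarrow> nat \<Rightarrow> 'm \<Rightarrow> real" where
  "test_kin \<alpha> k p = 4 * ((\<alpha>+1)/8 * flat 0 (real k - sqn p) + flat 2 (real k - sqn p))\<^sup>2 * tsq p
     + (flat 0 (real k - sqn p))\<^sup>2 / 2"

definition test_sq :: "nat \<Rightarrow> 'm \<Rightarrow> real" where
  "test_sq k p = (flat 0 (real k - sqn p))\<^sup>2"

lemma continuous_test_sq: "continuous_on UNIV (test_sq k)"
  unfolding test_sq_def[abs_def] by (intro continuous_on_power continuous_flat)

lemma continuous_test_kin: "continuous_on UNIV (test_kin \<alpha> k)"
  unfolding test_kin_def[abs_def]
  by (intro continuous_on_add continuous_on_mult continuous_on_divide continuous_on_power
      continuous_on_const continuous_flat continuous_tsq) auto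

lemma test_cutoff: "p \<notin> {p. sqn p \<le> real k} \<Longrightarrow> test_sq k p = 0"
    "p \<notin> {p. sqn p \<le> real k} \<Longrightarrow> test_kin \<alpha> k p = 0"
  by (simp_all add: test_sq_def test_kin_def flat_def)

lemma integrable_test:
  "integrable \<sigma> (\<lambda>p. weight \<alpha> p * test_sq k p)"
  "integrable \<sigma> (\<lambda>p. weight \<alpha> p * test_kin \<alpha> k p)"
  "integrable \<sigma> (\<lambda>p. weight \<alpha> p * (sff_norm2 \<A> F p * test_sq k p))"
  by (rule integrable_continuous_compact[OF _ compact_sublevel[of "real k"]],
      intro continuous_on_mult continuous_weight continuous_test_sq continuous_test_kin continuous_sff_norm2,
      simp add: test_cutoff)+

lemma bottom_spectrum_le:
  assumes D: "(LINT p|\<sigma>. weight \<alpha> p * test_sq k p) \<noteq> 0"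
  shows "bottom_spectrum \<A> F \<sigma> \<le> ereal (((LINT p|\<sigma>. weight \<alpha> p * test_kin \<alpha> k p)
     - (LINT p|\<sigma>. weight \<alpha> p * (sff_norm2 \<A> F p * test_sq k p))) / (LINT p|\<sigma>. weight \<alpha> p * test_sq k p))"
proof -
  \<comment> \<open>The solution of 2 c + 1/4 = - \<alpha>/4, so that squaring and multiplying by
    the given weight leaves \<open>weight \<alpha>\<close>.\<close>
  define c where "c = - ((\<alpha> + 1) / 8)"
  let ?G = "\<lambda>s. exp (c * s) * flat 0 (real k - s)"
  define f where "f p = ?G (sqn p)" for p
  have Gk: "Ck_on j UNIV ?G" for j by (rule Ck_on_cutoff)
  have E: "(exp (c * s))\<^sup>2 * exp (s / 4) = exp (- (\<alpha>/4) * s)" for s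
    by (simp add: exp_double[symmetric] exp_add[symmetric] c_def field_simps)
  have f2: "(f p)\<^sup>2 * exp (sqn p / 4) = weight \<alpha> p * test_sq k p" for p
  proof -
    have "(f p)\<^sup>2 * exp (sqn p / 4) = ((exp (c * sqn p))\<^sup>2 * exp (sqn p / 4)) * test_sq k p"
      by (simp add: f_def test_sq_def power_mult_distrib)
    then show ?thesis unfolding E .
  qed
  have num: "((norm (gradient \<A> F f p))\<^sup>2 - (sff_norm2 \<A> F p - 1/2) * (f p)\<^sup>2) * exp (sqn p / 4)
     = weight \<alpha> p * test_kin \<alpha> k p - weight \<alpha> p * (sff_norm2 \<A> F p * test_sq k p)" for p
  proof -
    let ?h = "flat 0 (real k - sqn p)" and ?h2 = "flat 2 (real k - sqn p)"
    have "gradient \<A> F f p = (2 * (exp (c * sqn p) * (c * ?h - ?h2))) *\<^sub>R pos_tangential \<A> F p"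
      unfolding f_def[abs_def] by (rule gradient_radial[OF Gk has_real_derivative_cutoff])
    then have "(norm (gradient \<A> F f p))\<^sup>2 * exp (sqn p / 4)
        = ((exp (c * sqn p))\<^sup>2 * exp (sqn p / 4)) * (4 * (c * ?h - ?h2)\<^sup>2 * tsq p)"
      by (simp add: power_mult_distrib)
    \<comment> \<open>The derivatives of the exponential and of the cutoff are both negative, so the
      square may be taken of the sum of their absolute values when \<alpha> \<ge> -1, and the
      identity itself is just a change of sign.\<close>
    also have "(c * ?h - ?h2)\<^sup>2 = ((\<alpha>+1)/8 * ?h + ?h2)\<^sup>2"
      by (simp add: c_def power2_eq_square algebra_simps)
    finally have "(norm (gradient \<A> F f p))\<^sup>2 * exp (sqn p / 4)
        = weight \<alpha> p * (4 * ((\<alpha>+1)/8 * ?h + ?h2)\<^sup>2 * tsq p)" unfolding E .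
    moreover have "(sff_norm2 \<A> F p - 1/2) * (f p)\<^sup>2 * exp (sqn p / 4)
        = (sff_norm2 \<A> F p - 1/2) * (weight \<alpha> p * test_sq k p)"
      using f2[of p] by (simp add: mult.assoc)
    ultimately show ?thesis
      by (simp add: left_diff_distrib test_kin_def test_sq_def algebra_simps)
  qed
  have "smooth_map \<A> f" unfolding f_def[abs_def] by (rule smooth_radial[OF Gk])
  moreover have "compact (closure {p. f p \<noteq> 0})"
  proof -
    have "{p. f p \<noteq> 0} \<subseteq> {p. sqn p \<le> real k}" using flat_cutoff[of _ "real k" 0] by (force simp: f_def)
    then have "closure {p. f p \<noteq> 0} \<subseteq> {p. sqn p \<le> real k}"
      by (rule closure_minimal[OF _ compact_imp_closed[OF compact_sublevel]])
    then have "closure {p. f p \<noteq> 0} = {p. sqn p \<le> real k} \<inter> closure {p. f p \<noteq> 0}" by blast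
    then show ?thesis by (metis closed_closure compact_Int_closed compact_sublevel)
  qed
  ultimately have "bottom_spectrum \<A> F \<sigma> \<le>
      ereal ((LINT p|\<sigma>. ((norm (gradient \<A> F f p))\<^sup>2 - (sff_norm2 \<A> F p - 1/2) * (f p)\<^sup>2) * exp (sqn p / 4))
        / (LINT p|\<sigma>. (f p)\<^sup>2 * exp (sqn p / 4)))"
    unfolding bottom_spectrum_def by (intro INF_lower) (use D in \<open>simp add: f2\<close>)
  then show ?thesis
    unfolding num f2 Bochner_Integration.integral_diff[OF integrable_test(2,3)] .
qed

text \<open>Denominator and kinetic part of the truncated quotients converge by domination. The
  |A|^2 part is monotone in the cutoff, so it either converges or exceeds every bound, and the two
  cases are treated apart.\<close>

lemma bottom_spectrum_bound:
  assumes ab: "0 \<le> a" "a < 1/2" "0 < b" and \<alpha>: "a\<^sup>2 / (1/4 - a\<^sup>2) < \<alpha>"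
    and H: "\<And>p. \<bar>mean_curvature \<A> F N p\<bar> \<le> a * norm (F p) + b"
  shows "bottom_spectrum \<A> F \<sigma> \<le>
    ereal (((\<alpha> + 1) * real CARD('n) + 2) / 4) +
    ext_integral \<sigma> (\<lambda>p.
        (scalar_curvature \<A> F N p
          + (\<alpha> - 1) * ((1/2) * (mean_curvature \<A> F N p)\<^sup>2
                       - (\<alpha> + 1) / 16 * (norm (pos_tangential \<A> F p))\<^sup>2))
        * exp (- (\<alpha>/4) * (norm (F p))\<^sup>2))
    / ext_integral \<sigma> (\<lambda>p. exp (- (\<alpha>/4) * (norm (F p))\<^sup>2))"
proof -
  let ?n = "real CARD('n)"
  have w: "integrable \<sigma> (\<lambda>p. weight \<alpha> p * (sqn p + 1))" by (rule integrable_weight[OF ab \<alpha> H])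
  have iw: "integrable \<sigma> (weight \<alpha>)" and it: "integrable \<sigma> (\<lambda>p. weight \<alpha> p * tsq p)"
    and iq: "integrable \<sigma> (\<lambda>p. weight \<alpha> p * nsq p)"
    using integrable_weight_bound[OF w, of "\<lambda>p. 1" 1] integrable_weight_bound[OF w, of tsq 1]
      integrable_weight_bound[OF w, of nsq 1] tsq_abs_le nsq_abs_le
      measurable_continuous[OF continuous_tsq] measurable_continuous[OF continuous_normal_sq] by simp_all
  define D where "D = integral\<^sup>L \<sigma> (weight \<alpha>)"
  define T where "T = (LINT p|\<sigma>. weight \<alpha> p * tsq p)"
  define Q where "Q = (LINT p|\<sigma>. weight \<alpha> p * nsq p)"
  have D0: "D > 0"
  proof (rule ccontr)
    assume "\<not> D > 0"
    moreover have "0 \<le> D" unfolding D_def by (rule Bochner_Integration.integral_nonneg) simp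
    ultimately have "D = 0" by linarith
    then have "AE p in \<sigma>. weight \<alpha> p = 0"
      using integral_nonneg_eq_0_iff_AE[OF iw] by (simp add: D_def)
    then have "AE p in \<sigma>. False" by simp
    then have "emeasure \<sigma> (space \<sigma>) = 0" by (simp add: AE_iff_null null_sets_def)
    then show False using emeasure_\<sigma>_nonzero by (simp add: space_\<sigma>)
  qed
  have id: "?n * D + Q / 2 - \<alpha> / 2 * T = 0"
  proof -
    have "(LINT p|\<sigma>. weight \<alpha> p * (?n + nsq p / 2 - \<alpha>/2 * tsq p))
        = (LINT p|\<sigma>. ?n * weight \<alpha> p + (1/2) * (weight \<alpha> p * nsq p) - \<alpha>/2 * (weight \<alpha> p * tsq p))"
      by (rule Bochner_Integration.integral_cong) (simp_all add: algebra_simps)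
    also have "\<dots> = ?n * D + Q / 2 - \<alpha> / 2 * T"
      using iw it iq by (simp add: D_def Q_def T_def)
    finally show ?thesis using weight_identity[OF w] by simp
  qed
  define Dk where "Dk k = (LINT p|\<sigma>. weight \<alpha> p * test_sq k p)" for k
  define Pk where "Pk k = (LINT p|\<sigma>. weight \<alpha> p * test_kin \<alpha> k p)" for k
  define Bk where "Bk k = (LINT p|\<sigma>. weight \<alpha> p * (sff_norm2 \<A> F p * test_sq k p))" for k
  \<comment> \<open>The limit of the kinetic part: 4 ((\<alpha> + 1) / 8)^2 = (\<alpha> + 1)^2 / 16,
    the derivative of the cutoff having disappeared.\<close>
  define P where "P = (\<alpha>+1)\<^sup>2 / 16 * T + D / 2"
  have hlim: "(\<lambda>k. test_sq k p) \<longlonglongrightarrow> 1" for p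
  proof -
    have "(\<lambda>k. (flat 0 (real k - sqn p))\<^sup>2) \<longlonglongrightarrow> 1\<^sup>2" by (intro tendsto_intros flat_LIMSEQ)
    then show ?thesis by (simp add: test_sq_def)
  qed
  have sq1: "0 \<le> test_sq k p" "test_sq k p \<le> 1" for k p
    using flat_nonneg flat_0_le_1 by (simp_all add: test_sq_def power_le_one)
  have Dlim: "Dk \<longlonglongrightarrow> D"
  proof -
    have "(\<lambda>k. LINT p|\<sigma>. weight \<alpha> p * test_sq k p) \<longlonglongrightarrow> (LINT p|\<sigma>. weight \<alpha> p * 1)"
      by (rule tendsto_weight_integral[OF w continuous_test_sq continuous_on_const _ hlim, where C = 1])
         (use sq1 in \<open>smt (verit) zero_le_power2\<close>)
    then show ?thesis by (simp add: Dk_def[abs_def] D_def)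
  qed
  have Dk_le: "Dk k \<le> D" for k
    unfolding Dk_def D_def using integrable_test iw sq1
    by (intro integral_mono) (auto simp: mult_left_le)
  have Plim: "Pk \<longlonglongrightarrow> P"
  proof -
    let ?C = "4 * (\<bar>\<alpha>+1\<bar>/8 + 2)\<^sup>2 + 1"
    have "(\<lambda>k. LINT p|\<sigma>. weight \<alpha> p * test_kin \<alpha> k p) \<longlonglongrightarrow>
        (LINT p|\<sigma>. weight \<alpha> p * (4 * ((\<alpha>+1)/8 * 1 + 0)\<^sup>2 * tsq p + 1\<^sup>2 / 2))"
    proof (rule tendsto_weight_integral[OF w continuous_test_kin, where C = ?C])
      show "continuous_on UNIV (\<lambda>p. 4 * ((\<alpha>+1)/8 * 1 + 0)\<^sup>2 * tsq p + 1\<^sup>2 / 2)"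
        by (intro continuous_on_add continuous_on_mult continuous_on_const continuous_tsq)
      fix p
      show "(\<lambda>k. test_kin \<alpha> k p) \<longlonglongrightarrow> 4 * ((\<alpha>+1)/8 * 1 + 0)\<^sup>2 * tsq p + 1\<^sup>2 / 2"
        unfolding test_kin_def by (intro tendsto_intros flat_LIMSEQ) simp
      show "\<bar>test_kin \<alpha> k p\<bar> \<le> ?C * (sqn p + 1)" for k
      proof -
        let ?h = "flat 0 (real k - sqn p)" and ?h2 = "flat 2 (real k - sqn p)"
        have "\<bar>(\<alpha>+1)/8 * ?h + ?h2\<bar> \<le> \<bar>(\<alpha>+1)/8\<bar> * \<bar>?h\<bar> + \<bar>?h2\<bar>"
          by (metis abs_mult abs_triangle_ineq)
        also have "\<dots> \<le> \<bar>\<alpha>+1\<bar>/8 * 1 + 2"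
          by (intro add_mono mult_mono flat_abs_le) auto
        finally have "((\<alpha>+1)/8 * ?h + ?h2)\<^sup>2 \<le> (\<bar>\<alpha>+1\<bar>/8 + 2)\<^sup>2"
          by (intro abs_le_square_iff[THEN iffD1]) simp
        then have "4 * ((\<alpha>+1)/8 * ?h + ?h2)\<^sup>2 * tsq p \<le> 4 * (\<bar>\<alpha>+1\<bar>/8 + 2)\<^sup>2 * (sqn p + 1)"
          using tsq_abs_le[of p] by (intro mult_mono) auto
        moreover have "?h\<^sup>2 / 2 \<le> 1 * (sqn p + 1)"
          using sq1(2)[of k p] zero_le_power2[of "norm (F p)"] unfolding test_sq_def mult_1 by linarith
        ultimately have "test_kin \<alpha> k p \<le> ?C * (sqn p + 1)"
          unfolding test_kin_def distrib_right by linarith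
        moreover have "0 \<le> test_kin \<alpha> k p" by (simp add: test_kin_def)
        ultimately show ?thesis by simp
      qed
    qed
    moreover have "(LINT p|\<sigma>. weight \<alpha> p * (4 * ((\<alpha>+1)/8 * 1 + 0)\<^sup>2 * tsq p + 1\<^sup>2 / 2))
       = (LINT p|\<sigma>. (\<alpha>+1)\<^sup>2 / 16 * (weight \<alpha> p * tsq p) + 1/2 * weight \<alpha> p)"
      by (rule Bochner_Integration.integral_cong) (simp_all add: power_divide field_simps)
    moreover have "\<dots> = P" using iw it by (simp add: P_def T_def D_def)
    ultimately show ?thesis by (simp add: Pk_def[abs_def])
  qed
  have le: "bottom_spectrum \<A> F \<sigma> \<le> ereal ((Pk k - Bk k) / Dk k)" if "Dk k \<noteq> 0" for k
    using bottom_spectrum_le[of \<alpha> k] that unfolding Dk_def Pk_def Bk_def .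
  have evD: "\<forall>\<^sub>F k in sequentially. Dk k > 0" using order_tendstoD(1)[OF Dlim D0] .
  define c where "c = ((\<alpha> + 1) * ?n + 2) / 4"
  \<comment> \<open>The integrand of the claim is u - v: \<open>u\<close> collects the terms in H^2
    = \<langle>x, N\<rangle>^2 / 4 and |x^T|^2, which are integrable, and \<open>v\<close> is the
    weighted |A|^2.\<close>
  define u where "u p = weight \<alpha> p * (nsq p / 4 + (\<alpha> - 1) * (nsq p / 8 - (\<alpha>+1)/16 * tsq p))" for p
  define v where "v p = weight \<alpha> p * sff_norm2 \<A> F p" for p
  have u_eq: "u = (\<lambda>p. (\<alpha>+1)/8 * (weight \<alpha> p * nsq p) - (\<alpha>-1)*(\<alpha>+1)/16 * (weight \<alpha> p * tsq p))"
    by (auto simp: u_def fun_eq_iff field_simps)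
  have iu: "integrable \<sigma> u" unfolding u_eq using iq it by simp
  have Iu: "integral\<^sup>L \<sigma> u = (\<alpha>+1)/8 * Q - (\<alpha>-1)*(\<alpha>+1)/16 * T"
    unfolding u_eq using iq it by (simp add: Q_def T_def)
  have mv: "v \<in> borel_measurable \<sigma>"
    unfolding v_def[abs_def]
    by (intro measurable_continuous continuous_on_mult continuous_weight continuous_sff_norm2)
  have vk: "Bk k = (LINT p|\<sigma>. v p * test_sq k p)" for k by (simp add: Bk_def v_def mult.assoc)
  have ivk: "integrable \<sigma> (\<lambda>p. v p * test_sq k p)" for k
    using integrable_test(3)[of \<alpha> k] by (simp add: v_def mult.assoc)
  have v0: "0 \<le> v p" for p using sff_norm2_nonneg by (simp add: v_def)
  have vmono: "mono (\<lambda>k. v p * test_sq k p)" for p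
    unfolding test_sq_def
    by (intro monoI mult_left_mono power_mono v0 flat_nonneg monoD[OF mono_flat_real]) auto
  have vlim: "(\<lambda>k. v p * test_sq k p) \<longlonglongrightarrow> v p" for p
    using tendsto_mult[OF tendsto_const hlim, of "v p" p] by simp
  have vk0: "0 \<le> v p * test_sq k p" for k p using v0 sq1 by simp
  have mc: "(mean_curvature \<A> F N p)\<^sup>2 = nsq p / 4" for p
    by (simp add: mean_curvature_def mean_curvature_vector_eq norm_N power_divide)
  have integrand: "(scalar_curvature \<A> F N p + (\<alpha> - 1) * ((1/2) * (mean_curvature \<A> F N p)\<^sup>2
       - (\<alpha> + 1) / 16 * tsq p)) * weight \<alpha> p = u p - v p" for p
    unfolding scalar_curvature_def mc u_def v_def by (simp add: algebra_simps)
  have extD: "ext_integral \<sigma> (weight \<alpha>) = ereal D"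
    unfolding D_def by (rule ext_integral_eq_integral[OF iw])
  show ?thesis
  proof (cases "integrable \<sigma> v")
    case True
    have "Bk k \<le> integral\<^sup>L \<sigma> v" for k
      unfolding vk using ivk True v0 sq1 by (intro integral_mono) (auto simp: mult_left_le)
    then have Blim: "Bk \<longlonglongrightarrow> integral\<^sup>L \<sigma> v"
      using integrable_bounded_incseq(2)[OF ivk vmono vk0 vlim _ mv] unfolding vk by blast
    have "(\<lambda>k. (Pk k - Bk k) / Dk k) \<longlonglongrightarrow> (P - integral\<^sup>L \<sigma> v) / D"
      using D0 by (intro tendsto_intros Plim Blim Dlim) simp
    then have "(\<lambda>k. ereal ((Pk k - Bk k) / Dk k)) \<longlonglongrightarrow> ereal ((P - integral\<^sup>L \<sigma> v) / D)"
      by simp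
    moreover have "\<forall>\<^sub>F k in sequentially. bottom_spectrum \<A> F \<sigma> \<le> ereal ((Pk k - Bk k) / Dk k)"
      using evD by eventually_elim (use le in auto)
    ultimately have "bottom_spectrum \<A> F \<sigma> \<le> ereal ((P - integral\<^sup>L \<sigma> v) / D)"
      using tendsto_lowerbound by (metis sequentially_bot)
    also have "(P - integral\<^sup>L \<sigma> v) / D = c + (integral\<^sup>L \<sigma> u - integral\<^sup>L \<sigma> v) / D"
    proof -
      have "P = c * D + integral\<^sup>L \<sigma> u"
      proof -
        \<comment> \<open>The claimed bound and the limit of the Rayleigh quotients differ by a
          multiple of the divergence identity \<open>id\<close>.\<close>
        have "c * D + integral\<^sup>L \<sigma> u - P = (\<alpha>+1)/4 * (?n * D + Q / 2 - \<alpha> / 2 * T)"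
          by (simp add: c_def P_def Iu power2_eq_square field_simps)
        then show ?thesis unfolding id by simp
      qed
      then show ?thesis using D0 by (simp add: field_simps)
    qed
    also have "ereal \<dots> = ereal c + ext_integral \<sigma> (\<lambda>p. u p - v p) / ereal D"
      using D0 iu True by (simp add: ext_integral_eq_integral)
    finally show ?thesis unfolding integrand extD c_def .
  next
    case False
    have ext: "ext_integral \<sigma> (\<lambda>p. u p - v p) = -\<infinity>"
      by (rule ext_integral_diff_eq_MInf[OF iu mv v0 False])
    have "bottom_spectrum \<A> F \<sigma> \<le> ereal r" for r
    proof -
      \<comment> \<open>Once \<open>Bk k\<close> exceeds this, the numerator is below - |r| D, hence
        below r \<open>Dk k\<close> because \<open>Dk k\<close> is at most \<open>D\<close>.\<close>
      define X where "X = P + 1 + \<bar>r\<bar> * D"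
      have "\<exists>k0. Bk k0 > X"
        using integrable_bounded_incseq(1)[OF ivk vmono vk0 vlim _ mv, of X] False
        unfolding vk by (meson not_le)
      then obtain k0 where "Bk k0 > X" ..
      moreover have "Bk k0 \<le> Bk k" if "k0 \<le> k" for k
        unfolding vk using that ivk by (intro integral_mono monoD[OF vmono])
      ultimately have B: "\<forall>\<^sub>F k in sequentially. X < Bk k"
        unfolding eventually_sequentially by (meson less_le_trans)
      have Pe: "\<forall>\<^sub>F k in sequentially. Pk k < P + 1" using order_tendstoD(2)[OF Plim, of "P + 1"] by simp
      have "\<exists>k. Dk k > 0 \<and> X < Bk k \<and> Pk k < P + 1"
        using eventually_happens[OF eventually_conj[OF evD eventually_conj[OF B Pe]]] by auto
      then obtain k where k: "Dk k > 0" "X < Bk k" "Pk k < P + 1" by blast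
      have "- \<bar>r\<bar> * D \<le> - \<bar>r\<bar> * Dk k" using mult_left_mono[OF Dk_le[of k], of "\<bar>r\<bar>"] by simp
      also have "\<dots> \<le> r * Dk k" using k(1) by (intro mult_right_mono) auto
      finally have "Pk k - Bk k \<le> r * Dk k" using k by (simp add: X_def)
      then have "(Pk k - Bk k) / Dk k \<le> r" using k(1) by (simp add: pos_divide_le_eq)
      moreover have "bottom_spectrum \<A> F \<sigma> \<le> ereal ((Pk k - Bk k) / Dk k)"
        using le k(1) by simp
      ultimately show ?thesis by (meson ereal_less_eq(3) order_trans)
    qed
    then have "bottom_spectrum \<A> F \<sigma> = -\<infinity>" by (rule ereal_bot)
    then show ?thesis by simp
  qed
qed

end

theorem theorem7p1:
  fixes \<A> :: "('n::finite, 'm::{t2_space, second_countable_topology}) atlas"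
    and F :: "'m \<Rightarrow> real^'k"
    and N :: "'m \<Rightarrow> real^'k"
    and \<sigma> :: "'m measure"
    and a b \<alpha> :: real
  assumes "CARD('k) = CARD('n) + 1"
    and "immersed_hypersurface \<A> F"
    and "complete_immersed F"
    and "properly_immersed F"
    and "self_expander \<A> F"
    and "unit_normal \<A> F N"
    and "volume_measure \<A> F \<sigma>"
    and "0 \<le> a" "a < 1/2" "b > 0"
    and "\<And>p. \<bar>mean_curvature \<A> F N p\<bar> \<le> a * norm (F p) + b"
    and "\<alpha> > a\<^sup>2 / (1/4 - a\<^sup>2)"
  shows "bottom_spectrum \<A> F \<sigma> \<le>
    ereal (((\<alpha> + 1) * real CARD('n) + 2) / 4) +
    ext_integral \<sigma> (\<lambda>p.
        (scalar_curvature \<A> F N p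
          + (\<alpha> - 1) * ((1/2) * (mean_curvature \<A> F N p)\<^sup>2
                       - (\<alpha> + 1) / 16 * (norm (pos_tangential \<A> F p))\<^sup>2))
        * exp (- (\<alpha>/4) * (norm (F p))\<^sup>2))
    / ext_integral \<sigma> (\<lambda>p. exp (- (\<alpha>/4) * (norm (F p))\<^sup>2))"
proof -
  interpret expander_hypersurface \<A> F N \<sigma>
    by unfold_locales (use assms in auto)
  show ?thesis by (rule bottom_spectrum_bound) (use assms in auto)
qed

end
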